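(* Let $\Sigma$ be an infinite group. Every pseudofield $K$ (with respect to $\Sigma$) embeds into a difference closed pseudofield; that is, there exist a difference closed pseudofield $L$ and an injective difference homomorphism $K\to L$.
   Context: Fix the group $\Sigma$. A difference ring is a commutative associative ring with $1$ on which $\Sigma$ acts by ring automorphisms. A difference homomorphism is a unital ring homomorphism commuting with the action of $\Sigma$. A difference ideal is an ideal $\mathfrak a$ with $\sigma(\mathfrak a)\subseteq\mathfrak a$ for all $\sigma\in\Sigma$. A difference ring is simple if the zero ideal is its unique proper difference ideal. A pseudofield is a simple difference ring that is absolutely flat (i.e. von Neumann regular). For a difference ring $A$ and a set $Y$, the ring of difference polynomials $A\{Y\}$ is the polynomial ring over $A$ in the variables $\sigma y$ ($\sigma\in\Sigma$, $y\in Y$), with $\Sigma$ acting on $A$ as given and on variables by $\sigma(\tau y)=(\sigma\tau)y$. If $B$ is a difference ring containing $A$ as a difference subring, $f\in A\{Y\}$ is evaluated at a point $b\in B^Y$ by substituting $\sigma(b_y)$ for $\sigma y$; $b$ is a common zero of $E\subseteq A\{Y\}$ if all $f\in E$ vanish at $b$. A pseudofield $A$ is called difference closed if it satisfies the following two conditions (which are equivalent for pseudofields): (A1) for every natural number $n$ and every proper difference ideal $\mathfrak a\subseteq A\{y_1,\dots,y_n\}$, there is a common zero for $\mathfrak a$ in $A^n$; (A2) for every natural number $n$ and every subset $E\subseteq A\{y_1,\dots,y_n\}$, if there exists a common zero for $E$ in $B^n$ for some difference ring $B$ containing $A$, then there exists a common zero for $E$ in $A^n$. *)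

theory Defs
  imports "HOL-Algebra.Indexed_Polynomials" "HOL-Algebra.Group_Action"
begin

section \<open>Difference rings and pseudofields\<close>

locale difference_ring =
  group_action S "carrier R" act + cring R
  for S (structure) and R (structure) and act +
  assumes act_ring_hom: "\<sigma> \<in> carrier S \<Longrightarrow> act \<sigma> \<in> ring_hom R R"

definition difference_ideal ::
  "('s, 'x) monoid_scheme \<Rightarrow> ('a, 'm) ring_scheme \<Rightarrow> ('s \<Rightarrow> 'a \<Rightarrow> 'a) \<Rightarrow> 'a set \<Rightarrow> bool" where
  "difference_ideal S R act I \<longleftrightarrow> ideal I R \<and> (\<forall>\<sigma>\<in>carrier S. act \<sigma> ` I \<subseteq> I)"

definition difference_hom ::
  "('s, 'x) monoid_scheme \<Rightarrow> ('a, 'm) ring_scheme \<Rightarrow> ('s \<Rightarrow> 'a \<Rightarrow> 'a) \<Rightarrow>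
     ('b, 'n) ring_scheme \<Rightarrow> ('s \<Rightarrow> 'b \<Rightarrow> 'b) \<Rightarrow> ('a \<Rightarrow> 'b) set" where
  "difference_hom S R actR T actT =
     {h \<in> ring_hom R T. \<forall>\<sigma>\<in>carrier S. \<forall>x\<in>carrier R. h (actR \<sigma> x) = actT \<sigma> (h x)}"

definition absolutely_flat :: "('a, 'm) ring_scheme \<Rightarrow> bool" where
  "absolutely_flat R \<longleftrightarrow>
     (\<forall>x\<in>carrier R. \<exists>y\<in>carrier R. x = x \<otimes>\<^bsub>R\<^esub> y \<otimes>\<^bsub>R\<^esub> x)"

locale simple_difference_ring = difference_ring +
  assumes simple: "{I. difference_ideal S R act I \<and> I \<noteq> carrier R} = {{\<zero>\<^bsub>R\<^esub>}}"

locale pseudofield = simple_difference_ring +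
  assumes absolutely_flat: "absolutely_flat R"


section \<open>Difference polynomials\<close>

text \<open>As in \<^theory>\<open>HOL-Algebra.Indexed_Polynomials\<close>, a monomial is a multiset of variables and
  a polynomial maps each monomial to its coefficient. That theory supplies the carrier, the
  constants and the addition, but no multiplication of two polynomials.\<close>

definition indexed_poly_ring ::
  "('a, 'm) ring_scheme \<Rightarrow> 'v set \<Rightarrow> ('v multiset \<Rightarrow> 'a) ring" where
  "indexed_poly_ring R V =
     \<lparr> carrier = ring.indexed_pset R V (carrier R),
       monoid.mult = (\<lambda>p q m. \<Oplus>\<^bsub>R\<^esub>k\<in>{k. k \<subseteq># m}. p k \<otimes>\<^bsub>R\<^esub> q (m - k)),
       one = ring.indexed_const R \<one>\<^bsub>R\<^esub>,
       ring.zero = ring.indexed_const R \<zero>\<^bsub>R\<^esub>,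
       add = ring.indexed_padd R \<rparr>"

text \<open>The pair \<open>(\<tau>, i)\<close> with \<open>i < n\<close> stands for the variable \<open>\<tau> y\<^sub>i\<close>.\<close>

definition diff_vars :: "('s, 'x) monoid_scheme \<Rightarrow> nat \<Rightarrow> ('s \<times> nat) set" where
  "diff_vars S n = carrier S \<times> {..<n}"

definition diff_poly_ring ::
  "('s, 'x) monoid_scheme \<Rightarrow> ('a, 'm) ring_scheme \<Rightarrow> nat \<Rightarrow> (('s \<times> nat) multiset \<Rightarrow> 'a) ring" where
  "diff_poly_ring S R n = indexed_poly_ring R (diff_vars S n)"

text \<open>Since \<open>\<sigma> (\<tau> y\<^sub>i) = (\<sigma> \<tau>) y\<^sub>i\<close>, the coefficient of \<open>\<sigma> f\<close> at \<open>m\<close> comes from the coefficient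
  of \<open>f\<close> at the monomial obtained from \<open>m\<close> by applying the inverse of \<open>\<sigma>\<close> to its variables. The
  case distinction is needed because the group operations are unspecified outside the carrier.
  The action is restricted to the carrier, as \<^locale>\<open>group_action\<close> requires.\<close>

definition diff_poly_act ::
  "('s, 'x) monoid_scheme \<Rightarrow> ('a, 'm) ring_scheme \<Rightarrow> ('s \<Rightarrow> 'a \<Rightarrow> 'a) \<Rightarrow> nat \<Rightarrow>
     's \<Rightarrow> (('s \<times> nat) multiset \<Rightarrow> 'a) \<Rightarrow> (('s \<times> nat) multiset \<Rightarrow> 'a)" where
  "diff_poly_act S R act n \<sigma> =
     (\<lambda>f\<in>carrier (diff_poly_ring S R n). \<lambda>m.
        if set_mset m \<subseteq> diff_vars S n
        then act \<sigma> (f (image_mset (\<lambda>(\<tau>, i). (inv\<^bsub>S\<^esub> \<sigma> \<otimes>\<^bsub>S\<^esub> \<tau>, i)) m))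
        else \<zero>\<^bsub>R\<^esub>)"

text \<open>Evaluation at a point \<open>b\<close> of a difference ring \<open>B\<close> into which the coefficient ring \<open>A\<close> is
  embedded by \<open>\<iota>\<close>: the variable \<open>\<tau> y\<^sub>i\<close> is replaced by \<open>\<tau> (b i)\<close>.\<close>

definition diff_eval ::
  "('a, 'm) ring_scheme \<Rightarrow> ('b, 'n) ring_scheme \<Rightarrow> ('s \<Rightarrow> 'b \<Rightarrow> 'b) \<Rightarrow> ('a \<Rightarrow> 'b) \<Rightarrow>
     (nat \<Rightarrow> 'b) \<Rightarrow> (('s \<times> nat) multiset \<Rightarrow> 'a) \<Rightarrow> 'b" where
  "diff_eval A B actB \<iota> b f =
     (\<Oplus>\<^bsub>B\<^esub>m\<in>{m. f m \<noteq> \<zero>\<^bsub>A\<^esub>}.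
        \<iota> (f m) \<otimes>\<^bsub>B\<^esub> (\<Otimes>\<^bsub>B\<^esub>v\<in>set_mset m. actB (fst v) (b (snd v)) [^]\<^bsub>B\<^esub> count m v))"

definition common_zero ::
  "('a, 'm) ring_scheme \<Rightarrow> ('b, 'n) ring_scheme \<Rightarrow> ('s \<Rightarrow> 'b \<Rightarrow> 'b) \<Rightarrow> ('a \<Rightarrow> 'b) \<Rightarrow>
     nat \<Rightarrow> (('s \<times> nat) multiset \<Rightarrow> 'a) set \<Rightarrow> (nat \<Rightarrow> 'b) \<Rightarrow> bool" where
  "common_zero A B actB \<iota> n E b \<longleftrightarrow>
     b \<in> {..<n} \<rightarrow>\<^sub>E carrier B \<and> (\<forall>f\<in>E. diff_eval A B actB \<iota> b f = \<zero>\<^bsub>B\<^esub>)"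


section \<open>Difference closed pseudofields\<close>

definition ideal_zeros ::
  "('s, 'x) monoid_scheme \<Rightarrow> ('a, 'm) ring_scheme \<Rightarrow> ('s \<Rightarrow> 'a \<Rightarrow> 'a) \<Rightarrow> bool" where
  "ideal_zeros S A act \<longleftrightarrow>
     (\<forall>n I. difference_ideal S (diff_poly_ring S A n) (diff_poly_act S A act n) I \<and>
            I \<noteq> carrier (diff_poly_ring S A n) \<longrightarrow>
        (\<exists>a. common_zero A A act (\<lambda>x. x) n I a))"

text \<open>The condition on \<open>B\<close>: it is a difference ring containing \<open>A\<close> (along \<open>\<iota>\<close>) in which \<open>E\<close> has a
  common zero.\<close>

definition zero_in_extension ::
  "('s, 'x) monoid_scheme \<Rightarrow> ('a, 'm) ring_scheme \<Rightarrow> ('s \<Rightarrow> 'a \<Rightarrow> 'a) \<Rightarrow> nat \<Rightarrow>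
     (('s \<times> nat) multiset \<Rightarrow> 'a) set \<Rightarrow> ('b, 'n) ring_scheme \<Rightarrow> bool" where
  "zero_in_extension S A act n E B \<longleftrightarrow>
     (\<exists>actB \<iota> b. difference_ring S B actB \<and>
        \<iota> \<in> difference_hom S A act B actB \<and> inj_on \<iota> (carrier A) \<and>
        common_zero A B actB \<iota> n E b)"

text \<open>A definition cannot quantify over the type of the elements of \<open>B\<close>. The type below is that of
  the quotients of \<open>A{y\<^sub>1, \<dots>, y\<^sub>n}\<close>, which is large enough: if \<open>E\<close> vanishes at a point \<open>b\<close> of some
  \<open>B\<close>, then it also has a zero in the difference subring generated by \<open>A\<close> and \<open>b\<close>, and this is a
  quotient of \<open>A{y\<^sub>1, \<dots>, y\<^sub>n}\<close>. Lemma \<open>difference_closed_extension\<close> below gives the condition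
  for \<open>B\<close> of an arbitrary type.\<close>

definition extension_zeros ::
  "('s, 'x) monoid_scheme \<Rightarrow> ('a, 'm) ring_scheme \<Rightarrow> ('s \<Rightarrow> 'a \<Rightarrow> 'a) \<Rightarrow> bool" where
  "extension_zeros S A act \<longleftrightarrow>
     (\<forall>n E. E \<subseteq> carrier (diff_poly_ring S A n) \<and>
            (\<exists>B :: (('s \<times> nat) multiset \<Rightarrow> 'a) set ring. zero_in_extension S A act n E B) \<longrightarrow>
        (\<exists>a. common_zero A A act (\<lambda>x. x) n E a))"

definition difference_closed ::
  "('s, 'x) monoid_scheme \<Rightarrow> ('a, 'm) ring_scheme \<Rightarrow> ('s \<Rightarrow> 'a \<Rightarrow> 'a) \<Rightarrow> bool" where
  "difference_closed S A act \<longleftrightarrow>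
     pseudofield S A act \<and> ideal_zeros S A act \<and> extension_zeros S A act"


section \<open>The extension condition for arbitrary types\<close>

subsection \<open>The ring of indexed polynomials\<close>

lemma finite_subset_mset: "finite {k. k \<subseteq># (m :: 'v multiset)}"
proof (induction m)
  case (add x m)
  have "{k. k \<subseteq># add_mset x m} \<subseteq> {k. k \<subseteq># m} \<union> add_mset x ` {k. k \<subseteq># m}"
  proof
    fix k assume "k \<in> {k. k \<subseteq># add_mset x m}"
    hence k: "k \<subseteq># add_mset x m" by simp
    show "k \<in> {k. k \<subseteq># m} \<union> add_mset x ` {k. k \<subseteq># m}"
    proof (cases "x \<in># k")
      case True
      then obtain l where l: "k = add_mset x l" by (metis insert_DiffM)
      thus ?thesis using k by auto
    next
      case False
      hence "k \<subseteq># m" using k by (metis diff_single_trivial subset_eq_diff_conv add_mset_add_single)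
      thus ?thesis by simp
    qed
  qed
  thus ?case using add finite_subset by blast
qed auto

context cring
begin

definition poly_conv :: "('v multiset \<Rightarrow> 'a) \<Rightarrow> ('v multiset \<Rightarrow> 'a) \<Rightarrow> ('v multiset \<Rightarrow> 'a)" where
  "poly_conv p q = (\<lambda>m. \<Oplus>k\<in>{k. k \<subseteq># m}. p k \<otimes> q (m - k))"

definition poly_smul :: "'a \<Rightarrow> ('v multiset \<Rightarrow> 'a) \<Rightarrow> ('v multiset \<Rightarrow> 'a)" where
  "poly_smul c q = (\<lambda>m. c \<otimes> q m)"

lemma pset_coeff: "p \<in> indexed_pset V (carrier R) \<Longrightarrow> p m \<in> carrier R"
  using indexed_pset_in_carrier[of "carrier R" p V] carrier_coeffE by blast

lemma conv_closed: "(\<And>m. p m \<in> carrier R) \<Longrightarrow> (\<And>m. q m \<in> carrier R) \<Longrightarrow> poly_conv p q m \<in> carrier R"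
  by (auto simp: poly_conv_def intro!: finsum_closed)

lemma conv_const:
  assumes "c \<in> carrier R" "\<And>m. q m \<in> carrier R"
  shows "poly_conv (indexed_const c) q = poly_smul c q"
proof
  note [simp] = poly_conv_def poly_smul_def
  fix m
  have "(\<Oplus>k\<in>{{#}}. indexed_const c k \<otimes> q (m - k)) = poly_conv (indexed_const c) q m"
    unfolding poly_conv_def by (rule add.finprod_mono_neutral_cong_left)
       (use assms in \<open>auto simp: finite_subset_mset indexed_const_def\<close>)
  thus "poly_conv (indexed_const c) q m = poly_smul c q m"
    using assms by (simp add: indexed_const_def del: poly_conv_def)
qed

lemma conv_padd:
  assumes "\<And>m. p m \<in> carrier R" "\<And>m. p' m \<in> carrier R" "\<And>m. q m \<in> carrier R"
  shows "poly_conv (indexed_padd p p') q = indexed_padd (poly_conv p q) (poly_conv p' q)"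
proof
  note [simp] = poly_conv_def poly_smul_def
  fix m
  have "poly_conv (indexed_padd p p') q m = (\<Oplus>k\<in>{k. k \<subseteq># m}. p k \<otimes> q (m - k) \<oplus> p' k \<otimes> q (m - k))"
    unfolding poly_conv_def using assms by (intro finsum_cong') (auto simp: indexed_padd_def l_distr)
  also have "\<dots> = poly_conv p q m \<oplus> poly_conv p' q m"
    unfolding poly_conv_def using assms by (intro finsum_addf) auto
  finally show "poly_conv (indexed_padd p p') q m = indexed_padd (poly_conv p q) (poly_conv p' q) m"
    by (simp add: indexed_padd_def)
qed

lemma conv_pmult:
  assumes "\<And>m. p m \<in> carrier R" "\<And>m. q m \<in> carrier R"
  shows "poly_conv (indexed_pmult p i) q = indexed_pmult (poly_conv p q) i"
proof
  note [simp] = poly_conv_def poly_smul_def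
  fix m
  let ?f = "\<lambda>k. indexed_pmult p i k \<otimes> q (m - k)"
  have cl: "\<And>k. ?f k \<in> carrier R" using assms by (auto simp: indexed_pmult_def)
  show "poly_conv (indexed_pmult p i) q m = indexed_pmult (poly_conv p q) i m"
  proof (cases "i \<in># m")
    case True
    then obtain n where n: "m = add_mset i n" by (metis insert_DiffM)
    have "poly_conv (indexed_pmult p i) q m = (\<Oplus>k\<in>add_mset i ` {k. k \<subseteq># n}. ?f k)"
      unfolding poly_conv_def
    proof (rule add.finprod_mono_neutral_cong_right)
      show "?f k = \<zero>" if "k \<in> {k. k \<subseteq># m} - add_mset i ` {k. k \<subseteq># n}" for k
      proof -
        have "i \<notin># k"
        proof
          assume "i \<in># k"
          then obtain l where l: "k = add_mset i l" by (metis insert_DiffM)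
          thus False using that n by auto
        qed
        thus ?thesis using assms by (simp add: indexed_pmult_def)
      qed
    qed (use n cl in \<open>auto simp: finite_subset_mset\<close>)
    also have "\<dots> = (\<Oplus>k\<in>{k. k \<subseteq># n}. ?f (add_mset i k))"
      by (rule finsum_reindex) (use cl in \<open>auto simp: inj_on_def\<close>)
    also have "\<dots> = poly_conv p q n"
      unfolding poly_conv_def by (rule finsum_cong') (use assms in \<open>auto simp: indexed_pmult_def n\<close>)
    finally show ?thesis by (simp add: indexed_pmult_def n)
  next
    case False
    have "poly_conv (indexed_pmult p i) q m = (\<Oplus>k\<in>{k. k \<subseteq># m}. \<zero>)"
      unfolding poly_conv_def
    proof (rule finsum_cong')
      fix k assume "k \<in> {k. k \<subseteq># m}"
      hence "i \<notin># k" using False by (auto dest: mset_subset_eqD)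
      thus "?f k = \<zero>" using assms by (simp add: indexed_pmult_def)
    qed auto
    thus ?thesis using False by (simp add: indexed_pmult_def)
  qed
qed

lemma conv_comm:
  fixes p q :: "'v multiset \<Rightarrow> 'a"
  assumes "\<And>m. p m \<in> carrier R" "\<And>m. q m \<in> carrier R"
  shows "poly_conv p q = poly_conv q p"
proof
  note [simp] = poly_conv_def poly_smul_def
  fix m :: "'v multiset"
  have im: "(\<lambda>k. m - k) ` {k. k \<subseteq># m} = {k. k \<subseteq># m}"
  proof (intro equalityI subsetI)
    fix k assume "k \<in> {k. k \<subseteq># m}"
    hence "k = m - (m - k)" "m - k \<subseteq># m"
      by (auto simp: multiset_eq_iff subseteq_mset_def le_diff_iff')
    thus "k \<in> (\<lambda>k. m - k) ` {k. k \<subseteq># m}" by blast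
  qed auto
  have inj: "inj_on (\<lambda>k. m - k) {k. k \<subseteq># m}"
    by (rule inj_on_inverseI[where g = "\<lambda>k. m - k"])
       (auto simp: multiset_eq_iff subseteq_mset_def)
  have "poly_conv p q m = (\<Oplus>k\<in>(\<lambda>k. m - k) ` {k. k \<subseteq># m}. p k \<otimes> q (m - k))"
    by (simp add: im)
  also have "\<dots> = (\<Oplus>k\<in>{k. k \<subseteq># m}. p (m - k) \<otimes> q (m - (m - k)))"
    by (rule finsum_reindex) (use assms inj in auto)
  also have "\<dots> = poly_conv q p m"
    unfolding poly_conv_def
  proof (rule finsum_cong')
    fix k assume "k \<in> {k. k \<subseteq># m}"
    hence "m - (m - k) = k" by (auto simp: multiset_eq_iff subseteq_mset_def)
    thus "p (m - k) \<otimes> q (m - (m - k)) = q k \<otimes> p (m - k)" using assms by (simp add: m_comm)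
  qed (use assms in auto)
  finally show "poly_conv p q m = poly_conv q p m" .
qed

lemma smul_pset:
  assumes "c \<in> carrier R" "q \<in> indexed_pset V (carrier R)"
  shows "poly_smul c q \<in> indexed_pset V (carrier R)"
  using assms(2)
proof induction
  case (indexed_const k)
  have *: "poly_smul c (indexed_const k) = indexed_const (c \<otimes> k)"
    using assms(1) by (auto simp: indexed_const_def poly_smul_def)
  show ?case unfolding * using assms(1) indexed_const by (auto intro: indexed_pset.indexed_const)
next
  case (indexed_padd P Q)
  have "poly_smul c (indexed_padd P Q) = indexed_padd (poly_smul c P) (poly_smul c Q)"
    using assms(1) indexed_padd by (auto simp: indexed_padd_def poly_smul_def r_distr pset_coeff)
  thus ?case using indexed_padd by (auto intro: indexed_pset.indexed_padd)
next
  case (indexed_pmult P i)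
  have "poly_smul c (indexed_pmult P i) = indexed_pmult (poly_smul c P) i"
    using assms(1) by (auto simp: indexed_pmult_def poly_smul_def)
  thus ?case using indexed_pmult by (auto intro: indexed_pset.indexed_pmult)
qed

lemma conv_pset:
  assumes "p \<in> indexed_pset V (carrier R)" "q \<in> indexed_pset V (carrier R)"
  shows "poly_conv p q \<in> indexed_pset V (carrier R)"
  using assms(1)
proof induction
  case (indexed_const k)
  thus ?case using assms(2) by (simp add: conv_const pset_coeff smul_pset)
next
  case (indexed_padd P Q)
  thus ?case using assms(2)
    by (simp add: conv_padd pset_coeff) (rule indexed_pset.indexed_padd)
next
  case (indexed_pmult P i)
  thus ?case using assms(2)
    by (simp add: conv_pmult pset_coeff) (rule indexed_pset.indexed_pmult)
qed

lemma conv_assoc: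
  assumes "p \<in> indexed_pset V (carrier R)"
    and q: "q \<in> indexed_pset V (carrier R)" and r: "r \<in> indexed_pset V (carrier R)"
  shows "poly_conv (poly_conv p q) r = poly_conv p (poly_conv q r)"
  using assms(1)
proof induction
  case (indexed_const k)
  have "poly_conv (poly_smul k q) r m = poly_smul k (poly_conv q r) m" for m
  proof -
    have "poly_conv (poly_smul k q) r m = (\<Oplus>l\<in>{l. l \<subseteq># m}. k \<otimes> (q l \<otimes> r (m - l)))"
      unfolding poly_conv_def poly_smul_def
      by (rule finsum_cong') (use indexed_const pset_coeff[OF q] pset_coeff[OF r] in \<open>auto simp: m_assoc\<close>)
    also have "\<dots> = poly_smul k (poly_conv q r) m"
      unfolding poly_conv_def poly_smul_def
      by (rule finsum_rdistr[symmetric])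
         (use indexed_const pset_coeff[OF q] pset_coeff[OF r] in \<open>auto simp: finite_subset_mset\<close>)
    finally show ?thesis .
  qed
  hence "poly_conv (poly_smul k q) r = poly_smul k (poly_conv q r)" by (rule ext)
  moreover have "poly_conv (indexed_const k) (poly_conv q r) = poly_smul k (poly_conv q r)"
    by (rule conv_const) (use indexed_const pset_coeff[OF q] pset_coeff[OF r] in \<open>auto intro!: conv_closed\<close>)
  moreover have "poly_conv (indexed_const k) q = poly_smul k q"
    by (rule conv_const) (use indexed_const q in \<open>auto intro!: pset_coeff\<close>)
  ultimately show ?case by simp
next
  case (indexed_padd P Q)
  note c = pset_coeff[OF indexed_padd(1)] pset_coeff[OF indexed_padd(2)] pset_coeff[OF q] pset_coeff[OF r]
    pset_coeff[OF conv_pset[OF indexed_padd(1) q]] pset_coeff[OF conv_pset[OF indexed_padd(2) q]]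
    pset_coeff[OF conv_pset[OF q r]]
  show ?case
    using indexed_padd(3,4) conv_padd[of P Q q, OF c(1,2,3)] conv_padd[of "poly_conv P q" "poly_conv Q q" r, OF c(5,6,4)]
      conv_padd[of P Q "poly_conv q r", OF c(1,2,7)]
    by simp
next
  case (indexed_pmult P i)
  note c = pset_coeff[OF indexed_pmult(1)] pset_coeff[OF q] pset_coeff[OF r]
    pset_coeff[OF conv_pset[OF indexed_pmult(1) q]] pset_coeff[OF conv_pset[OF q r]]
  show ?case
    using indexed_pmult(3) conv_pmult[of P q, OF c(1,2)] conv_pmult[of "poly_conv P q" r, OF c(4,3)]
      conv_pmult[of P "poly_conv q r", OF c(1,5)]
    by simp
qed

lemma indexed_poly_ring_simps:
  "carrier (indexed_poly_ring R V) = indexed_pset V (carrier R)"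
  "x \<otimes>\<^bsub>indexed_poly_ring R V\<^esub> y = poly_conv x y"
  "\<one>\<^bsub>indexed_poly_ring R V\<^esub> = indexed_const \<one>"
  "\<zero>\<^bsub>indexed_poly_ring R V\<^esub> = indexed_const \<zero>"
  "x \<oplus>\<^bsub>indexed_poly_ring R V\<^esub> y = indexed_padd x y"
  by (simp_all add: indexed_poly_ring_def poly_conv_def)

lemma cring_indexed_poly_ring: "cring (indexed_poly_ring R V)"
proof (rule cringI)
  note [intro] = indexed_pset.intros
  note d = indexed_poly_ring_simps
  show "abelian_group (indexed_poly_ring R V)"
  proof (rule abelian_groupI)
    fix x assume "x \<in> carrier (indexed_poly_ring R V)"
    hence x: "x \<in> indexed_pset V (carrier R)" by (simp add: d)
    have "indexed_padd (poly_smul (\<ominus> \<one>) x) x = indexed_const \<zero>"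
      using pset_coeff[OF x] by (auto simp: poly_smul_def indexed_padd_def indexed_const_def l_minus l_neg)
    thus "\<exists>y\<in>carrier (indexed_poly_ring R V).
        y \<oplus>\<^bsub>indexed_poly_ring R V\<^esub> x = \<zero>\<^bsub>indexed_poly_ring R V\<^esub>"
      using smul_pset[OF _ x, of "\<ominus> \<one>"] by (auto simp: d)
  next
    show "\<zero>\<^bsub>indexed_poly_ring R V\<^esub> \<in> carrier (indexed_poly_ring R V)" by (auto simp: d)
  next
    fix x y assume "x \<in> carrier (indexed_poly_ring R V)" "y \<in> carrier (indexed_poly_ring R V)"
    thus "x \<oplus>\<^bsub>indexed_poly_ring R V\<^esub> y \<in> carrier (indexed_poly_ring R V)" by (auto simp: d)
  qed (auto simp: d indexed_padd_def indexed_const_def pset_coeff a_ac)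
  show "comm_monoid (indexed_poly_ring R V)"
  proof (rule comm_monoidI)
    fix x assume "x \<in> carrier (indexed_poly_ring R V)"
    hence x: "x \<in> indexed_pset V (carrier R)" by (simp add: d)
    show "\<one>\<^bsub>indexed_poly_ring R V\<^esub> \<otimes>\<^bsub>indexed_poly_ring R V\<^esub> x = x"
      using pset_coeff[OF x] by (simp add: d conv_const poly_smul_def)
  next
    fix x y assume "x \<in> carrier (indexed_poly_ring R V)" "y \<in> carrier (indexed_poly_ring R V)"
    hence "x \<in> indexed_pset V (carrier R)" "y \<in> indexed_pset V (carrier R)" by (simp_all add: d)
    from conv_comm[OF pset_coeff[OF this(1)] pset_coeff[OF this(2)]]
    show "x \<otimes>\<^bsub>indexed_poly_ring R V\<^esub> y = y \<otimes>\<^bsub>indexed_poly_ring R V\<^esub> x" by (simp add: d)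
  qed (auto simp: d intro: conv_pset conv_assoc)
  fix x y z
  assume "x \<in> carrier (indexed_poly_ring R V)" "y \<in> carrier (indexed_poly_ring R V)"
    "z \<in> carrier (indexed_poly_ring R V)"
  hence "x \<in> indexed_pset V (carrier R)" "y \<in> indexed_pset V (carrier R)"
    "z \<in> indexed_pset V (carrier R)" by (simp_all add: d)
  from conv_padd[OF pset_coeff[OF this(1)] pset_coeff[OF this(2)] pset_coeff[OF this(3)]]
  show "(x \<oplus>\<^bsub>indexed_poly_ring R V\<^esub> y) \<otimes>\<^bsub>indexed_poly_ring R V\<^esub> z =
        x \<otimes>\<^bsub>indexed_poly_ring R V\<^esub> z \<oplus>\<^bsub>indexed_poly_ring R V\<^esub> y \<otimes>\<^bsub>indexed_poly_ring R V\<^esub> z"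
    by (simp add: d)
qed

lemma pset_support:
  assumes "p \<in> indexed_pset V (carrier R)"
  shows "finite {m. p m \<noteq> \<zero>} \<and> (\<forall>m. p m \<noteq> \<zero> \<longrightarrow> set_mset m \<subseteq> V)"
  using assms
proof induction
  case (indexed_const k)
  have "{m. indexed_const k m \<noteq> \<zero>} \<subseteq> {{#}}" by (auto simp: indexed_const_def)
  thus ?case by (auto simp: indexed_const_def intro: finite_subset split: if_splits)
next
  case (indexed_padd P Q)
  have "{m. indexed_padd P Q m \<noteq> \<zero>} \<subseteq> {m. P m \<noteq> \<zero>} \<union> {m. Q m \<noteq> \<zero>}"
    by (auto simp: indexed_padd_def)
  moreover have "P m \<noteq> \<zero> \<or> Q m \<noteq> \<zero>" if "indexed_padd P Q m \<noteq> \<zero>" for m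
    using that by (auto simp: indexed_padd_def)
  ultimately show ?case using indexed_padd(3,4) by (meson finite_UnI finite_subset)
next
  case (indexed_pmult P i)
  have *: "m \<in> add_mset i ` {m. P m \<noteq> \<zero>}" if "indexed_pmult P i m \<noteq> \<zero>" for m
    using that by (auto simp: indexed_pmult_def image_iff split: if_splits intro!: exI[of _ "m - {#i#}"])
  hence "{m. indexed_pmult P i m \<noteq> \<zero>} \<subseteq> add_mset i ` {m. P m \<noteq> \<zero>}" by blast
  hence "finite {m. indexed_pmult P i m \<noteq> \<zero>}"
    using indexed_pmult(3) finite_subset by blast
  moreover have "set_mset m \<subseteq> V" if "indexed_pmult P i m \<noteq> \<zero>" for m
    using *[OF that] indexed_pmult(2,3) by fastforce
  ultimately show ?case by blast
qed

end


subsection \<open>Evaluation\<close>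

locale poly_eval = ring_hom_cring R S h
  for R (structure) and S (structure) and h +
  fixes V :: "'v set" and t :: "'v \<Rightarrow> 'c"
  assumes t_closed: "v \<in> V \<Longrightarrow> t v \<in> carrier S"
begin

definition monom_val :: "'v multiset \<Rightarrow> 'c" where
  "monom_val m = (\<Otimes>\<^bsub>S\<^esub>v\<in>set_mset m. t v [^]\<^bsub>S\<^esub> count m v)"

definition poly_val :: "('v multiset \<Rightarrow> 'a) \<Rightarrow> 'c" where
  "poly_val f = (\<Oplus>\<^bsub>S\<^esub>m\<in>{m. f m \<noteq> \<zero>\<^bsub>R\<^esub>}. h (f m) \<otimes>\<^bsub>S\<^esub> monom_val m)"

lemma monom_val_closed: "set_mset m \<subseteq> V \<Longrightarrow> monom_val m \<in> carrier S"
  unfolding monom_val_def by (rule S.finprod_closed) (use t_closed in auto)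

lemma monom_val_add_mset:
  assumes "v \<in> V" "set_mset m \<subseteq> V"
  shows "monom_val (add_mset v m) = t v \<otimes>\<^bsub>S\<^esub> monom_val m"
proof -
  let ?A = "set_mset m - {v}"
  let ?Q = "\<Otimes>\<^bsub>S\<^esub>u\<in>?A. t u [^]\<^bsub>S\<^esub> count m u"
  have tv: "t v \<in> carrier S" using assms t_closed by auto
  have Q: "?Q \<in> carrier S" using assms t_closed by (intro S.finprod_closed) auto
  have ins: "(\<Otimes>\<^bsub>S\<^esub>u\<in>insert v ?A. t u [^]\<^bsub>S\<^esub> count M u)
      = t v [^]\<^bsub>S\<^esub> count M v \<otimes>\<^bsub>S\<^esub> (\<Otimes>\<^bsub>S\<^esub>u\<in>?A. t u [^]\<^bsub>S\<^esub> count M u)" for M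
    using assms t_closed by (intro S.finprod_insert) auto
  have 1: "monom_val (add_mset v m) = t v [^]\<^bsub>S\<^esub> Suc (count m v) \<otimes>\<^bsub>S\<^esub> ?Q"
  proof -
    have "set_mset (add_mset v m) = insert v ?A" by auto
    moreover have "(\<Otimes>\<^bsub>S\<^esub>u\<in>?A. t u [^]\<^bsub>S\<^esub> count (add_mset v m) u) = ?Q"
      by (rule S.finprod_cong') (use assms t_closed in auto)
    ultimately show ?thesis using ins[of "add_mset v m"] by (simp add: monom_val_def)
  qed
  have 2: "monom_val m = t v [^]\<^bsub>S\<^esub> count m v \<otimes>\<^bsub>S\<^esub> ?Q"
  proof (cases "v \<in># m")
    case True
    hence "set_mset m = insert v ?A" by auto
    thus ?thesis using ins[of m] by (simp add: monom_val_def)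
  next
    case False
    hence "set_mset m = ?A" "count m v = 0" by (auto simp: not_in_iff)
    thus ?thesis using Q by (simp add: monom_val_def)
  qed
  show ?thesis unfolding 1 2 using tv Q by (simp add: S.m_ac)
qed

lemma poly_val_superset:
  assumes "\<And>m. f m \<in> carrier R" "finite F" "{m. f m \<noteq> \<zero>} \<subseteq> F" "\<And>m. m \<in> F \<Longrightarrow> set_mset m \<subseteq> V"
  shows "poly_val f = (\<Oplus>\<^bsub>S\<^esub>m\<in>F. h (f m) \<otimes>\<^bsub>S\<^esub> monom_val m)"
  unfolding poly_val_def
  by (rule S.add.finprod_mono_neutral_cong_left) (use assms monom_val_closed in auto)

lemma poly_val_const:
  assumes "c \<in> carrier R"
  shows "poly_val (R.indexed_const c) = h c"
proof -
  have "poly_val (R.indexed_const c) = (\<Oplus>\<^bsub>S\<^esub>m\<in>{{#}}. h (R.indexed_const c m) \<otimes>\<^bsub>S\<^esub> monom_val m)"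
    by (rule poly_val_superset) (use assms in \<open>auto simp: R.indexed_const_def split: if_splits\<close>)
  thus ?thesis using assms by (simp add: R.indexed_const_def monom_val_def)
qed

lemma poly_val_padd:
  assumes p: "p \<in> R.indexed_pset V (carrier R)" and q: "q \<in> R.indexed_pset V (carrier R)"
  shows "poly_val (R.indexed_padd p q) = poly_val p \<oplus>\<^bsub>S\<^esub> poly_val q"
proof -
  let ?F = "{m. p m \<noteq> \<zero>} \<union> {m. q m \<noteq> \<zero>}"
  note c = R.pset_coeff[OF p] R.pset_coeff[OF q]
  have F: "finite ?F" "\<And>m. m \<in> ?F \<Longrightarrow> set_mset m \<subseteq> V"
    using R.pset_support[OF p] R.pset_support[OF q] by auto
  have "poly_val (R.indexed_padd p q)
      = (\<Oplus>\<^bsub>S\<^esub>m\<in>?F. h (R.indexed_padd p q m) \<otimes>\<^bsub>S\<^esub> monom_val m)"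
    by (rule poly_val_superset[OF _ F(1) _ F(2)]) (use c in \<open>auto simp: R.indexed_padd_def\<close>)
  also have "\<dots> = (\<Oplus>\<^bsub>S\<^esub>m\<in>?F. h (p m) \<otimes>\<^bsub>S\<^esub> monom_val m \<oplus>\<^bsub>S\<^esub> h (q m) \<otimes>\<^bsub>S\<^esub> monom_val m)"
    by (rule S.finsum_cong')
       (use c F(2) monom_val_closed in \<open>auto simp: R.indexed_padd_def S.l_distr\<close>)
  also have "\<dots> = (\<Oplus>\<^bsub>S\<^esub>m\<in>?F. h (p m) \<otimes>\<^bsub>S\<^esub> monom_val m) \<oplus>\<^bsub>S\<^esub> (\<Oplus>\<^bsub>S\<^esub>m\<in>?F. h (q m) \<otimes>\<^bsub>S\<^esub> monom_val m)"
    by (rule S.finsum_addf) (use c F(2) monom_val_closed in auto)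
  also have "(\<Oplus>\<^bsub>S\<^esub>m\<in>?F. h (p m) \<otimes>\<^bsub>S\<^esub> monom_val m) = poly_val p"
    by (rule poly_val_superset[symmetric, OF _ F(1) _ F(2)]) (use c in auto)
  also have "(\<Oplus>\<^bsub>S\<^esub>m\<in>?F. h (q m) \<otimes>\<^bsub>S\<^esub> monom_val m) = poly_val q"
    by (rule poly_val_superset[symmetric, OF _ F(1) _ F(2)]) (use c in auto)
  finally show ?thesis .
qed

lemma poly_val_pmult:
  assumes p: "p \<in> R.indexed_pset V (carrier R)" and i: "i \<in> V"
  shows "poly_val (R.indexed_pmult p i) = t i \<otimes>\<^bsub>S\<^esub> poly_val p"
proof -
  let ?G = "{m. p m \<noteq> \<zero>}"
  let ?F = "add_mset i ` ?G"
  note c = R.pset_coeff[OF p]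
  have G: "finite ?G" "\<And>m. m \<in> ?G \<Longrightarrow> set_mset m \<subseteq> V"
    using R.pset_support[OF p] by auto
  have F: "finite ?F" "\<And>m. m \<in> ?F \<Longrightarrow> set_mset m \<subseteq> V" using G i by fastforce+
  have sub: "{m. R.indexed_pmult p i m \<noteq> \<zero>} \<subseteq> ?F"
    by (auto simp: R.indexed_pmult_def image_iff split: if_splits
             intro!: exI[of _ "m - {#i#}" for m])
  have "poly_val (R.indexed_pmult p i)
      = (\<Oplus>\<^bsub>S\<^esub>m\<in>?F. h (R.indexed_pmult p i m) \<otimes>\<^bsub>S\<^esub> monom_val m)"
    by (rule poly_val_superset[OF _ F(1) sub F(2)]) (use c in \<open>auto simp: R.indexed_pmult_def\<close>)
  also have "\<dots> = (\<Oplus>\<^bsub>S\<^esub>m\<in>?G. h (R.indexed_pmult p i (add_mset i m)) \<otimes>\<^bsub>S\<^esub> monom_val (add_mset i m))"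
    by (rule S.finsum_reindex)
       (use c G(2) i monom_val_closed in \<open>auto simp: R.indexed_pmult_def inj_on_def\<close>)
  also have "\<dots> = (\<Oplus>\<^bsub>S\<^esub>m\<in>?G. t i \<otimes>\<^bsub>S\<^esub> (h (p m) \<otimes>\<^bsub>S\<^esub> monom_val m))"
  proof (rule S.finsum_cong')
    fix m assume "m \<in> ?G"
    hence m: "set_mset m \<subseteq> V" using G by blast
    thus "h (R.indexed_pmult p i (add_mset i m)) \<otimes>\<^bsub>S\<^esub> monom_val (add_mset i m)
        = t i \<otimes>\<^bsub>S\<^esub> (h (p m) \<otimes>\<^bsub>S\<^esub> monom_val m)"
      using c[of m] i t_closed monom_val_closed[OF m]
      by (simp add: R.indexed_pmult_def monom_val_add_mset S.m_lcomm)
  qed (use c G(2) i t_closed monom_val_closed in auto)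
  also have "\<dots> = t i \<otimes>\<^bsub>S\<^esub> poly_val p"
    unfolding poly_val_def
    by (rule S.finsum_rdistr[symmetric]) (use c G i t_closed monom_val_closed in auto)
  finally show ?thesis .
qed

lemma poly_val_closed: "p \<in> R.indexed_pset V (carrier R) \<Longrightarrow> poly_val p \<in> carrier S"
  by (induction rule: R.indexed_pset.induct)
     (auto simp: poly_val_const poly_val_padd poly_val_pmult t_closed)

lemma poly_val_smul:
  assumes "c \<in> carrier R" "q \<in> R.indexed_pset V (carrier R)"
  shows "poly_val (R.poly_smul c q) = h c \<otimes>\<^bsub>S\<^esub> poly_val q"
  using assms(2)
proof (induction rule: R.indexed_pset.induct)
  case (indexed_const k)
  have "R.poly_smul c (R.indexed_const k) = (R.indexed_const (c \<otimes> k) :: 'v multiset \<Rightarrow> 'a)"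
    using assms(1) by (auto simp: R.indexed_const_def R.poly_smul_def)
  thus ?case using assms(1) indexed_const by (simp add: poly_val_const)
next
  case (indexed_padd P Q)
  have "R.poly_smul c (R.indexed_padd P Q) = R.indexed_padd (R.poly_smul c P) (R.poly_smul c Q)"
    using assms(1) indexed_padd by (auto simp: R.indexed_padd_def R.poly_smul_def R.r_distr R.pset_coeff)
  thus ?case using indexed_padd assms(1)
    by (simp add: poly_val_padd R.smul_pset poly_val_closed S.r_distr)
next
  case (indexed_pmult P i)
  have "R.poly_smul c (R.indexed_pmult P i) = R.indexed_pmult (R.poly_smul c P) i"
    using assms(1) by (auto simp: R.indexed_pmult_def R.poly_smul_def)
  thus ?case using indexed_pmult assms(1)
    by (simp add: poly_val_pmult R.smul_pset poly_val_closed t_closed S.m_lcomm)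
qed

lemma poly_val_conv:
  assumes "p \<in> R.indexed_pset V (carrier R)" and q: "q \<in> R.indexed_pset V (carrier R)"
  shows "poly_val (R.poly_conv p q) = poly_val p \<otimes>\<^bsub>S\<^esub> poly_val q"
  using assms(1)
proof (induction rule: R.indexed_pset.induct)
  case (indexed_const k)
  thus ?case using R.conv_const[of k q] R.pset_coeff[OF q] q
    by (simp add: poly_val_smul poly_val_const)
next
  case (indexed_padd P Q)
  thus ?case
    using R.conv_padd[of P Q q] R.pset_coeff[OF q] R.pset_coeff[of P V] R.pset_coeff[of Q V] q
    by (simp add: poly_val_padd R.conv_pset poly_val_closed S.l_distr)
next
  case (indexed_pmult P i)
  thus ?case
    using R.conv_pmult[of P q i] R.pset_coeff[OF q] R.pset_coeff[of P V] q
    by (simp add: poly_val_pmult R.conv_pset poly_val_closed S.m_assoc t_closed)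
qed

lemma poly_val_hom: "poly_val \<in> ring_hom (indexed_poly_ring R V) S"
proof (rule ring_hom_memI)
  fix p q assume "p \<in> carrier (indexed_poly_ring R V)" "q \<in> carrier (indexed_poly_ring R V)"
  hence "p \<in> R.indexed_pset V (carrier R)" "q \<in> R.indexed_pset V (carrier R)"
    by (simp_all add: R.indexed_poly_ring_simps)
  thus "poly_val (p \<otimes>\<^bsub>indexed_poly_ring R V\<^esub> q) = poly_val p \<otimes>\<^bsub>S\<^esub> poly_val q"
    "poly_val (p \<oplus>\<^bsub>indexed_poly_ring R V\<^esub> q) = poly_val p \<oplus>\<^bsub>S\<^esub> poly_val q"
    by (simp_all add: R.indexed_poly_ring_simps poly_val_conv poly_val_padd)
qed (auto simp: R.indexed_poly_ring_simps poly_val_closed poly_val_const)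

end


subsection \<open>The difference ring of difference polynomials\<close>

context difference_ring
begin

lemma act_closed: "\<sigma> \<in> carrier S \<Longrightarrow> x \<in> carrier R \<Longrightarrow> act \<sigma> x \<in> carrier R"
  using element_image by blast

lemma act_zero: "\<sigma> \<in> carrier S \<Longrightarrow> act \<sigma> \<zero>\<^bsub>R\<^esub> = \<zero>\<^bsub>R\<^esub>"
  using ring_hom_cring.hom_zero[of R R "act \<sigma>"] act_ring_hom cring_axioms
  by (simp add: ring_hom_cring_def ring_hom_cring_axioms_def)

lemma act_add: "\<sigma> \<in> carrier S \<Longrightarrow> x \<in> carrier R \<Longrightarrow> y \<in> carrier R \<Longrightarrow>
    act \<sigma> (x \<oplus>\<^bsub>R\<^esub> y) = act \<sigma> x \<oplus>\<^bsub>R\<^esub> act \<sigma> y"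
  using ring_hom_add[OF act_ring_hom] by simp

lemma act_mult: "\<sigma> \<in> carrier S \<Longrightarrow> x \<in> carrier R \<Longrightarrow> y \<in> carrier R \<Longrightarrow>
    act \<sigma> (x \<otimes>\<^bsub>R\<^esub> y) = act \<sigma> x \<otimes>\<^bsub>R\<^esub> act \<sigma> y"
  using ring_hom_mult[OF act_ring_hom] by simp

lemma act_unit: "\<sigma> \<in> carrier S \<Longrightarrow> act \<sigma> \<one>\<^bsub>R\<^esub> = \<one>\<^bsub>R\<^esub>"
  using ring_hom_one[OF act_ring_hom] by simp

lemma group_S: "Group.group S"
  using group_hom group_hom.axioms(1) by blast

abbreviation dp_set :: "nat \<Rightarrow> (('a \<times> nat) multiset \<Rightarrow> 'c) set" where
  "dp_set n \<equiv> indexed_pset (diff_vars S n) (carrier R)"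

abbreviation dp_act :: "nat \<Rightarrow> 'a \<Rightarrow> (('a \<times> nat) multiset \<Rightarrow> 'c) \<Rightarrow> (('a \<times> nat) multiset \<Rightarrow> 'c)" where
  "dp_act n \<equiv> diff_poly_act S R act n"

lemma diff_poly_carrier: "carrier (diff_poly_ring S R n) = dp_set n"
  by (simp add: diff_poly_ring_def indexed_poly_ring_simps)

lemma dp_act_apply:
  "f \<in> dp_set n \<Longrightarrow> dp_act n \<sigma> f m =
     (if set_mset m \<subseteq> diff_vars S n
      then act \<sigma> (f (image_mset (\<lambda>(\<tau>, i). (inv\<^bsub>S\<^esub> \<sigma> \<otimes>\<^bsub>S\<^esub> \<tau>, i)) m)) else \<zero>\<^bsub>R\<^esub>)"
  by (simp add: diff_poly_act_def diff_poly_carrier)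

lemma dp_act_const:
  assumes "\<sigma> \<in> carrier S" "k \<in> carrier R"
  shows "dp_act n \<sigma> (indexed_const k) = indexed_const (act \<sigma> k)"
proof
  fix m
  have "indexed_const k \<in> dp_set n" using assms by (auto intro: indexed_pset.indexed_const)
  thus "dp_act n \<sigma> (indexed_const k) m = indexed_const (act \<sigma> k) m"
    using assms by (auto simp: dp_act_apply indexed_const_def act_zero)
qed

lemma dp_act_padd:
  assumes "\<sigma> \<in> carrier S" and P: "P \<in> dp_set n" and Q: "Q \<in> dp_set n"
  shows "dp_act n \<sigma> (indexed_padd P Q) = indexed_padd (dp_act n \<sigma> P) (dp_act n \<sigma> Q)"
proof
  fix m
  have "indexed_padd P Q \<in> dp_set n" using P Q by (auto intro: indexed_pset.indexed_padd)
  thus "dp_act n \<sigma> (indexed_padd P Q) m = indexed_padd (dp_act n \<sigma> P) (dp_act n \<sigma> Q) m"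
    using assms pset_coeff[OF P] pset_coeff[OF Q] by (simp add: dp_act_apply) (simp add: indexed_padd_def dp_act_apply act_add)
qed

lemma dp_act_pmult:
  assumes \<sigma>: "\<sigma> \<in> carrier S" and P: "P \<in> dp_set n" and v: "(\<tau>, j) \<in> diff_vars S n"
  shows "dp_act n \<sigma> (indexed_pmult P (\<tau>, j)) = indexed_pmult (dp_act n \<sigma> P) (\<sigma> \<otimes>\<^bsub>S\<^esub> \<tau>, j)"
proof
  fix m
  interpret G: Group.group S by (rule group_S)
  let ?g = "\<lambda>(\<rho>, i). (inv\<^bsub>S\<^esub> \<sigma> \<otimes>\<^bsub>S\<^esub> \<rho>, i :: nat)"
  have \<tau>: "\<tau> \<in> carrier S" "j < n" using v by (auto simp: diff_vars_def)
  have v': "(\<sigma> \<otimes>\<^bsub>S\<^esub> \<tau>, j) \<in> diff_vars S n" using \<sigma> \<tau> by (auto simp: diff_vars_def)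
  have g: "?g (\<sigma> \<otimes>\<^bsub>S\<^esub> \<tau>, j) = (\<tau>, j)" using \<sigma> \<tau> by (simp add: G.m_assoc[symmetric])
  have P': "indexed_pmult P (\<tau>, j) \<in> dp_set n" using P v by (rule indexed_pset.indexed_pmult)
  show "dp_act n \<sigma> (indexed_pmult P (\<tau>, j)) m = indexed_pmult (dp_act n \<sigma> P) (\<sigma> \<otimes>\<^bsub>S\<^esub> \<tau>, j) m"
  proof (cases "set_mset m \<subseteq> diff_vars S n")
    case True
    show ?thesis
    proof (cases "(\<sigma> \<otimes>\<^bsub>S\<^esub> \<tau>, j) \<in># m")
      case mem: True
      then obtain l where l: "m = add_mset (\<sigma> \<otimes>\<^bsub>S\<^esub> \<tau>, j) l" by (metis insert_DiffM)
      have im: "image_mset ?g m = add_mset (\<tau>, j) (image_mset ?g l)"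
        unfolding l image_mset_add_mset g ..
      show ?thesis using True l P P' im by (simp add: dp_act_apply indexed_pmult_def del: image_mset_add_mset)
    next
      case False
      have "(\<tau>, j) \<notin># image_mset ?g m"
      proof
        assume "(\<tau>, j) \<in># image_mset ?g m"
        then obtain \<rho> where \<rho>: "(\<rho>, j) \<in># m" "\<tau> = inv\<^bsub>S\<^esub> \<sigma> \<otimes>\<^bsub>S\<^esub> \<rho>" by auto
        hence "\<rho> \<in> carrier S" using True by (auto simp: diff_vars_def)
        hence "\<sigma> \<otimes>\<^bsub>S\<^esub> \<tau> = \<rho>" using \<sigma> \<rho> by (simp add: G.m_assoc[symmetric])
        thus False using False \<rho> by simp
      qed
      thus ?thesis using True False P' \<sigma> by (simp add: dp_act_apply indexed_pmult_def act_zero)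
    qed
  next
    case False
    hence "\<not> set_mset (m - {#(\<sigma> \<otimes>\<^bsub>S\<^esub> \<tau>, j)#}) \<subseteq> diff_vars S n" using v'
      by (metis insert_DiffM insert_subset set_mset_add_mset_insert diff_single_trivial)
    thus ?thesis using False P P' by (simp add: dp_act_apply indexed_pmult_def)
  qed
qed

lemma dp_act_closed:
  assumes "\<sigma> \<in> carrier S" "P \<in> dp_set n"
  shows "dp_act n \<sigma> P \<in> dp_set n"
  using assms(2)
proof (induction rule: indexed_pset.induct)
  case (indexed_const k)
  thus ?case using assms(1) by (auto simp: dp_act_const act_closed intro: indexed_pset.indexed_const)
next
  case (indexed_padd P Q)
  thus ?case using assms(1) by (auto simp: dp_act_padd intro: indexed_pset.indexed_padd)
next
  case (indexed_pmult P i)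
  obtain \<tau> j where i: "i = (\<tau>, j)" by fastforce
  interpret G: Group.group S by (rule group_S)
  show ?case using indexed_pmult assms(1) unfolding i
    by (auto simp: dp_act_pmult diff_vars_def intro!: indexed_pset.indexed_pmult)
qed

lemma dp_act_smul:
  assumes "\<sigma> \<in> carrier S" "c \<in> carrier R" and Q: "Q \<in> dp_set n"
  shows "dp_act n \<sigma> (poly_smul c Q) = poly_smul (act \<sigma> c) (dp_act n \<sigma> Q)"
proof
  fix m
  show "dp_act n \<sigma> (poly_smul c Q) m = poly_smul (act \<sigma> c) (dp_act n \<sigma> Q) m"
    using assms smul_pset[OF assms(2) Q] pset_coeff[OF Q]
    by (simp add: dp_act_apply poly_smul_def act_mult act_closed)
qed

lemma dp_act_conv:
  assumes \<sigma>: "\<sigma> \<in> carrier S" and "P \<in> dp_set n" and Q: "Q \<in> dp_set n"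
  shows "dp_act n \<sigma> (poly_conv P Q) = poly_conv (dp_act n \<sigma> P) (dp_act n \<sigma> Q)"
  using assms(2)
proof (induction rule: indexed_pset.induct)
  case (indexed_const k)
  thus ?case using \<sigma> Q conv_const[of k Q] conv_const[of "act \<sigma> k" "dp_act n \<sigma> Q"]
      pset_coeff[OF Q] pset_coeff[OF dp_act_closed[OF \<sigma> Q]]
    by (simp add: dp_act_const dp_act_smul act_closed)
next
  case (indexed_padd P P')
  note c = pset_coeff[OF indexed_padd(1)] pset_coeff[OF indexed_padd(2)] pset_coeff[OF Q]
     pset_coeff[OF dp_act_closed[OF \<sigma> indexed_padd(1)]]
     pset_coeff[OF dp_act_closed[OF \<sigma> indexed_padd(2)]] pset_coeff[OF dp_act_closed[OF \<sigma> Q]]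
  show ?case
    using indexed_padd conv_padd[of P P' Q, OF c(1-3)]
      conv_padd[of "dp_act n \<sigma> P" "dp_act n \<sigma> P'" "dp_act n \<sigma> Q", OF c(4-6)] \<sigma> Q
    by (simp add: dp_act_padd conv_pset)
next
  case (indexed_pmult P i)
  obtain \<tau> j where i: "i = (\<tau>, j)" by fastforce
  note c = pset_coeff[OF indexed_pmult(1)] pset_coeff[OF Q]
     pset_coeff[OF dp_act_closed[OF \<sigma> indexed_pmult(1)]] pset_coeff[OF dp_act_closed[OF \<sigma> Q]]
  show ?case
    using indexed_pmult conv_pmult[of P Q i, OF c(1,2)]
      conv_pmult[of "dp_act n \<sigma> P" "dp_act n \<sigma> Q" "(\<sigma> \<otimes>\<^bsub>S\<^esub> \<tau>, j)", OF c(3,4)] \<sigma> Q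
    unfolding i by (simp add: dp_act_pmult conv_pset)
qed

lemma dp_act_id:
  assumes "P \<in> dp_set n"
  shows "dp_act n \<one>\<^bsub>S\<^esub> P = P"
proof
  fix m
  interpret G: Group.group S by (rule group_S)
  show "dp_act n \<one>\<^bsub>S\<^esub> P m = P m"
  proof (cases "set_mset m \<subseteq> diff_vars S n")
    case True
    have "image_mset (\<lambda>(\<tau>, i). (inv\<^bsub>S\<^esub> \<one>\<^bsub>S\<^esub> \<otimes>\<^bsub>S\<^esub> \<tau>, i)) m = image_mset (\<lambda>x. x) m"
      by (rule image_mset_cong) (use True in \<open>auto simp: diff_vars_def\<close>)
    moreover have "act \<one>\<^bsub>S\<^esub> (P m) = P m"
      using id_eq_one pset_coeff[OF assms, of m] by (metis restrict_apply')
    ultimately show ?thesis using True assms by (simp add: dp_act_apply)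
  next
    case False
    hence "P m = \<zero>\<^bsub>R\<^esub>" using pset_support[OF assms] by blast
    thus ?thesis using False assms by (simp add: dp_act_apply)
  qed
qed

lemma dp_act_comp:
  assumes \<sigma>: "\<sigma> \<in> carrier S" and \<tau>: "\<tau> \<in> carrier S" and P: "P \<in> dp_set n"
  shows "dp_act n (\<sigma> \<otimes>\<^bsub>S\<^esub> \<tau>) P = dp_act n \<sigma> (dp_act n \<tau> P)"
proof
  fix m
  interpret G: Group.group S by (rule group_S)
  let ?g = "\<lambda>\<sigma> (\<rho>, i). (inv\<^bsub>S\<^esub> \<sigma> \<otimes>\<^bsub>S\<^esub> \<rho>, i :: nat)"
  note P' = dp_act_closed[OF \<tau> P]
  show "dp_act n (\<sigma> \<otimes>\<^bsub>S\<^esub> \<tau>) P m = dp_act n \<sigma> (dp_act n \<tau> P) m"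
  proof (cases "set_mset m \<subseteq> diff_vars S n")
    case True
    have "set_mset (image_mset (?g \<sigma>) m) \<subseteq> diff_vars S n"
      using True \<sigma> by (auto simp: diff_vars_def)
    moreover have "image_mset (?g \<tau>) (image_mset (?g \<sigma>) m) = image_mset (?g (\<sigma> \<otimes>\<^bsub>S\<^esub> \<tau>)) m"
      unfolding multiset.map_comp
      by (rule image_mset_cong)
         (use True \<sigma> \<tau> in \<open>auto simp: diff_vars_def G.inv_mult_group G.m_assoc\<close>)
    ultimately show ?thesis
      using True P P' composition_rule[OF pset_coeff[OF P] \<sigma> \<tau>] by (simp add: dp_act_apply)
  qed (use P P' in \<open>simp add: dp_act_apply\<close>)
qed

lemma difference_ring_diff_poly:
  "difference_ring S (diff_poly_ring S R n) (dp_act n)"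
proof -
  interpret G: Group.group S by (rule group_S)
  have Bij: "dp_act n \<sigma> \<in> Bij (dp_set n)" if \<sigma>: "\<sigma> \<in> carrier S" for \<sigma>
  proof -
    have "bij_betw (dp_act n \<sigma>) (dp_set n) (dp_set n)"
      by (rule bij_betw_byWitness[where f' = "dp_act n (inv\<^bsub>S\<^esub> \<sigma>)"])
         (use \<sigma> dp_act_closed in \<open>auto simp: dp_act_comp[symmetric] dp_act_id\<close>)
    moreover have "dp_act n \<sigma> \<in> extensional (dp_set n)"
      by (simp add: diff_poly_act_def diff_poly_carrier)
    ultimately show ?thesis by (simp add: Bij_def)
  qed
  have comp: "dp_act n (\<sigma> \<otimes>\<^bsub>S\<^esub> \<tau>) = compose (dp_set n) (dp_act n \<sigma>) (dp_act n \<tau>)"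
    if "\<sigma> \<in> carrier S" "\<tau> \<in> carrier S" for \<sigma> \<tau>
    by (rule extensionalityI[where A = "dp_set n"])
       (use that Bij[THEN Bij_imp_extensional] in \<open>auto simp: compose_def dp_act_comp\<close>)
  have "group_action S (dp_set n) (dp_act n)"
    unfolding group_action_def group_hom_def group_hom_axioms_def
    using group_S group_BijGroup Bij comp by (auto simp: hom_def BijGroup_def)
  moreover have "cring (diff_poly_ring S R n)"
    unfolding diff_poly_ring_def by (rule cring_indexed_poly_ring)
  moreover have "dp_act n \<sigma> \<in> ring_hom (diff_poly_ring S R n) (diff_poly_ring S R n)"
    if "\<sigma> \<in> carrier S" for \<sigma>
    unfolding diff_poly_ring_def
    by (rule ring_hom_memI)
       (use that in \<open>auto simp: indexed_poly_ring_simps dp_act_closed dp_act_conv dp_act_padd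
          dp_act_const act_unit\<close>)
  ultimately show ?thesis
    by (simp add: difference_ring_def difference_ring_axioms_def diff_poly_carrier)
qed

lemma
  assumes B: "difference_ring S B actB" and \<iota>: "\<iota> \<in> difference_hom S R act B actB"
    and b: "b \<in> {..<n} \<rightarrow>\<^sub>E carrier B"
  shows diff_eval_hom: "diff_eval R B actB \<iota> b \<in> ring_hom (diff_poly_ring S R n) B"
    and diff_eval_act: "\<And>\<sigma> f. \<sigma> \<in> carrier S \<Longrightarrow> f \<in> carrier (diff_poly_ring S R n) \<Longrightarrow>
          diff_eval R B actB \<iota> b (dp_act n \<sigma> f) = actB \<sigma> (diff_eval R B actB \<iota> b f)"
proof -
  interpret G: Group.group S by (rule group_S)
  interpret B: difference_ring S B actB by (rule B)
  define t where "t = (\<lambda>v. actB (fst v) (b (snd v)))"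
  interpret ev: poly_eval R B \<iota> "diff_vars S n" t
  proof (intro poly_eval.intro ring_hom_cring.intro ring_hom_cring_axioms.intro poly_eval_axioms.intro)
    show "\<iota> \<in> ring_hom R B" using \<iota> by (simp add: difference_hom_def)
    fix v assume "v \<in> diff_vars S n"
    hence "fst v \<in> carrier S" "snd v < n" by (auto simp: diff_vars_def)
    moreover from this b have "b (snd v) \<in> carrier B" by auto
    ultimately show "t v \<in> carrier B" unfolding t_def by (intro B.act_closed)
  qed (rule cring_axioms B.cring_axioms)+
  have val: "diff_eval R B actB \<iota> b = ev.poly_val"
    unfolding diff_eval_def[abs_def] ev.poly_val_def[abs_def] ev.monom_val_def
    by (simp add: t_def)
  show "diff_eval R B actB \<iota> b \<in> ring_hom (diff_poly_ring S R n) B"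
    unfolding val diff_poly_ring_def by (rule ev.poly_val_hom)
  fix \<sigma> f assume \<sigma>: "\<sigma> \<in> carrier S" and f: "f \<in> carrier (diff_poly_ring S R n)"
  from f have "f \<in> dp_set n" by (simp add: diff_poly_carrier)
  thus "diff_eval R B actB \<iota> b (dp_act n \<sigma> f) = actB \<sigma> (diff_eval R B actB \<iota> b f)"
    unfolding val
  proof (induction rule: indexed_pset.induct)
    case (indexed_const k)
    thus ?case using \<sigma> \<iota>
      by (simp add: dp_act_const ev.poly_val_const act_closed difference_hom_def)
  next
    case (indexed_padd P Q)
    thus ?case using \<sigma>
      by (simp add: dp_act_padd ev.poly_val_padd dp_act_closed ev.poly_val_closed B.act_add)
  next
    case (indexed_pmult P i)
    obtain \<tau> j where i: "i = (\<tau>, j)" by fastforce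
    have \<tau>: "\<tau> \<in> carrier S" "j < n" using indexed_pmult by (auto simp: i diff_vars_def)
    have v: "(\<sigma> \<otimes>\<^bsub>S\<^esub> \<tau>, j) \<in> diff_vars S n" using \<sigma> \<tau> by (auto simp: diff_vars_def)
    have "t (\<sigma> \<otimes>\<^bsub>S\<^esub> \<tau>, j) = actB \<sigma> (t i)"
      using b \<sigma> \<tau> B.composition_rule by (auto simp: t_def i)
    thus ?case using indexed_pmult \<sigma> v ev.t_closed[OF indexed_pmult(2)] unfolding i
      by (simp add: dp_act_pmult ev.poly_val_pmult dp_act_closed ev.poly_val_closed B.act_mult)
  qed
qed

end

lemma difference_closed_extension:
  assumes "difference_closed S A act" and E: "E \<subseteq> carrier (diff_poly_ring S A n)"
    and "zero_in_extension S A act n E B"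
  shows "\<exists>a. common_zero A A act (\<lambda>x. x) n E a"
proof -
  interpret A: pseudofield S A act using assms by (simp add: difference_closed_def)
  from assms(3) obtain actB \<iota> b where B: "difference_ring S B actB"
    and \<iota>: "\<iota> \<in> difference_hom S A act B actB" "inj_on \<iota> (carrier A)"
    and zero: "common_zero A B actB \<iota> n E b" by (auto simp: zero_in_extension_def)
  interpret B: difference_ring S B actB by (rule B)
  have b: "b \<in> {..<n} \<rightarrow>\<^sub>E carrier B" using zero by (simp add: common_zero_def)
  have P: "difference_ring S (diff_poly_ring S A n) (diff_poly_act S A act n)"
    by (rule A.difference_ring_diff_poly)
  have P_ring: "ring (diff_poly_ring S A n)"
    using P by (simp add: difference_ring_def cring_def)
  let ?ev = "diff_eval A B actB \<iota> b"
  have ev: "ring_hom_ring (diff_poly_ring S A n) B ?ev"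
    by (intro ring_hom_ring.intro ring_hom_ring_axioms.intro P_ring B.ring_axioms
          A.diff_eval_hom[OF B \<iota>(1) b])
  let ?I = "a_kernel (diff_poly_ring S A n) B ?ev"
  have "difference_ideal S (diff_poly_ring S A n) (diff_poly_act S A act n) ?I"
    unfolding difference_ideal_def
    using ring_hom_ring.kernel_is_ideal[OF ev]
    by (auto simp: a_kernel_def' A.diff_eval_act[OF B \<iota>(1) b] B.act_zero difference_ring.act_closed[OF P])
  moreover have "?I \<noteq> carrier (diff_poly_ring S A n)"
  proof
    assume "?I = carrier (diff_poly_ring S A n)"
    hence "?ev \<one>\<^bsub>diff_poly_ring S A n\<^esub> = \<zero>\<^bsub>B\<^esub>" using ring.ring_simprules(6)[OF P_ring]
      by (auto simp: a_kernel_def')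
    hence "\<one>\<^bsub>B\<^esub> = \<zero>\<^bsub>B\<^esub>"
      using ring_hom_one[OF A.diff_eval_hom[OF B \<iota>(1) b]] by simp
    moreover interpret \<iota>: ring_hom_cring A B \<iota>
      by (intro ring_hom_cring.intro ring_hom_cring_axioms.intro A.cring_axioms B.cring_axioms)
         (use \<iota> in \<open>simp add: difference_hom_def\<close>)
    have "\<iota> \<one>\<^bsub>A\<^esub> = \<one>\<^bsub>B\<^esub>" "\<iota> \<zero>\<^bsub>A\<^esub> = \<zero>\<^bsub>B\<^esub>" by simp_all
    ultimately have "\<one>\<^bsub>A\<^esub> = \<zero>\<^bsub>A\<^esub>"
      using inj_onD[OF \<iota>(2), of "\<one>\<^bsub>A\<^esub>" "\<zero>\<^bsub>A\<^esub>"] by simp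
    hence "carrier A = {\<zero>\<^bsub>A\<^esub>}" using A.one_zeroD by blast
    thus False using A.simple by blast
  qed
  ultimately obtain a where "common_zero A A act (\<lambda>x. x) n ?I a"
    using assms(1) unfolding difference_closed_def ideal_zeros_def by blast
  moreover have "E \<subseteq> ?I" using E zero by (auto simp: a_kernel_def' common_zero_def)
  ultimately show ?thesis unfolding common_zero_def by blast
qed

end

theory Submission
  imports Defs
begin

text \<open>Every proper difference ideal \<open>I\<close> of a difference ring \<open>R\<close> is killed by a difference
  homomorphism to a pseudofield: take a maximal ideal \<open>q\<close> containing \<open>I\<close> and divide the ring of all
  functions from the group to \<open>R/q\<close> by a maximal difference ideal. Applied to difference polynomials,
  this gives zeros of proper difference ideals in larger pseudofields.

  A difference closed pseudofield is obtained as the union \<open>L\<close> of a chain. The difficulty is that an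
  ideal \<open>I\<close> of \<open>L{y\<^sub>1, \<dots>, y\<^sub>n}\<close> is in general not generated by few elements. It suffices, however,
  to solve only as many equations as there are monomials: modulo a maximal ideal \<open>p\<close> of \<open>L\<close>, a family
  of elements of \<open>I\<close>, one for each leading monomial, spans \<open>I\<close>, so at a common zero \<open>b\<close> of this
  family every \<open>f(b)\<close> with \<open>f \<in> I\<close> lies in \<open>p\<close>. The same holds for \<open>\<sigma>(f(b)) = (\<sigma> f)(b)\<close>, hence
  \<open>f(b) = 0\<close> because \<open>L\<close> is simple. The set of all such small families over \<open>L\<close> has a bounded
  cardinality, and a maximal chain decides all of them.\<close>

section \<open>Criteria for being a difference ring\<close>

text \<open>Bijectivity of \<open>act \<sigma>\<close> is a consequence of the action laws: the
  group inverse of \<open>\<sigma>\<close> acts as a two-sided inverse.\<close>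

lemma difference_ringI:
  assumes "Group.group S" "cring R"
    and ext: "\<And>\<sigma>. \<sigma> \<in> carrier S \<Longrightarrow> act \<sigma> \<in> extensional (carrier R)"
    and hom: "\<And>\<sigma>. \<sigma> \<in> carrier S \<Longrightarrow> act \<sigma> \<in> ring_hom R R"
    and one: "\<And>x. x \<in> carrier R \<Longrightarrow> act \<one>\<^bsub>S\<^esub> x = x"
    and mult: "\<And>\<sigma> \<tau> x. \<sigma> \<in> carrier S \<Longrightarrow> \<tau> \<in> carrier S \<Longrightarrow> x \<in> carrier R \<Longrightarrow>
      act (\<sigma> \<otimes>\<^bsub>S\<^esub> \<tau>) x = act \<sigma> (act \<tau> x)"
  shows "difference_ring S R act"
proof -
  interpret G: Group.group S by fact
  have cl: "act \<sigma> x \<in> carrier R" if "\<sigma> \<in> carrier S" "x \<in> carrier R" for \<sigma> x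
    using ring_hom_closed[OF hom] that .
  have Bij: "act \<sigma> \<in> Bij (carrier R)" if \<sigma>: "\<sigma> \<in> carrier S" for \<sigma>
  proof -
    have "bij_betw (act \<sigma>) (carrier R) (carrier R)"
      by (rule bij_betw_byWitness[where f' = "act (inv\<^bsub>S\<^esub> \<sigma>)"])
         (use \<sigma> cl in \<open>auto simp: mult[symmetric] one\<close>)
    thus ?thesis using ext[OF \<sigma>] by (simp add: Bij_def)
  qed
  have "act (\<sigma> \<otimes>\<^bsub>S\<^esub> \<tau>) = compose (carrier R) (act \<sigma>) (act \<tau>)"
    if "\<sigma> \<in> carrier S" "\<tau> \<in> carrier S" for \<sigma> \<tau>
    by (rule extensionalityI[where A = "carrier R"]) (use that ext in \<open>auto simp: compose_def mult\<close>)
  hence "group_action S (carrier R) act"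
    unfolding group_action_def group_hom_def group_hom_axioms_def
    using assms(1) group_BijGroup Bij by (auto simp: hom_def BijGroup_def)
  thus ?thesis
    using assms(2) hom by (simp add: difference_ring_def difference_ring_axioms_def)
qed

text \<open>Every element of \<open>T\<close> is a value of \<open>g\<close>, so the laws of the
  action descend along \<open>g\<close>. This serves both for quotients and for rings with renamed
  elements.\<close>

lemma (in difference_ring) difference_ring_hom_image:
  assumes "cring T" and g: "g \<in> ring_hom R T" and surj: "carrier T = g ` carrier R"
    and act: "\<And>\<sigma> x. \<sigma> \<in> carrier S \<Longrightarrow> x \<in> carrier R \<Longrightarrow> actT \<sigma> (g x) = g (act \<sigma> x)"
    and ext: "\<And>\<sigma>. \<sigma> \<in> carrier S \<Longrightarrow> actT \<sigma> \<in> extensional (carrier T)"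
  shows "difference_ring S T actT"
proof (rule difference_ringI)
  interpret G: Group.group S by (rule group_S)
  show "Group.group S" by (rule group_S)
  show "actT \<sigma> \<in> ring_hom T T" if \<sigma>: "\<sigma> \<in> carrier S" for \<sigma>
  proof (rule ring_hom_memI)
    show "actT \<sigma> \<one>\<^bsub>T\<^esub> = \<one>\<^bsub>T\<^esub>"
      using act[OF \<sigma> one_closed] act_unit[OF \<sigma>] ring_hom_one[OF g] by simp
  next
    fix x y assume "x \<in> carrier T" "y \<in> carrier T"
    then obtain a b where ab: "a \<in> carrier R" "b \<in> carrier R" "x = g a" "y = g b"
      using surj by auto
    show "actT \<sigma> (x \<otimes>\<^bsub>T\<^esub> y) = actT \<sigma> x \<otimes>\<^bsub>T\<^esub> actT \<sigma> y"
      using ab \<sigma> act[of \<sigma> "a \<otimes>\<^bsub>R\<^esub> b"] by (simp add: act act_mult act_closed ring_hom_mult[OF g])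
    show "actT \<sigma> (x \<oplus>\<^bsub>T\<^esub> y) = actT \<sigma> x \<oplus>\<^bsub>T\<^esub> actT \<sigma> y"
      using ab \<sigma> act[of \<sigma> "a \<oplus>\<^bsub>R\<^esub> b"] by (simp add: act act_add act_closed ring_hom_add[OF g])
  qed (use \<sigma> in \<open>auto simp: surj act intro: act_closed\<close>)
  show "actT \<one>\<^bsub>S\<^esub> x = x" if "x \<in> carrier T" for x
  proof -
    have "act \<one>\<^bsub>S\<^esub> a = a" if "a \<in> carrier R" for a
      using id_eq_one that by (metis restrict_apply')
    thus ?thesis using that by (auto simp: surj act)
  qed
  show "actT (\<sigma> \<otimes>\<^bsub>S\<^esub> \<tau>) x = actT \<sigma> (actT \<tau> x)"
    if "\<sigma> \<in> carrier S" "\<tau> \<in> carrier S" "x \<in> carrier T" for \<sigma> \<tau> x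
    using that composition_rule by (auto simp: surj act act_closed)
qed (use assms in auto)

section \<open>Difference ideals\<close>

text \<open>Lets one application of Zorn's lemma produce ordinary maximal ideals as well as maximal
  difference ideals.\<close>

lemma difference_ideal_trivial_action [simp]:
  "difference_ideal S R (\<lambda>\<sigma> x. x) I \<longleftrightarrow> ideal I R"
  by (auto simp: difference_ideal_def)

lemma (in ring) ideal_proper_iff: "ideal I R \<Longrightarrow> I \<noteq> carrier R \<longleftrightarrow> \<one> \<notin> I"
  using ideal.one_imp_carrier[of I R] one_closed by blast

text \<open>Zorn's lemma: the union of a chain of difference ideals avoiding 1 is again one. Since
  \<open>act\<close> is arbitrary here, the identity maps may be inserted for it to obtain a maximal
  ideal.\<close>

lemma (in ring) exists_maximal_difference_ideal:
  assumes I: "difference_ideal S R act I" "\<one> \<notin> I"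
  obtains N where "difference_ideal S R act N" "I \<subseteq> N" "\<one> \<notin> N"
    "\<And>J. difference_ideal S R act J \<Longrightarrow> N \<subseteq> J \<Longrightarrow> \<one> \<notin> J \<Longrightarrow> J = N"
proof -
  let ?A = "{J. difference_ideal S R act J \<and> I \<subseteq> J \<and> \<one> \<notin> J}"
  have "\<exists>N\<in>?A. \<forall>J\<in>?A. N \<subseteq> J \<longrightarrow> J = N"
  proof (rule subset_Zorn_nonempty)
    show "?A \<noteq> {}" using I by auto
    fix C assume C: "C \<noteq> {}" "subset.chain ?A C"
    have CA: "C \<subseteq> ?A" and lin: "\<And>J J'. J \<in> C \<Longrightarrow> J' \<in> C \<Longrightarrow> J \<subseteq> J' \<or> J' \<subseteq> J"
      using C(2) unfolding subset_chain_def by blast+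
    have id: "ideal J R" if "J \<in> C" for J using CA that by (auto simp: difference_ideal_def)
    have "ideal (\<Union>C) R"
    proof (rule idealI[OF ring_axioms])
      show "subgroup (\<Union>C) (add_monoid R)"
      proof
        show "\<Union>C \<subseteq> carrier (add_monoid R)" using ideal.Icarr[OF id] by auto
        show "\<one>\<^bsub>add_monoid R\<^esub> \<in> \<Union>C"
          using C(1) additive_subgroup.zero_closed[OF ideal.axioms(1)[OF id]] by auto
      next
        fix x y assume "x \<in> \<Union>C" "y \<in> \<Union>C"
        then obtain J J' where J: "J \<in> C" "J' \<in> C" "x \<in> J" "y \<in> J'" by blast
        then obtain J'' where "J'' \<in> C" "x \<in> J''" "y \<in> J''" using lin[of J J'] by blast
        thus "x \<otimes>\<^bsub>add_monoid R\<^esub> y \<in> \<Union>C"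
          using additive_subgroup.a_closed[OF ideal.axioms(1)[OF id], of J'' x y] by auto
      next
        fix x assume "x \<in> \<Union>C"
        then obtain J where "J \<in> C" "x \<in> J" by blast
        thus "inv\<^bsub>add_monoid R\<^esub> x \<in> \<Union>C"
          using additive_subgroup.a_inv_closed[OF ideal.axioms(1)[OF id]] by (auto simp: a_inv_def)
      qed
    next
      fix a x assume "a \<in> \<Union>C" and x: "x \<in> carrier R"
      then obtain J where J: "J \<in> C" "a \<in> J" by blast
      show "x \<otimes> a \<in> \<Union>C" "a \<otimes> x \<in> \<Union>C"
        using ideal.I_l_closed[OF id[OF J(1)] J(2) x] ideal.I_r_closed[OF id[OF J(1)] J(2) x] J(1)
        by blast+
    qed
    moreover have "act \<sigma> ` \<Union>C \<subseteq> \<Union>C" if "\<sigma> \<in> carrier S" for \<sigma>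
      using CA that unfolding difference_ideal_def by blast
    moreover have "I \<subseteq> \<Union>C" "\<one> \<notin> \<Union>C" using CA C(1) by blast+
    ultimately show "\<Union>C \<in> ?A" by (auto simp: difference_ideal_def)
  qed
  then obtain N where N: "N \<in> ?A" "\<And>J. J \<in> ?A \<Longrightarrow> N \<subseteq> J \<Longrightarrow> J = N" by auto
  show thesis by (rule that[of N]) (use N in auto)
qed

lemma difference_hom_ring_hom:
  "h \<in> difference_hom S R actR T actT \<Longrightarrow> h \<in> ring_hom R T"
  by (simp add: difference_hom_def)

lemma difference_hom_act:
  "h \<in> difference_hom S R actR T actT \<Longrightarrow> \<sigma> \<in> carrier S \<Longrightarrow> x \<in> carrier R \<Longrightarrow>
    h (actR \<sigma> x) = actT \<sigma> (h x)"
  by (simp add: difference_hom_def)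

lemma difference_hom_comp:
  assumes "h \<in> difference_hom S R actR T actT" "g \<in> difference_hom S T actT V actV"
  shows "(\<lambda>x. g (h x)) \<in> difference_hom S R actR V actV"
  using assms ring_hom_trans[of h R T g V] ring_hom_closed[of h R T]
  by (auto simp: difference_hom_def comp_def)

text \<open>Pulling back is how simplicity of \<open>R\<close> is exploited: a proper difference
  ideal of \<open>T\<close> has a proper preimage, which is zero if \<open>R\<close> is simple. With
  the zero ideal for \<open>J\<close> it treats kernels.\<close>

lemma difference_ideal_vimage:
  assumes "difference_ring S R actR" "difference_ring S T actT"
    and h: "h \<in> difference_hom S R actR T actT" and J: "difference_ideal S T actT J"
  shows "difference_ideal S R actR {x \<in> carrier R. h x \<in> J}"
proof -
  interpret R: difference_ring S R actR by fact
  interpret T: difference_ring S T actT by fact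
  interpret h: ring_hom_ring R T h
    by (rule ring_hom_ringI2[OF R.ring_axioms T.ring_axioms difference_hom_ring_hom[OF h]])
  have J': "ideal J T" using J by (simp add: difference_ideal_def)
  interpret J: ideal J T by (rule J')
  have "ideal {x \<in> carrier R. h x \<in> J} R"
    by (rule h.ideal_vimage[OF J'])
  moreover have "h (actR \<sigma> x) \<in> J" if "\<sigma> \<in> carrier S" "x \<in> carrier R" "h x \<in> J" for \<sigma> x
    using J that by (auto simp: difference_ideal_def difference_hom_act[OF h])
  ultimately show ?thesis using R.act_closed by (auto simp: difference_ideal_def)
qed

section \<open>Pseudofields as quotients of coinduced rings\<close>

text \<open>The condition \<open>1 \<noteq> 0\<close> makes the zero ideal proper, and properness of
  the other ideals is phrased by 1, which homomorphisms preserve.\<close>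

lemma simple_difference_ringI:
  assumes "difference_ring S R act" and "\<one>\<^bsub>R\<^esub> \<noteq> \<zero>\<^bsub>R\<^esub>"
    and max: "\<And>I. difference_ideal S R act I \<Longrightarrow> \<one>\<^bsub>R\<^esub> \<notin> I \<Longrightarrow> I \<subseteq> {\<zero>\<^bsub>R\<^esub>}"
  shows "simple_difference_ring S R act"
proof -
  interpret difference_ring S R act by fact
  have "difference_ideal S R act {\<zero>\<^bsub>R\<^esub>}"
    using zeroideal act_zero by (auto simp: difference_ideal_def)
  moreover have "I = {\<zero>\<^bsub>R\<^esub>}" if I: "difference_ideal S R act I" "I \<noteq> carrier R" for I
  proof -
    have id: "ideal I R" using I by (simp add: difference_ideal_def)
    thus ?thesis using max[OF I(1)] ideal_proper_iff[OF id] I(2)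
        additive_subgroup.zero_closed[OF ideal.axioms(1)[OF id]] by auto
  qed
  moreover have "{\<zero>\<^bsub>R\<^esub>} \<noteq> carrier R" using assms(2) one_closed by blast
  ultimately have "{I. difference_ideal S R act I \<and> I \<noteq> carrier R} = {{\<zero>\<^bsub>R\<^esub>}}" by blast
  with assms(1) show ?thesis
    unfolding simple_difference_ring_def simple_difference_ring_axioms_def by (rule conjI)
qed

lemma (in simple_difference_ring) one_not_zero: "\<one>\<^bsub>R\<^esub> \<noteq> \<zero>\<^bsub>R\<^esub>"
proof
  assume "\<one>\<^bsub>R\<^esub> = \<zero>\<^bsub>R\<^esub>"
  hence "carrier R = {\<zero>\<^bsub>R\<^esub>}" using one_zeroD by blast
  thus False using simple by blast
qed

lemma (in simple_difference_ring) proper_difference_ideal_zero: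
  assumes "difference_ideal S R act I" "\<one>\<^bsub>R\<^esub> \<notin> I"
  shows "I = {\<zero>\<^bsub>R\<^esub>}"
proof -
  have "I \<noteq> carrier R" using assms(2) one_closed by blast
  hence "I \<in> {I. difference_ideal S R act I \<and> I \<noteq> carrier R}" using assms(1) by simp
  thus ?thesis unfolding simple by simp
qed

section \<open>Quotients by difference ideals\<close>

text \<open>Acting by images of cosets avoids choosing representatives; for a difference ideal
  \<open>N\<close> such an image is again a full coset of \<open>N\<close>.\<close>

definition quot_act :: "('s \<Rightarrow> 'a \<Rightarrow> 'a) \<Rightarrow> ('a, 'm) ring_scheme \<Rightarrow> 'a set \<Rightarrow> 's \<Rightarrow> 'a set \<Rightarrow> 'a set" where
  "quot_act act R N \<sigma> = (\<lambda>A\<in>carrier (R Quot N). act \<sigma> ` A)"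

lemma quot_act_extensional: "quot_act act R N \<sigma> \<in> extensional (carrier (R Quot N))"
  unfolding quot_act_def by (rule restrict_extensional)

lemma carrier_Quot: "carrier (R Quot N) = (\<lambda>x. N +>\<^bsub>R\<^esub> x) ` carrier R"
  by (auto simp: FactRing_def A_RCOSETS_def')

context difference_ring
begin

text \<open>The definition gives one inclusion; applied to the inverse of \<open>\<sigma>\<close> it
  gives the other.\<close>

lemma act_image_difference_ideal:
  assumes "difference_ideal S R act N" "\<sigma> \<in> carrier S"
  shows "act \<sigma> ` N = N"
proof
  interpret G: Group.group S by (rule group_S)
  show "act \<sigma> ` N \<subseteq> N" using assms by (auto simp: difference_ideal_def)
  show "N \<subseteq> act \<sigma> ` N"
  proof
    fix x assume x: "x \<in> N"
    hence xR: "x \<in> carrier R" using assms ideal.Icarr by (fastforce simp: difference_ideal_def)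
    have "act (inv\<^bsub>S\<^esub> \<sigma>) x \<in> N" using assms x by (auto simp: difference_ideal_def)
    moreover have "act \<sigma> (act (inv\<^bsub>S\<^esub> \<sigma>) x) = x"
      using composition_rule[of x \<sigma> "inv\<^bsub>S\<^esub> \<sigma>"] assms(2) xR id_eq_one
      by (metis G.inv_closed G.r_inv restrict_apply')
    ultimately show "x \<in> act \<sigma> ` N" by (metis imageI)
  qed
qed

lemma act_rcoset:
  assumes N: "difference_ideal S R act N" and "\<sigma> \<in> carrier S" "x \<in> carrier R"
  shows "act \<sigma> ` (N +>\<^bsub>R\<^esub> x) = N +>\<^bsub>R\<^esub> act \<sigma> x"
proof -
  have "N \<subseteq> carrier R" using N ideal.Icarr by (fastforce simp: difference_ideal_def)
  hence "act \<sigma> ` (N +>\<^bsub>R\<^esub> x) = (\<lambda>n. n \<oplus>\<^bsub>R\<^esub> act \<sigma> x) ` (act \<sigma> ` N)"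
    unfolding a_r_coset_def' using assms(2,3) by (auto simp: act_add image_iff subset_iff)
  thus ?thesis using act_image_difference_ideal[OF assms(1,2)] by (auto simp: a_r_coset_def')
qed

lemma
  assumes N: "difference_ideal S R act N"
  shows difference_ring_Quot: "difference_ring S (R Quot N) (quot_act act R N)"
    and rcos_difference_hom: "(+>\<^bsub>R\<^esub>) N \<in> difference_hom S R act (R Quot N) (quot_act act R N)"
proof -
  have id: "ideal N R" using N by (simp add: difference_ideal_def)
  have act: "quot_act act R N \<sigma> (N +>\<^bsub>R\<^esub> x) = N +>\<^bsub>R\<^esub> act \<sigma> x"
    if "\<sigma> \<in> carrier S" "x \<in> carrier R" for \<sigma> x
    using that act_rcoset[OF N] by (simp add: quot_act_def carrier_Quot)
  show "difference_ring S (R Quot N) (quot_act act R N)"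
    by (rule difference_ring_hom_image[OF ideal.quotient_is_cring[OF id is_cring]
          ideal.rcos_ring_hom[OF id] carrier_Quot act quot_act_extensional])
  show "(+>\<^bsub>R\<^esub>) N \<in> difference_hom S R act (R Quot N) (quot_act act R N)"
    using ideal.rcos_ring_hom[OF id] act by (auto simp: difference_hom_def)
qed

lemma rcos_eq_zero_iff:
  assumes "ideal N R" "x \<in> carrier R"
  shows "N +>\<^bsub>R\<^esub> x = \<zero>\<^bsub>R Quot N\<^esub> \<longleftrightarrow> x \<in> N"
  using ideal.rcos_const_imp_mem[OF assms(1)] a_rcos_zero[OF assms(1)] assms(2)
  by (auto simp: FactRing_def)

text \<open>A proper difference ideal of the quotient pulls back to one of \<open>R\<close> that
  contains \<open>N\<close> and avoids 1. By maximality this is \<open>N\<close>, so the ideal is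
  zero.\<close>

lemma simple_difference_ring_Quot:
  assumes N: "difference_ideal S R act N" "\<one>\<^bsub>R\<^esub> \<notin> N"
    and max: "\<And>J. difference_ideal S R act J \<Longrightarrow> N \<subseteq> J \<Longrightarrow> \<one>\<^bsub>R\<^esub> \<notin> J \<Longrightarrow> J = N"
  shows "simple_difference_ring S (R Quot N) (quot_act act R N)"
proof (rule simple_difference_ringI)
  let ?Q = "R Quot N" and ?h = "(+>\<^bsub>R\<^esub>) N"
  have id: "ideal N R" using N by (simp add: difference_ideal_def)
  note dr = difference_ring_Quot[OF N(1)]
  interpret Q: difference_ring S ?Q "quot_act act R N" by (rule dr)
  have one: "\<one>\<^bsub>?Q\<^esub> = ?h \<one>\<^bsub>R\<^esub>" by (simp add: FactRing_def)
  show "difference_ring S ?Q (quot_act act R N)" by (rule dr)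
  show "\<one>\<^bsub>?Q\<^esub> \<noteq> \<zero>\<^bsub>?Q\<^esub>" using rcos_eq_zero_iff[OF id] N(2) unfolding one by simp
  fix I assume I: "difference_ideal S ?Q (quot_act act R N) I" "\<one>\<^bsub>?Q\<^esub> \<notin> I"
  let ?J = "{x \<in> carrier R. ?h x \<in> I}"
  have "difference_ideal S R act ?J"
    by (rule difference_ideal_vimage[OF difference_ring_axioms dr rcos_difference_hom[OF N(1)] I(1)])
  moreover have "N \<subseteq> ?J"
  proof
    fix x assume x: "x \<in> N"
    have "x \<in> carrier R" using x ideal.Icarr[OF id] by simp
    moreover have "\<zero>\<^bsub>?Q\<^esub> \<in> I"
      using I(1) additive_subgroup.zero_closed[OF ideal.axioms(1)] by (fastforce simp: difference_ideal_def)
    moreover have "?h x = \<zero>\<^bsub>?Q\<^esub>" using rcos_eq_zero_iff[OF id \<open>x \<in> carrier R\<close>] x by blast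
    ultimately show "x \<in> ?J" by simp
  qed
  moreover have "\<one>\<^bsub>R\<^esub> \<notin> ?J" using I(2) one by simp
  ultimately have J: "?J = N" by (rule max)
  have "I \<subseteq> carrier ?Q" using I(1) ideal.Icarr by (fastforce simp: difference_ideal_def)
  show "I \<subseteq> {\<zero>\<^bsub>?Q\<^esub>}"
  proof
    fix Z assume Z: "Z \<in> I"
    then obtain x where x: "x \<in> carrier R" "Z = ?h x"
      using \<open>I \<subseteq> carrier ?Q\<close> by (auto simp: carrier_Quot)
    hence "x \<in> N" using J Z by blast
    thus "Z \<in> {\<zero>\<^bsub>?Q\<^esub>}" using x rcos_eq_zero_iff[OF id] by simp
  qed
qed

end

section \<open>Coinduced rings and their pseudofield quotients\<close>

definition coinduced_ring ::
  "('s, 'x) monoid_scheme \<Rightarrow> ('a, 'm) ring_scheme \<Rightarrow> ('s \<Rightarrow> 'a) ring" where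
  "coinduced_ring S R =
     \<lparr> carrier = carrier S \<rightarrow>\<^sub>E carrier R,
       monoid.mult = (\<lambda>f g. \<lambda>\<tau>\<in>carrier S. f \<tau> \<otimes>\<^bsub>R\<^esub> g \<tau>),
       one = (\<lambda>\<tau>\<in>carrier S. \<one>\<^bsub>R\<^esub>),
       ring.zero = (\<lambda>\<tau>\<in>carrier S. \<zero>\<^bsub>R\<^esub>),
       add = (\<lambda>f g. \<lambda>\<tau>\<in>carrier S. f \<tau> \<oplus>\<^bsub>R\<^esub> g \<tau>) \<rparr>"

text \<open>Translation on the right of the argument is what makes this a left action and makes the
  orbit map of an element of a difference ring equivariant.\<close>

definition coinduced_act ::
  "('s, 'x) monoid_scheme \<Rightarrow> ('a, 'm) ring_scheme \<Rightarrow> 's \<Rightarrow> ('s \<Rightarrow> 'a) \<Rightarrow> ('s \<Rightarrow> 'a)" where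
  "coinduced_act S R \<sigma> =
     (\<lambda>g\<in>carrier (coinduced_ring S R). \<lambda>\<tau>\<in>carrier S. g (\<tau> \<otimes>\<^bsub>S\<^esub> \<sigma>))"

lemma coinduced_ring_simps:
  "carrier (coinduced_ring S R) = carrier S \<rightarrow>\<^sub>E carrier R"
  "f \<otimes>\<^bsub>coinduced_ring S R\<^esub> g = (\<lambda>\<tau>\<in>carrier S. f \<tau> \<otimes>\<^bsub>R\<^esub> g \<tau>)"
  "f \<oplus>\<^bsub>coinduced_ring S R\<^esub> g = (\<lambda>\<tau>\<in>carrier S. f \<tau> \<oplus>\<^bsub>R\<^esub> g \<tau>)"
  "\<one>\<^bsub>coinduced_ring S R\<^esub> = (\<lambda>\<tau>\<in>carrier S. \<one>\<^bsub>R\<^esub>)"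
  "\<zero>\<^bsub>coinduced_ring S R\<^esub> = (\<lambda>\<tau>\<in>carrier S. \<zero>\<^bsub>R\<^esub>)"
  by (simp_all add: coinduced_ring_def)

lemma (in cring) cring_coinduced_ring: "cring (coinduced_ring S R)"
proof (rule cringI)
  note d = coinduced_ring_simps
  show "abelian_group (coinduced_ring S R)"
  proof (rule abelian_groupI)
    fix x assume x: "x \<in> carrier (coinduced_ring S R)"
    show "\<exists>y\<in>carrier (coinduced_ring S R). y \<oplus>\<^bsub>coinduced_ring S R\<^esub> x = \<zero>\<^bsub>coinduced_ring S R\<^esub>"
      by (rule bexI[of _ "\<lambda>\<tau>\<in>carrier S. \<ominus> x \<tau>"])
         (use x in \<open>auto simp: d l_neg PiE_iff intro!: restrict_ext\<close>)
  qed (auto simp: d PiE_iff a_ac extensional_def fun_eq_iff intro!: restrict_ext)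
  show "comm_monoid (coinduced_ring S R)"
    by (rule comm_monoidI) (auto simp: d PiE_iff m_ac extensional_def fun_eq_iff intro!: restrict_ext)
  fix x y z
  assume "x \<in> carrier (coinduced_ring S R)" "y \<in> carrier (coinduced_ring S R)"
    "z \<in> carrier (coinduced_ring S R)"
  thus "(x \<oplus>\<^bsub>coinduced_ring S R\<^esub> y) \<otimes>\<^bsub>coinduced_ring S R\<^esub> z =
      x \<otimes>\<^bsub>coinduced_ring S R\<^esub> z \<oplus>\<^bsub>coinduced_ring S R\<^esub> y \<otimes>\<^bsub>coinduced_ring S R\<^esub> z"
    unfolding d by (intro restrict_ext) (simp add: PiE_iff l_distr)
qed

lemma difference_ring_coinduced:
  assumes "Group.group S" "cring R"
  shows "difference_ring S (coinduced_ring S R) (coinduced_act S R)"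
proof (rule difference_ringI)
  interpret G: Group.group S by fact
  interpret R: cring R by fact
  note d = coinduced_ring_simps coinduced_act_def
  show "cring (coinduced_ring S R)" by (rule R.cring_coinduced_ring)
  show "coinduced_act S R \<sigma> \<in> extensional (carrier (coinduced_ring S R))" for \<sigma>
    by (simp add: coinduced_act_def)
  show "coinduced_act S R \<sigma> \<in> ring_hom (coinduced_ring S R) (coinduced_ring S R)"
    if "\<sigma> \<in> carrier S" for \<sigma>
    by (rule ring_hom_memI) (use that in \<open>auto simp: d PiE_iff intro!: restrict_ext\<close>)
  show "coinduced_act S R \<one>\<^bsub>S\<^esub> x = x" if "x \<in> carrier (coinduced_ring S R)" for x
    using that by (auto simp: d PiE_iff extensional_def)
  show "coinduced_act S R (\<sigma> \<otimes>\<^bsub>S\<^esub> \<tau>) x = coinduced_act S R \<sigma> (coinduced_act S R \<tau> x)"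
    if "\<sigma> \<in> carrier S" "\<tau> \<in> carrier S" "x \<in> carrier (coinduced_ring S R)" for \<sigma> \<tau> x
    using that by (auto simp: d PiE_iff G.m_assoc intro!: restrict_ext)
qed fact

text \<open>The ideal generated by \<open>x\<close> and \<open>q\<close> contains 1. This expresses
  that \<open>R/q\<close> is a field without forming that quotient.\<close>

lemma (in cring) maximal_ideal_inverse:
  assumes q: "ideal q R" and max: "\<And>J. ideal J R \<Longrightarrow> q \<subseteq> J \<Longrightarrow> \<one> \<notin> J \<Longrightarrow> J = q"
    and x: "x \<in> carrier R" "x \<notin> q"
  obtains y where "y \<in> carrier R" "\<one> \<ominus> x \<otimes> y \<in> q"
proof -
  have id: "ideal (PIdl x <+> q) R" by (intro add_ideals cgenideal_ideal q x)
  have "q \<subseteq> PIdl x <+> q"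
  proof
    fix z assume z: "z \<in> q"
    moreover have "\<zero> \<in> PIdl x" 
      using additive_subgroup.zero_closed[OF ideal.axioms(1)[OF cgenideal_ideal[OF x(1)]]] .
    ultimately show "z \<in> PIdl x <+> q"
      using ideal.Icarr[OF q] unfolding set_add_def' by (metis (mono_tags, lifting) UN_I l_zero singletonI)
  qed
  moreover have "x \<in> PIdl x <+> q"
    using cgenideal_self[OF x(1)] additive_subgroup.zero_closed[OF ideal.axioms(1)[OF q]] x(1)
    unfolding set_add_def' by (metis (mono_tags, lifting) UN_I r_zero singletonI)
  ultimately have "\<one> \<in> PIdl x <+> q" using max[OF id] x(2) by blast
  then obtain y z where yz: "y \<in> carrier R" "z \<in> q" "\<one> = y \<otimes> x \<oplus> z"
    unfolding set_add_def' cgenideal_def by auto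
  have "z \<in> carrier R" using yz(2) ideal.Icarr[OF q] by simp
  hence "\<one> \<ominus> x \<otimes> y = z"
    unfolding yz(3) using yz(1) x(1) by (simp add: m_comm[of y x] minus_eq a_ac) (simp add: r_neg a_assoc[symmetric])
  thus thesis using that yz by auto
qed

text \<open>The injection \<open>\<kappa>\<close> bounds the size of \<open>B\<close> by that of the
  functions from the group type to the ring type; it is needed later to rename the elements of
  \<open>B\<close> inside a fixed type.\<close>

lemma (in difference_ring) exists_pseudofield_hom:
  assumes I: "difference_ideal S R act I" "\<one>\<^bsub>R\<^esub> \<notin> I"
  obtains B :: "('a \<Rightarrow> 'c) set ring" and actB h \<kappa> where
    "pseudofield S B actB" "h \<in> difference_hom S R act B actB" "\<And>x. x \<in> I \<Longrightarrow> h x = \<zero>\<^bsub>B\<^esub>"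
    "inj_on (\<kappa> :: ('a \<Rightarrow> 'c) set \<Rightarrow> ('a \<Rightarrow> 'c)) (carrier B)"
proof -
  interpret G: Group.group S by (rule group_S)
  let ?C = "coinduced_ring S R" and ?actC = "coinduced_act S R"
  interpret C: difference_ring S ?C ?actC
    by (rule difference_ring_coinduced[OF group_S is_cring])
  note d = coinduced_ring_simps coinduced_act_def
  have "difference_ideal S R (\<lambda>\<sigma> x. x) I" using I by (simp add: difference_ideal_def)
  from exists_maximal_difference_ideal[OF this I(2)]
  obtain q where q: "ideal q R" "I \<subseteq> q" "\<one>\<^bsub>R\<^esub> \<notin> q"
    "\<And>J. ideal J R \<Longrightarrow> q \<subseteq> J \<Longrightarrow> \<one>\<^bsub>R\<^esub> \<notin> J \<Longrightarrow> J = q" by auto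
  interpret q: ideal q R by (rule q)
  \<comment> \<open>\<open>Q\<close> consists of the functions that vanish modulo \<open>q\<close>.
    Dividing by an ideal \<open>N\<close> above \<open>Q\<close> amounts to taking a quotient of the
    ring of functions into the field \<open>R/q\<close>.\<close>
  define Q where "Q = {g \<in> carrier ?C. \<forall>\<tau>\<in>carrier S. g \<tau> \<in> q}"
  have "ideal Q ?C"
  proof (rule idealI[OF C.ring_axioms])
    show "subgroup Q (add_monoid ?C)"
    proof
      fix x assume x: "x \<in> Q"
      have "inv\<^bsub>add_monoid ?C\<^esub> x = (\<lambda>\<tau>\<in>carrier S. \<ominus>\<^bsub>R\<^esub> x \<tau>)"
        unfolding a_inv_def[symmetric]
        by (rule C.minus_equality) (use x in \<open>auto simp: Q_def d PiE_iff l_neg intro!: restrict_ext\<close>)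
      thus "inv\<^bsub>add_monoid ?C\<^esub> x \<in> Q" using x by (auto simp: Q_def d PiE_iff)
    qed (auto simp: Q_def d PiE_iff extensional_def)
  qed (auto simp: Q_def d PiE_iff q.I_l_closed q.I_r_closed)
  hence "difference_ideal S ?C ?actC Q"
    by (auto simp: difference_ideal_def Q_def d PiE_iff)
  moreover have "\<one>\<^bsub>?C\<^esub> \<notin> Q" using q(3) G.one_closed by (auto simp: Q_def d)
  ultimately obtain N where N: "difference_ideal S ?C ?actC N" "Q \<subseteq> N" "\<one>\<^bsub>?C\<^esub> \<notin> N"
    "\<And>J. difference_ideal S ?C ?actC J \<Longrightarrow> N \<subseteq> J \<Longrightarrow> \<one>\<^bsub>?C\<^esub> \<notin> J \<Longrightarrow> J = N"
    by (rule C.exists_maximal_difference_ideal) auto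
  have idN: "ideal N ?C" using N by (simp add: difference_ideal_def)
  let ?B = "?C Quot N" and ?actB = "quot_act ?actC ?C N" and ?\<pi> = "(+>\<^bsub>?C\<^esub>) N"
  interpret B: simple_difference_ring S ?B ?actB
    by (rule C.simple_difference_ring_Quot[OF N(1,3,4)])
  have \<pi>: "?\<pi> \<in> difference_hom S ?C ?actC ?B ?actB" by (rule C.rcos_difference_hom[OF N(1)])
  interpret \<pi>: ring_hom_cring ?C ?B ?\<pi>
    by (intro ring_hom_cring.intro ring_hom_cring_axioms.intro C.is_cring B.is_cring
          difference_hom_ring_hom[OF \<pi>])
  have "absolutely_flat ?B"
    unfolding absolutely_flat_def
  proof
    fix Z assume "Z \<in> carrier ?B"
    then obtain x where x: "x \<in> carrier ?C" "Z = ?\<pi> x" by (auto simp: carrier_Quot)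
    \<comment> \<open>Quasi-inverses are found pointwise: 0 where \<open>x\<close> vanishes modulo
      \<open>q\<close>, an inverse modulo \<open>q\<close> elsewhere. They are then assembled into
      one function.\<close>
    have "\<exists>y\<in>carrier R. x \<tau> \<ominus>\<^bsub>R\<^esub> x \<tau> \<otimes>\<^bsub>R\<^esub> y \<otimes>\<^bsub>R\<^esub> x \<tau> \<in> q" if \<tau>: "\<tau> \<in> carrier S" for \<tau>
    proof (cases "x \<tau> \<in> q")
      case True
      thus ?thesis by (intro bexI[of _ "\<zero>\<^bsub>R\<^esub>"]) (auto simp: minus_eq)
    next
      case False
      have xR: "x \<tau> \<in> carrier R" using x \<tau> by (auto simp: d)
      from maximal_ideal_inverse[OF q(1,4) xR False]
      obtain y where y: "y \<in> carrier R" "\<one>\<^bsub>R\<^esub> \<ominus>\<^bsub>R\<^esub> x \<tau> \<otimes>\<^bsub>R\<^esub> y \<in> q" by blast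
      have "x \<tau> \<ominus>\<^bsub>R\<^esub> x \<tau> \<otimes>\<^bsub>R\<^esub> y \<otimes>\<^bsub>R\<^esub> x \<tau> = (\<one>\<^bsub>R\<^esub> \<ominus>\<^bsub>R\<^esub> x \<tau> \<otimes>\<^bsub>R\<^esub> y) \<otimes>\<^bsub>R\<^esub> x \<tau>"
        using xR y(1) by (simp add: minus_eq l_distr l_minus)
      moreover have "\<dots> \<in> q" by (rule q.I_r_closed[OF y(2) xR])
      ultimately show ?thesis using y(1) by metis
    qed
    then obtain y where y: "\<And>\<tau>. \<tau> \<in> carrier S \<Longrightarrow> y \<tau> \<in> carrier R"
      "\<And>\<tau>. \<tau> \<in> carrier S \<Longrightarrow> x \<tau> \<ominus>\<^bsub>R\<^esub> x \<tau> \<otimes>\<^bsub>R\<^esub> y \<tau> \<otimes>\<^bsub>R\<^esub> x \<tau> \<in> q" by metis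
    define y' where "y' = (\<lambda>\<tau>\<in>carrier S. y \<tau>)"
    have y': "y' \<in> carrier ?C" using y(1) by (auto simp: d y'_def)
    have "\<ominus>\<^bsub>?C\<^esub> (x \<otimes>\<^bsub>?C\<^esub> y' \<otimes>\<^bsub>?C\<^esub> x) = (\<lambda>\<tau>\<in>carrier S. \<ominus>\<^bsub>R\<^esub> (x \<tau> \<otimes>\<^bsub>R\<^esub> y \<tau> \<otimes>\<^bsub>R\<^esub> x \<tau>))"
      by (rule C.minus_equality)
         (use x y(1) in \<open>auto simp: y'_def d PiE_iff l_neg intro!: restrict_ext\<close>)
    hence "x \<ominus>\<^bsub>?C\<^esub> x \<otimes>\<^bsub>?C\<^esub> y' \<otimes>\<^bsub>?C\<^esub> x \<in> Q"
      using y x by (auto simp: a_minus_def Q_def d PiE_iff)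
    hence "?\<pi> (x \<ominus>\<^bsub>?C\<^esub> x \<otimes>\<^bsub>?C\<^esub> y' \<otimes>\<^bsub>?C\<^esub> x) = \<zero>\<^bsub>?B\<^esub>"
      using C.rcos_eq_zero_iff[OF idN, of "x \<ominus>\<^bsub>?C\<^esub> x \<otimes>\<^bsub>?C\<^esub> y' \<otimes>\<^bsub>?C\<^esub> x"] N(2) x(1) y'
      by (meson C.m_closed C.minus_closed subsetD)
    hence "?\<pi> x \<ominus>\<^bsub>?B\<^esub> ?\<pi> x \<otimes>\<^bsub>?B\<^esub> ?\<pi> y' \<otimes>\<^bsub>?B\<^esub> ?\<pi> x = \<zero>\<^bsub>?B\<^esub>"
      using x y' by (simp add: a_minus_def)
    hence "?\<pi> x = ?\<pi> x \<otimes>\<^bsub>?B\<^esub> ?\<pi> y' \<otimes>\<^bsub>?B\<^esub> ?\<pi> x" using x y' by simp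
    thus "\<exists>Y\<in>carrier ?B. Z = Z \<otimes>\<^bsub>?B\<^esub> Y \<otimes>\<^bsub>?B\<^esub> Z"
      using x y' by (intro bexI[of _ "?\<pi> y'"]) auto
  qed
  hence B: "pseudofield S ?B ?actB"
    by (simp add: pseudofield_def pseudofield_axioms_def B.simple_difference_ring_axioms)
  \<comment> \<open>The orbit map. It sends \<open>I\<close> into \<open>Q\<close>, because all
    translates of an element of \<open>I\<close> lie in \<open>I\<close> and hence in
    \<open>q\<close>.\<close>
  let ?\<Phi> = "\<lambda>x. \<lambda>\<tau>\<in>carrier S. act \<tau> x"
  have "?\<Phi> \<in> ring_hom R ?C"
    by (rule ring_hom_memI)
       (auto simp: d act_closed act_mult act_add act_unit intro!: restrict_ext)
  moreover have "?\<Phi> (act \<sigma> x) = ?actC \<sigma> (?\<Phi> x)" if "\<sigma> \<in> carrier S" "x \<in> carrier R" for \<sigma> x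
    using that by (auto simp: d act_closed composition_rule intro!: restrict_ext)
  ultimately have \<Phi>: "?\<Phi> \<in> difference_hom S R act ?C ?actC"
    by (auto simp: difference_hom_def)
  have "?\<pi> (?\<Phi> x) = \<zero>\<^bsub>?B\<^esub>" if x: "x \<in> I" for x
  proof -
    have "x \<in> carrier R" using x q.Icarr q(2) by auto
    hence "?\<Phi> x \<in> carrier ?C" using \<Phi> by (auto simp: d act_closed)
    moreover have "act \<tau> x \<in> q" if "\<tau> \<in> carrier S" for \<tau>
      using I(1) x that q(2) by (auto simp: difference_ideal_def)
    ultimately have "?\<Phi> x \<in> Q" by (auto simp: Q_def)
    thus ?thesis using C.rcos_eq_zero_iff[OF idN \<open>?\<Phi> x \<in> carrier ?C\<close>] N(2) by blast
  qed
  \<comment> \<open>The injection \<open>\<kappa>\<close> picks a representative of each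
    coset.\<close>
  moreover have "inj_on (inv_into (carrier ?C) ?\<pi>) (carrier ?B)"
    unfolding carrier_Quot by (rule inj_on_inv_into) simp
  ultimately show thesis
    using that[OF B difference_hom_comp[OF \<Phi> \<pi>]] by blast
qed

section \<open>Evaluation of difference polynomials\<close>

text \<open>Rewrites multiplication by a variable as a product in the polynomial ring, to which a
  ring homomorphism can be applied.\<close>

lemma (in cring) indexed_pmult_eq_conv:
  fixes p :: "'v multiset \<Rightarrow> 'a"
  assumes "p \<in> indexed_pset V (carrier R)"
  shows "indexed_pmult p v = poly_conv (indexed_pmult (indexed_const \<one>) v) p"
proof -
  have "indexed_const \<one> m \<in> carrier R" for m :: "'v multiset" by (simp add: indexed_const_def)
  moreover have "poly_conv (indexed_const \<one>) p = p"
    using pset_coeff[OF assms] by (simp add: conv_const poly_smul_def)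
  ultimately show ?thesis
    using conv_pmult[of "indexed_const \<one>" p v] pset_coeff[OF assms] by simp
qed

context difference_ring
begin

text \<open>\<open>diff_eval\<close> is \<open>poly_val\<close> at the point that sends each
  variable to the corresponding translate of an entry of \<open>b\<close>. The third fact will be
  used contrapositively: a value outside an ideal forces a coefficient outside it.\<close>

lemma
  assumes B: "difference_ring S B actB" and \<iota>: "\<iota> \<in> difference_hom S R act B actB"
    and b: "b \<in> {..<n} \<rightarrow>\<^sub>E carrier B"
  shows diff_eval_const: "\<And>c. c \<in> carrier R \<Longrightarrow> diff_eval R B actB \<iota> b (indexed_const c) = \<iota> c"
    and diff_eval_pmult: "\<And>P \<sigma> i. P \<in> dp_set n \<Longrightarrow> \<sigma> \<in> carrier S \<Longrightarrow> i < n \<Longrightarrow>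
      diff_eval R B actB \<iota> b (indexed_pmult P (\<sigma>, i)) = actB \<sigma> (b i) \<otimes>\<^bsub>B\<^esub> diff_eval R B actB \<iota> b P"
    and diff_eval_ideal: "\<And>J P. ideal J B \<Longrightarrow> P \<in> dp_set n \<Longrightarrow> (\<And>m. \<iota> (P m) \<in> J) \<Longrightarrow>
      diff_eval R B actB \<iota> b P \<in> J"
proof -
  interpret B: difference_ring S B actB by (rule B)
  define t where "t = (\<lambda>v. actB (fst v) (b (snd v)))"
  interpret ev: poly_eval R B \<iota> "diff_vars S n" t
  proof (intro poly_eval.intro ring_hom_cring.intro ring_hom_cring_axioms.intro poly_eval_axioms.intro)
    show "\<iota> \<in> ring_hom R B" using \<iota> by (simp add: difference_hom_def)
    fix v assume "v \<in> diff_vars S n"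
    hence "fst v \<in> carrier S" "snd v < n" by (auto simp: diff_vars_def)
    moreover from this b have "b (snd v) \<in> carrier B" by auto
    ultimately show "t v \<in> carrier B" unfolding t_def by (intro B.act_closed)
  qed (rule cring_axioms B.cring_axioms)+
  have val: "diff_eval R B actB \<iota> b = ev.poly_val"
    unfolding diff_eval_def[abs_def] ev.poly_val_def[abs_def] ev.monom_val_def
    by (simp add: t_def)
  show "diff_eval R B actB \<iota> b (indexed_const c) = \<iota> c" if "c \<in> carrier R" for c
    unfolding val by (rule ev.poly_val_const[OF that])
  show "diff_eval R B actB \<iota> b (indexed_pmult P (\<sigma>, i)) = actB \<sigma> (b i) \<otimes>\<^bsub>B\<^esub> diff_eval R B actB \<iota> b P"
    if "P \<in> dp_set n" "\<sigma> \<in> carrier S" "i < n" for P \<sigma> i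
    using ev.poly_val_pmult[OF that(1), of "(\<sigma>, i)"] that unfolding val
    by (simp add: diff_vars_def t_def)
  fix J P assume J: "ideal J B" and P: "P \<in> dp_set n" "\<And>m. \<iota> (P m) \<in> J"
  \<comment> \<open>Stated for any finite \<open>F\<close>, since the induction removes monomials
    from the index set while \<open>P\<close> stays fixed.\<close>
  have fin: "(\<Oplus>\<^bsub>B\<^esub>m\<in>F. \<iota> (P m) \<otimes>\<^bsub>B\<^esub> ev.monom_val m) \<in> J"
    if "finite F" "\<And>m. m \<in> F \<Longrightarrow> set_mset m \<subseteq> diff_vars S n" for F
    using that
  proof (induction rule: finite_induct)
    case empty
    thus ?case using additive_subgroup.zero_closed[OF ideal.axioms(1)[OF J]] by simp
  next
    case (insert m F)
    have *: "\<iota> (P k) \<otimes>\<^bsub>B\<^esub> ev.monom_val k \<in> J" if "k \<in> insert m F" for k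
      using ideal.I_r_closed[OF J P(2) ev.monom_val_closed] insert.prems that by blast
    have "(\<Oplus>\<^bsub>B\<^esub>k\<in>insert m F. \<iota> (P k) \<otimes>\<^bsub>B\<^esub> ev.monom_val k)
        = \<iota> (P m) \<otimes>\<^bsub>B\<^esub> ev.monom_val m \<oplus>\<^bsub>B\<^esub> (\<Oplus>\<^bsub>B\<^esub>k\<in>F. \<iota> (P k) \<otimes>\<^bsub>B\<^esub> ev.monom_val k)"
      by (rule B.finsum_insert) (use insert.hyps * ideal.Icarr[OF J] in auto)
    thus ?case
      using additive_subgroup.a_closed[OF ideal.axioms(1)[OF J]] * insert by simp
  qed
  show "diff_eval R B actB \<iota> b P \<in> J"
    unfolding val ev.poly_val_def using pset_support[OF P(1)] by (intro fin) auto
qed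

text \<open>Constants and variables generate the polynomial ring, so a ring homomorphism is
  determined by its values on them.\<close>

lemma diff_eval_unique:
  assumes B: "difference_ring S B actB" and \<iota>: "\<iota> \<in> difference_hom S R act B actB"
    and b: "b \<in> {..<n} \<rightarrow>\<^sub>E carrier B" and g: "g \<in> ring_hom (diff_poly_ring S R n) B"
    and const: "\<And>c. c \<in> carrier R \<Longrightarrow> g (indexed_const c) = \<iota> c"
    and var: "\<And>\<sigma> i. \<sigma> \<in> carrier S \<Longrightarrow> i < n \<Longrightarrow>
      g (indexed_pmult (indexed_const \<one>\<^bsub>R\<^esub>) (\<sigma>, i)) = actB \<sigma> (b i)"
    and f: "f \<in> dp_set n"
  shows "g f = diff_eval R B actB \<iota> b f"
proof -
  let ?ev = "diff_eval R B actB \<iota> b"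
  note d = indexed_poly_ring_simps[of "diff_vars S n", folded diff_poly_ring_def]
  note ev = diff_eval_hom[OF B \<iota> b]
  show ?thesis
    using f
  proof (induction rule: indexed_pset.induct)
    case (indexed_const k)
    thus ?case by (simp add: const diff_eval_const[OF B \<iota> b])
  next
    case (indexed_padd P Q)
    thus ?case using ring_hom_add[OF g, of P Q] ring_hom_add[OF ev, of P Q] by (simp add: d)
  next
    case (indexed_pmult P v)
    obtain \<sigma> i where v: "v = (\<sigma>, i)" "\<sigma> \<in> carrier S" "i < n"
      using indexed_pmult(2) by (auto simp: diff_vars_def)
    have "indexed_pmult (indexed_const \<one>\<^bsub>R\<^esub>) v \<in> dp_set n"
      using indexed_pmult(2) by (auto intro!: indexed_pset.intros)
    hence "g (indexed_pmult P v) = g (indexed_pmult (indexed_const \<one>\<^bsub>R\<^esub>) v) \<otimes>\<^bsub>B\<^esub> g P"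
      unfolding indexed_pmult_eq_conv[OF indexed_pmult(1), of v]
      using ring_hom_mult[OF g, of "indexed_pmult (indexed_const \<one>\<^bsub>R\<^esub>) v" P] indexed_pmult(1)
      by (simp add: d)
    thus ?case using indexed_pmult diff_eval_pmult[OF B \<iota> b] v var by simp
  qed
qed

text \<open>Composing evaluation with \<open>g\<close> gives a ring homomorphism with the prescribed
  values on constants and variables, so uniqueness applies.\<close>

lemma diff_eval_comp:
  assumes B: "difference_ring S B actB" and \<iota>: "\<iota> \<in> difference_hom S R act B actB"
    and b: "b \<in> {..<n} \<rightarrow>\<^sub>E carrier B"
    and T: "difference_ring S T actT" and g: "g \<in> difference_hom S B actB T actT"
    and f: "f \<in> dp_set n"
  shows "g (diff_eval R B actB \<iota> b f) = diff_eval R T actT (\<lambda>x. g (\<iota> x)) (\<lambda>i\<in>{..<n}. g (b i)) f"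
proof (rule diff_eval_unique[OF T difference_hom_comp[OF \<iota> g] _ _ _ _ f])
  interpret B: difference_ring S B actB by (rule B)
  have bB: "b i \<in> carrier B" if "i < n" for i using b that by auto
  show "(\<lambda>i\<in>{..<n}. g (b i)) \<in> {..<n} \<rightarrow>\<^sub>E carrier T"
    using bB ring_hom_closed[OF difference_hom_ring_hom[OF g]] by auto
  show "(\<lambda>f. g (diff_eval R B actB \<iota> b f)) \<in> ring_hom (diff_poly_ring S R n) T"
    using ring_hom_trans[OF diff_eval_hom[OF B \<iota> b] difference_hom_ring_hom[OF g]] by (simp add: comp_def)
  show "g (diff_eval R B actB \<iota> b (indexed_const c)) = g (\<iota> c)" if "c \<in> carrier R" for c
    using that by (simp add: diff_eval_const[OF B \<iota> b])
  show "g (diff_eval R B actB \<iota> b (indexed_pmult (indexed_const \<one>\<^bsub>R\<^esub>) (\<sigma>, i))) =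
      actT \<sigma> ((\<lambda>i\<in>{..<n}. g (b i)) i)" if "\<sigma> \<in> carrier S" "i < n" for \<sigma> i
    using that bB ring_hom_one[OF difference_hom_ring_hom[OF \<iota>]]
    by (simp add: diff_eval_pmult[OF B \<iota> b] diff_eval_const[OF B \<iota> b] indexed_pset.indexed_const
        B.act_closed difference_hom_act[OF g])
qed

lemma indexed_const_difference_hom:
  "indexed_const \<in> difference_hom S R act (diff_poly_ring S R n) (dp_act n)"
proof -
  note d = indexed_poly_ring_simps[of "diff_vars S n", folded diff_poly_ring_def]
  have "indexed_const \<in> ring_hom R (diff_poly_ring S R n)"
  proof (rule ring_hom_memI)
    fix x y assume xy: "x \<in> carrier R" "y \<in> carrier R"
    have "indexed_const y m \<in> carrier R" for m :: "('a \<times> nat) multiset"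
      using xy by (simp add: indexed_const_def)
    thus "indexed_const (x \<otimes>\<^bsub>R\<^esub> y) = indexed_const x \<otimes>\<^bsub>diff_poly_ring S R n\<^esub> indexed_const y"
      using xy conv_const[of x "indexed_const y :: ('a \<times> nat) multiset \<Rightarrow> 'c"]
      by (auto simp: d poly_smul_def indexed_const_def)
    show "indexed_const (x \<oplus>\<^bsub>R\<^esub> y) = indexed_const x \<oplus>\<^bsub>diff_poly_ring S R n\<^esub> indexed_const y"
      using xy by (auto simp: d indexed_padd_def indexed_const_def)
  qed (auto simp: d indexed_pset.indexed_const)
  thus ?thesis by (simp add: difference_hom_def dp_act_const)
qed

text \<open>The zero is the tuple of images of the variables under a homomorphism \<open>g\<close>
  from the polynomial ring to a pseudofield that kills \<open>I\<close>; evaluation at this tuple is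
  \<open>g\<close> itself.\<close>

lemma exists_pseudofield_zero:
  assumes I: "difference_ideal S (diff_poly_ring S R n) (dp_act n) I"
    and proper: "I \<noteq> carrier (diff_poly_ring S R n)"
  obtains B :: "('a \<Rightarrow> ('a \<times> nat) multiset \<Rightarrow> 'c) set ring" and actB h b \<kappa> where
    "pseudofield S B actB" "h \<in> difference_hom S R act B actB" "common_zero R B actB h n I b"
    "inj_on (\<kappa> :: _ \<Rightarrow> ('a \<Rightarrow> ('a \<times> nat) multiset \<Rightarrow> 'c)) (carrier B)"
proof -
  let ?P = "diff_poly_ring S R n" and ?var = "\<lambda>\<sigma> i. indexed_pmult (indexed_const \<one>\<^bsub>R\<^esub>) (\<sigma>, i)"
  interpret G: Group.group S by (rule group_S)
  interpret P: difference_ring S ?P "dp_act n" by (rule difference_ring_diff_poly)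
  have "\<one>\<^bsub>?P\<^esub> \<notin> I" using P.ideal_proper_iff I proper by (auto simp: difference_ideal_def)
  then obtain B :: "('a \<Rightarrow> ('a \<times> nat) multiset \<Rightarrow> 'c) set ring" and actB g
    and \<kappa> :: "_ \<Rightarrow> ('a \<Rightarrow> ('a \<times> nat) multiset \<Rightarrow> 'c)" where
    B: "pseudofield S B actB" and g: "g \<in> difference_hom S ?P (dp_act n) B actB"
    and gI: "\<And>x. x \<in> I \<Longrightarrow> g x = \<zero>\<^bsub>B\<^esub>" and \<kappa>: "inj_on \<kappa> (carrier B)"
    using P.exists_pseudofield_hom[OF I] by blast
  interpret B: pseudofield S B actB by (rule B)
  note gr = difference_hom_ring_hom[OF g]
  define h where "h = (\<lambda>c. g (indexed_const c))"
  define b where "b = (\<lambda>i\<in>{..<n}. g (?var \<one>\<^bsub>S\<^esub> i))"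
  have h: "h \<in> difference_hom S R act B actB"
    unfolding h_def by (rule difference_hom_comp[OF indexed_const_difference_hom g])
  have var: "?var \<sigma> i \<in> dp_set n" if "\<sigma> \<in> carrier S" "i < n" for \<sigma> i
    using that by (auto intro!: indexed_pset.intros simp: diff_vars_def)
  have b: "b \<in> {..<n} \<rightarrow>\<^sub>E carrier B"
    using ring_hom_closed[OF gr] var by (auto simp: b_def diff_poly_carrier)
  \<comment> \<open>The variable \<open>\<sigma> y\<close> is the translate by
    \<open>\<sigma>\<close> of the variable \<open>1 y\<close>, so equivariance of \<open>g\<close>
    fixes its image.\<close>
  have gvar: "g (?var \<sigma> i) = actB \<sigma> (b i)" if "\<sigma> \<in> carrier S" "i < n" for \<sigma> i
  proof -
    have "(\<one>\<^bsub>S\<^esub>, i) \<in> diff_vars S n" using that by (simp add: diff_vars_def)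
    hence "dp_act n \<sigma> (?var \<one>\<^bsub>S\<^esub> i) = ?var \<sigma> i"
      using that by (simp add: dp_act_pmult indexed_pset.indexed_const dp_act_const act_unit)
    thus ?thesis
      using difference_hom_act[OF g, of \<sigma> "?var \<one>\<^bsub>S\<^esub> i"] var that
      by (simp add: b_def diff_poly_carrier)
  qed
  have ev: "g f = diff_eval R B actB h b f" if "f \<in> dp_set n" for f
    by (rule diff_eval_unique[OF B.difference_ring_axioms h b gr _ gvar that]) (auto simp: h_def)
  have "I \<subseteq> dp_set n" using I ideal.Icarr by (fastforce simp: difference_ideal_def diff_poly_carrier)
  hence "common_zero R B actB h n I b"
    using b ev gI unfolding common_zero_def by (metis subsetD)
  thus thesis using that B h \<kappa> by blast
qed

end

section \<open>Transport of structure\<close>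

text \<open>The kernel is a difference ideal that misses 1, hence zero by simplicity.\<close>

lemma (in simple_difference_ring) difference_hom_inj:
  assumes T: "difference_ring S T actT" and h: "h \<in> difference_hom S R act T actT"
    and one: "\<one>\<^bsub>T\<^esub> \<noteq> \<zero>\<^bsub>T\<^esub>"
  shows "inj_on h (carrier R)"
proof -
  interpret T: difference_ring S T actT by (rule T)
  interpret h: ring_hom_ring R T h
    by (rule ring_hom_ringI2[OF ring_axioms T.ring_axioms difference_hom_ring_hom[OF h]])
  have "difference_ideal S T actT {\<zero>\<^bsub>T\<^esub>}"
    using T.zeroideal T.act_zero by (auto simp: difference_ideal_def)
  hence "difference_ideal S R act {x \<in> carrier R. h x \<in> {\<zero>\<^bsub>T\<^esub>}}"
    by (rule difference_ideal_vimage[OF difference_ring_axioms T h])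
  hence "{x \<in> carrier R. h x \<in> {\<zero>\<^bsub>T\<^esub>}} = {\<zero>\<^bsub>R\<^esub>}"
    by (rule proper_difference_ideal_zero) (use one in simp)
  hence "a_kernel R T h = {\<zero>\<^bsub>R\<^esub>}" unfolding a_kernel_def' singleton_iff .
  thus ?thesis by (rule h.trivial_ker_imp_inj)
qed

text \<open>Renames the elements along an injection, possibly into another type.\<close>

lemma (in pseudofield) exists_pseudofield_image:
  assumes inj: "inj_on g (carrier R)"
  obtains T :: "'u ring" and actT where "pseudofield S T actT" "carrier T = g ` carrier R"
    "g \<in> difference_hom S R act T actT"
proof -
  let ?T = "image_ring g R"
  let ?actT = "\<lambda>\<sigma>. \<lambda>y\<in>carrier ?T. g (act \<sigma> (inv_into (carrier R) g y))"
  have car: "carrier ?T = g ` carrier R" by (rule image_ring_carrier)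
  have g: "g \<in> ring_hom R ?T" using inj_imp_image_ring_iso[OF inj] by (simp add: ring_iso_def)
  have act: "?actT \<sigma> (g x) = g (act \<sigma> x)" if "\<sigma> \<in> carrier S" "x \<in> carrier R" for \<sigma> x
    using that inj by (simp add: car)
  interpret T: cring ?T
    using ring_iso_imp_img_cring[OF inj_imp_image_ring_iso[OF inj]]
    by (simp add: image_ring_zero[symmetric])
  have T: "difference_ring S ?T ?actT"
    by (rule difference_ring_hom_image[OF T.is_cring g car act restrict_extensional])
  have gd: "g \<in> difference_hom S R act ?T ?actT" using g act by (simp add: difference_hom_def)
  have zero: "g \<zero>\<^bsub>R\<^esub> = \<zero>\<^bsub>?T\<^esub>" by (simp add: image_ring_zero)
  have "simple_difference_ring S ?T ?actT"
  proof (rule simple_difference_ringI[OF T])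
    show "\<one>\<^bsub>?T\<^esub> \<noteq> \<zero>\<^bsub>?T\<^esub>"
      using inj_onD[OF inj, of "\<one>\<^bsub>R\<^esub>" "\<zero>\<^bsub>R\<^esub>"] one_not_zero by (auto simp: image_ring_one image_ring_zero)
    fix I assume I: "difference_ideal S ?T ?actT I" "\<one>\<^bsub>?T\<^esub> \<notin> I"
    have *: "{x \<in> carrier R. g x \<in> I} = {\<zero>\<^bsub>R\<^esub>}"
      by (rule proper_difference_ideal_zero[OF difference_ideal_vimage[OF difference_ring_axioms T gd I(1)]])
         (use I(2) in \<open>simp add: image_ring_one\<close>)
    have id: "ideal I ?T" using I(1) unfolding difference_ideal_def by (rule conjunct1)
    show "I \<subseteq> {\<zero>\<^bsub>?T\<^esub>}"
    proof
      fix y assume y: "y \<in> I"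
      have "y \<in> g ` carrier R" using ideal.Icarr[OF id y] unfolding car .
      then obtain x where x: "x \<in> carrier R" "y = g x" by (rule imageE)
      hence "x \<in> {x \<in> carrier R. g x \<in> I}" using y by simp
      hence "x = \<zero>\<^bsub>R\<^esub>" unfolding * by simp
      thus "y \<in> {\<zero>\<^bsub>?T\<^esub>}" using x zero by simp
    qed
  qed
  moreover have "absolutely_flat ?T"
    unfolding absolutely_flat_def
  proof
    fix z assume "z \<in> carrier ?T"
    then obtain x where x: "x \<in> carrier R" "z = g x" by (auto simp: car)
    then obtain y where y: "y \<in> carrier R" "x = x \<otimes>\<^bsub>R\<^esub> y \<otimes>\<^bsub>R\<^esub> x"
      using absolutely_flat by (auto simp: absolutely_flat_def)
    have "g x = g x \<otimes>\<^bsub>?T\<^esub> g y \<otimes>\<^bsub>?T\<^esub> g x"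
      using x(1) y(1) ring_hom_mult[OF g, of x y] ring_hom_mult[OF g, of "x \<otimes>\<^bsub>R\<^esub> y" x]
      by (simp add: y(2)[symmetric])
    thus "\<exists>y\<in>carrier ?T. z = z \<otimes>\<^bsub>?T\<^esub> y \<otimes>\<^bsub>?T\<^esub> z"
      using x(2) y(1) by (intro bexI[of _ "g y"]) (simp_all add: car)
  qed
  ultimately have "pseudofield S ?T ?actT"
    unfolding pseudofield_def pseudofield_axioms_def by (rule conjI)
  thus thesis by (rule that[OF _ car gd])
qed

text \<open>Turns an abstract extension into a literal one: elements of the copy \<open>h(A)\<close>
  get back their names in \<open>A\<close>, all others get names outside \<open>A\<close> through
  \<open>j\<close>.\<close>

lemma exists_extension_on_superset:
  fixes A :: "'u ring" and B :: "('b, 'm) ring_scheme"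
  assumes A: "pseudofield S A actA" and B: "pseudofield S B actB"
    and h: "h \<in> difference_hom S A actA B actB"
    and j: "inj_on j (carrier B)" "j ` carrier B \<inter> carrier A = {}"
  obtains T :: "'u ring" and actT g where "pseudofield S T actT"
    "carrier T \<subseteq> carrier A \<union> j ` carrier B" "g \<in> difference_hom S B actB T actT"
    "\<And>x. x \<in> carrier A \<Longrightarrow> g (h x) = x"
proof -
  interpret A: pseudofield S A actA by (rule A)
  interpret B: pseudofield S B actB by (rule B)
  have inj_h: "inj_on h (carrier A)"
    by (rule A.difference_hom_inj[OF B.difference_ring_axioms h B.one_not_zero])
  have hB: "h x \<in> carrier B" if "x \<in> carrier A" for x
    using ring_hom_closed[OF difference_hom_ring_hom[OF h] that] .
  define g where "g = (\<lambda>y. if y \<in> h ` carrier A then inv_into (carrier A) h y else j y)"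
  have gh: "g (h x) = x" if "x \<in> carrier A" for x using that inj_h by (simp add: g_def)
  have g: "g y \<in> carrier A \<longleftrightarrow> y \<in> h ` carrier A" if "y \<in> carrier B" for y
    using that j(2) inv_into_into[of y h "carrier A"] by (auto simp: g_def gh)
  have inj_g: "inj_on g (carrier B)"
  proof (rule inj_onI)
    fix x y assume xy: "x \<in> carrier B" "y \<in> carrier B" "g x = g y"
    show "x = y"
    proof (cases "x \<in> h ` carrier A")
      case True
      hence "y \<in> h ` carrier A" using g xy by metis
      thus ?thesis using True xy(3) by (auto simp: gh)
    next
      case False
      hence "y \<notin> h ` carrier A" using g xy by metis
      thus ?thesis using False xy inj_onD[OF j(1)] by (simp add: g_def)
    qed
  qed
  obtain T :: "'u ring" and actT where T: "pseudofield S T actT" "carrier T = g ` carrier B"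
    "g \<in> difference_hom S B actB T actT" using B.exists_pseudofield_image[OF inj_g] by blast
  moreover have "g ` carrier B \<subseteq> carrier A \<union> j ` carrier B" by (auto simp: g_def gh inv_into_into)
  ultimately show thesis using that gh by simp
qed

section \<open>Unions of chains\<close>

text \<open>The elements of \<open>C\<close> pair a ring with its action. Each operation is computed
  in some chosen member that contains the operands; in a chain the choice does not affect the
  result.\<close>

definition chain_ring :: "('a ring \<times> ('s \<Rightarrow> 'a \<Rightarrow> 'a)) set \<Rightarrow> 'a ring" where
  "chain_ring C =
     \<lparr> carrier = (\<Union>p\<in>C. carrier (fst p)),
       monoid.mult = (\<lambda>x y. x \<otimes>\<^bsub>fst (SOME p. p \<in> C \<and> x \<in> carrier (fst p) \<and> y \<in> carrier (fst p))\<^esub> y),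
       one = \<one>\<^bsub>fst (SOME p. p \<in> C)\<^esub>,
       ring.zero = \<zero>\<^bsub>fst (SOME p. p \<in> C)\<^esub>,
       add = (\<lambda>x y. x \<oplus>\<^bsub>fst (SOME p. p \<in> C \<and> x \<in> carrier (fst p) \<and> y \<in> carrier (fst p))\<^esub> y) \<rparr>"

definition chain_act :: "('a ring \<times> ('s \<Rightarrow> 'a \<Rightarrow> 'a)) set \<Rightarrow> 's \<Rightarrow> 'a \<Rightarrow> 'a" where
  "chain_act C \<sigma> =
     (\<lambda>x\<in>carrier (chain_ring C). snd (SOME p. p \<in> C \<and> x \<in> carrier (fst p)) \<sigma> x)"

locale difference_ring_chain =
  fixes S :: "('s, 'x) monoid_scheme" and C :: "('a ring \<times> ('s \<Rightarrow> 'a \<Rightarrow> 'a)) set"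
  assumes nonempty: "C \<noteq> {}"
    and difference_ring: "p \<in> C \<Longrightarrow> difference_ring S (fst p) (snd p)"
    and chain: "p \<in> C \<Longrightarrow> q \<in> C \<Longrightarrow>
      (\<lambda>x. x) \<in> difference_hom S (fst p) (snd p) (fst q) (snd q) \<or>
      (\<lambda>x. x) \<in> difference_hom S (fst q) (snd q) (fst p) (snd p)"
begin

lemma carrier_chain: "carrier (chain_ring C) = (\<Union>p\<in>C. carrier (fst p))"
  by (simp add: chain_ring_def)

lemma ring: "p \<in> C \<Longrightarrow> Ring.ring (fst p)"
  using difference_ring by (simp add: difference_ring_def cring_def)

text \<open>Of two members one includes into the other by a homomorphism, so their operations agree
  wherever both apply. Hence the choices made by \<open>SOME\<close> are harmless.\<close>

lemma
  assumes "p \<in> C" "q \<in> C"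
  shows same_one: "\<one>\<^bsub>fst p\<^esub> = \<one>\<^bsub>fst q\<^esub>" and same_zero: "\<zero>\<^bsub>fst p\<^esub> = \<zero>\<^bsub>fst q\<^esub>"
    and same_mult: "\<And>x y. x \<in> carrier (fst p) \<Longrightarrow> y \<in> carrier (fst p) \<Longrightarrow> x \<in> carrier (fst q) \<Longrightarrow>
      y \<in> carrier (fst q) \<Longrightarrow> x \<otimes>\<^bsub>fst p\<^esub> y = x \<otimes>\<^bsub>fst q\<^esub> y"
    and same_add: "\<And>x y. x \<in> carrier (fst p) \<Longrightarrow> y \<in> carrier (fst p) \<Longrightarrow> x \<in> carrier (fst q) \<Longrightarrow>
      y \<in> carrier (fst q) \<Longrightarrow> x \<oplus>\<^bsub>fst p\<^esub> y = x \<oplus>\<^bsub>fst q\<^esub> y"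
    and same_act: "\<And>x \<sigma>. \<sigma> \<in> carrier S \<Longrightarrow> x \<in> carrier (fst p) \<Longrightarrow> x \<in> carrier (fst q) \<Longrightarrow>
      snd p \<sigma> x = snd q \<sigma> x"
  using chain[OF assms] ring_hom_zero[OF _ ring[OF assms(1)] ring[OF assms(2)], of "\<lambda>x. x"]
    ring_hom_zero[OF _ ring[OF assms(2)] ring[OF assms(1)], of "\<lambda>x. x"]
  by (auto simp: difference_hom_def ring_hom_def)

lemma chain_one: "p \<in> C \<Longrightarrow> \<one>\<^bsub>chain_ring C\<^esub> = \<one>\<^bsub>fst p\<^esub>"
  using same_one[of "SOME p. p \<in> C" p] someI[of "\<lambda>p. p \<in> C" p] by (simp add: chain_ring_def)

lemma chain_zero: "p \<in> C \<Longrightarrow> \<zero>\<^bsub>chain_ring C\<^esub> = \<zero>\<^bsub>fst p\<^esub>"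
  using same_zero[of "SOME p. p \<in> C" p] someI[of "\<lambda>p. p \<in> C" p] by (simp add: chain_ring_def)

lemma
  assumes "p \<in> C" "x \<in> carrier (fst p)" "y \<in> carrier (fst p)"
  shows chain_mult: "x \<otimes>\<^bsub>chain_ring C\<^esub> y = x \<otimes>\<^bsub>fst p\<^esub> y"
    and chain_add: "x \<oplus>\<^bsub>chain_ring C\<^esub> y = x \<oplus>\<^bsub>fst p\<^esub> y"
proof -
  let ?q = "SOME p. p \<in> C \<and> x \<in> carrier (fst p) \<and> y \<in> carrier (fst p)"
  have "?q \<in> C \<and> x \<in> carrier (fst ?q) \<and> y \<in> carrier (fst ?q)"
    by (rule someI[where x = p]) (use assms in simp)
  thus "x \<otimes>\<^bsub>chain_ring C\<^esub> y = x \<otimes>\<^bsub>fst p\<^esub> y" "x \<oplus>\<^bsub>chain_ring C\<^esub> y = x \<oplus>\<^bsub>fst p\<^esub> y"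
    using same_mult[of ?q p x y] same_add[of ?q p x y] assms by (simp_all add: chain_ring_def)
qed

lemma chain_act_eq:
  assumes "p \<in> C" "x \<in> carrier (fst p)" "\<sigma> \<in> carrier S"
  shows "chain_act C \<sigma> x = snd p \<sigma> x"
proof -
  let ?q = "SOME p. p \<in> C \<and> x \<in> carrier (fst p)"
  have "?q \<in> C \<and> x \<in> carrier (fst ?q)" by (rule someI[where x = p]) (use assms in simp)
  thus ?thesis
    using same_act[of ?q p \<sigma> x] assms by (auto simp: chain_act_def carrier_chain)
qed

lemma chain_upper:
  assumes "p \<in> C" "q \<in> C"
  obtains r where "r \<in> C" "carrier (fst p) \<subseteq> carrier (fst r)" "carrier (fst q) \<subseteq> carrier (fst r)"
proof -
  have "carrier (fst p) \<subseteq> carrier (fst q) \<or> carrier (fst q) \<subseteq> carrier (fst p)"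
    using chain[OF assms] by (auto simp: difference_hom_def ring_hom_def)
  thus thesis using that assms by blast
qed

text \<open>Three elements, because associativity and distributivity involve three; each ring law is
  then checked inside one member.\<close>

lemma chain_common:
  assumes "x \<in> carrier (chain_ring C)" "y \<in> carrier (chain_ring C)" "z \<in> carrier (chain_ring C)"
  obtains p where "p \<in> C" "x \<in> carrier (fst p)" "y \<in> carrier (fst p)" "z \<in> carrier (fst p)"
proof -
  obtain p q r where pqr: "p \<in> C" "x \<in> carrier (fst p)" "q \<in> C" "y \<in> carrier (fst q)"
    "r \<in> C" "z \<in> carrier (fst r)" using assms by (auto simp: carrier_chain)
  obtain s where s: "s \<in> C" "carrier (fst p) \<subseteq> carrier (fst s)" "carrier (fst q) \<subseteq> carrier (fst s)"
    using chain_upper[OF pqr(1,3)] .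
  obtain t where "t \<in> C" "carrier (fst s) \<subseteq> carrier (fst t)" "carrier (fst r) \<subseteq> carrier (fst t)"
    using chain_upper[OF s(1) pqr(5)] .
  thus thesis using that pqr s by blast
qed

lemma chain_carrierI: "p \<in> C \<Longrightarrow> x \<in> carrier (fst p) \<Longrightarrow> x \<in> carrier (chain_ring C)"
  by (auto simp: carrier_chain)

lemma cring_chain: "cring (chain_ring C)"
proof (rule cringI)
  let ?U = "chain_ring C"
  obtain p0 where p0: "p0 \<in> C" using nonempty by blast
  interpret p0: difference_ring S "fst p0" "snd p0" by (rule difference_ring[OF p0])
  have zero: "\<zero>\<^bsub>?U\<^esub> \<in> carrier ?U" and one: "\<one>\<^bsub>?U\<^esub> \<in> carrier ?U"
    using chain_carrierI[OF p0] chain_zero[OF p0] chain_one[OF p0] by simp_all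
  show "abelian_group ?U"
  proof (rule abelian_groupI)
    fix x y z assume "x \<in> carrier ?U" "y \<in> carrier ?U" "z \<in> carrier ?U"
    then obtain p where p: "p \<in> C" "x \<in> carrier (fst p)" "y \<in> carrier (fst p)" "z \<in> carrier (fst p)"
      by (rule chain_common)
    interpret p: difference_ring S "fst p" "snd p" by (rule difference_ring[OF p(1)])
    show "x \<oplus>\<^bsub>?U\<^esub> y \<in> carrier ?U" "x \<oplus>\<^bsub>?U\<^esub> y = y \<oplus>\<^bsub>?U\<^esub> x"
      "(x \<oplus>\<^bsub>?U\<^esub> y) \<oplus>\<^bsub>?U\<^esub> z = x \<oplus>\<^bsub>?U\<^esub> (y \<oplus>\<^bsub>?U\<^esub> z)" "\<zero>\<^bsub>?U\<^esub> \<oplus>\<^bsub>?U\<^esub> x = x"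
      using p chain_carrierI[OF p(1)] by (simp_all add: chain_zero[OF p(1)] chain_add[OF p(1)] p.a_ac)
    show "\<exists>y\<in>carrier ?U. y \<oplus>\<^bsub>?U\<^esub> x = \<zero>\<^bsub>?U\<^esub>"
      by (rule bexI[of _ "\<ominus>\<^bsub>fst p\<^esub> x"])
         (use p chain_carrierI[OF p(1)] in \<open>simp_all add: chain_zero[OF p(1)] chain_add[OF p(1)] p.l_neg\<close>)
  qed (rule zero)
  show "comm_monoid ?U"
  proof (rule comm_monoidI)
    fix x y z assume "x \<in> carrier ?U" "y \<in> carrier ?U" "z \<in> carrier ?U"
    then obtain p where p: "p \<in> C" "x \<in> carrier (fst p)" "y \<in> carrier (fst p)" "z \<in> carrier (fst p)"
      by (rule chain_common)
    interpret p: difference_ring S "fst p" "snd p" by (rule difference_ring[OF p(1)])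
    show "x \<otimes>\<^bsub>?U\<^esub> y \<in> carrier ?U" "x \<otimes>\<^bsub>?U\<^esub> y = y \<otimes>\<^bsub>?U\<^esub> x"
      "(x \<otimes>\<^bsub>?U\<^esub> y) \<otimes>\<^bsub>?U\<^esub> z = x \<otimes>\<^bsub>?U\<^esub> (y \<otimes>\<^bsub>?U\<^esub> z)" "\<one>\<^bsub>?U\<^esub> \<otimes>\<^bsub>?U\<^esub> x = x"
      using p chain_carrierI[OF p(1)] by (simp_all add: chain_one[OF p(1)] chain_mult[OF p(1)] p.m_ac)
  qed (rule one)
  fix x y z assume "x \<in> carrier ?U" "y \<in> carrier ?U" "z \<in> carrier ?U"
  then obtain p where p: "p \<in> C" "x \<in> carrier (fst p)" "y \<in> carrier (fst p)" "z \<in> carrier (fst p)"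
    by (rule chain_common)
  interpret p: difference_ring S "fst p" "snd p" by (rule difference_ring[OF p(1)])
  show "(x \<oplus>\<^bsub>?U\<^esub> y) \<otimes>\<^bsub>?U\<^esub> z = x \<otimes>\<^bsub>?U\<^esub> z \<oplus>\<^bsub>?U\<^esub> y \<otimes>\<^bsub>?U\<^esub> z"
    using p by (simp add: chain_add[OF p(1)] chain_mult[OF p(1)] p.l_distr)
qed

lemma difference_ring_union: "difference_ring S (chain_ring C) (chain_act C)"
proof (rule difference_ringI)
  let ?U = "chain_ring C"
  obtain p0 where p0: "p0 \<in> C" using nonempty by blast
  interpret p0: difference_ring S "fst p0" "snd p0" by (rule difference_ring[OF p0])
  show "Group.group S" by (rule p0.group_S)
  interpret G: Group.group S by (rule p0.group_S)
  show "cring ?U" by (rule cring_chain)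
  show "chain_act C \<sigma> \<in> extensional (carrier ?U)" for \<sigma>
    unfolding chain_act_def by (rule restrict_extensional)
  show "chain_act C \<sigma> \<in> ring_hom ?U ?U" if \<sigma>: "\<sigma> \<in> carrier S" for \<sigma>
  proof (rule ring_hom_memI)
    show "chain_act C \<sigma> \<one>\<^bsub>?U\<^esub> = \<one>\<^bsub>?U\<^esub>"
      using \<sigma> by (simp add: chain_one[OF p0] chain_act_eq[OF p0] p0.act_unit)
  next
    fix x y assume "x \<in> carrier ?U" "y \<in> carrier ?U"
    then obtain p where p: "p \<in> C" "x \<in> carrier (fst p)" "y \<in> carrier (fst p)"
      using chain_common[of x y y] by blast
    interpret p: difference_ring S "fst p" "snd p" by (rule difference_ring[OF p(1)])
    show "chain_act C \<sigma> (x \<otimes>\<^bsub>?U\<^esub> y) = chain_act C \<sigma> x \<otimes>\<^bsub>?U\<^esub> chain_act C \<sigma> y"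
      "chain_act C \<sigma> (x \<oplus>\<^bsub>?U\<^esub> y) = chain_act C \<sigma> x \<oplus>\<^bsub>?U\<^esub> chain_act C \<sigma> y"
      using p \<sigma> by (simp_all add: chain_add[OF p(1)] chain_mult[OF p(1)] chain_act_eq[OF p(1)]
          p.act_closed p.act_mult p.act_add)
    show "chain_act C \<sigma> x \<in> carrier ?U"
      using p \<sigma> chain_carrierI[OF p(1)] by (simp add: chain_act_eq[OF p(1)] p.act_closed)
  qed
  fix x assume "x \<in> carrier ?U"
  then obtain p where p: "p \<in> C" "x \<in> carrier (fst p)" by (auto simp: carrier_chain)
  interpret p: difference_ring S "fst p" "snd p" by (rule difference_ring[OF p(1)])
  show "chain_act C \<one>\<^bsub>S\<^esub> x = x"
    using p p.id_eq_one by (simp add: chain_act_eq[OF p(1)]) (metis restrict_apply')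
  show "chain_act C (\<sigma> \<otimes>\<^bsub>S\<^esub> \<tau>) x = chain_act C \<sigma> (chain_act C \<tau> x)"
    if "\<sigma> \<in> carrier S" "\<tau> \<in> carrier S" for \<sigma> \<tau>
    using p that p.composition_rule by (simp add: chain_act_eq[OF p(1)] p.act_closed)
qed

lemma chain_difference_hom:
  assumes "p \<in> C"
  shows "(\<lambda>x. x) \<in> difference_hom S (fst p) (snd p) (chain_ring C) (chain_act C)"
  using assms
  by (auto simp: difference_hom_def ring_hom_def chain_carrierI chain_mult chain_add chain_one chain_act_eq)

text \<open>A difference ideal avoiding 1 meets every member in such an ideal, thus in zero, and
  quasi-inverses are found inside a member.\<close>

lemma pseudofield_union:
  assumes pf: "\<And>p. p \<in> C \<Longrightarrow> pseudofield S (fst p) (snd p)"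
  shows "pseudofield S (chain_ring C) (chain_act C)"
proof -
  let ?U = "chain_ring C"
  obtain p0 where p0: "p0 \<in> C" using nonempty by blast
  interpret p0: pseudofield S "fst p0" "snd p0" by (rule pf[OF p0])
  have "simple_difference_ring S ?U (chain_act C)"
  proof (rule simple_difference_ringI[OF difference_ring_union])
    show "\<one>\<^bsub>?U\<^esub> \<noteq> \<zero>\<^bsub>?U\<^esub>"
      using p0.one_not_zero by (simp add: chain_one[OF p0] chain_zero[OF p0])
    fix I assume I: "difference_ideal S ?U (chain_act C) I" "\<one>\<^bsub>?U\<^esub> \<notin> I"
    have id: "ideal I ?U" using I(1) unfolding difference_ideal_def by (rule conjunct1)
    show "I \<subseteq> {\<zero>\<^bsub>?U\<^esub>}"
    proof
      fix x assume x: "x \<in> I"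
      then obtain p where p: "p \<in> C" "x \<in> carrier (fst p)"
        using ideal.Icarr[OF id x] by (auto simp: carrier_chain)
      interpret p: pseudofield S "fst p" "snd p" by (rule pf[OF p(1)])
      have "{x \<in> carrier (fst p). x \<in> I} = {\<zero>\<^bsub>fst p\<^esub>}"
        by (rule p.proper_difference_ideal_zero[OF difference_ideal_vimage[OF p.difference_ring_axioms
                difference_ring_union chain_difference_hom[OF p(1)] I(1)]])
           (use I(2) in \<open>simp add: chain_one[OF p(1)]\<close>)
      hence "x \<in> {\<zero>\<^bsub>fst p\<^esub>}" using x p(2) by blast
      thus "x \<in> {\<zero>\<^bsub>?U\<^esub>}" by (simp add: chain_zero[OF p(1)])
    qed
  qed
  moreover have "absolutely_flat ?U"
    unfolding absolutely_flat_def
  proof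
    fix x assume "x \<in> carrier ?U"
    then obtain p where p: "p \<in> C" "x \<in> carrier (fst p)" by (auto simp: carrier_chain)
    interpret p: pseudofield S "fst p" "snd p" by (rule pf[OF p(1)])
    obtain y where y: "y \<in> carrier (fst p)" "x = x \<otimes>\<^bsub>fst p\<^esub> y \<otimes>\<^bsub>fst p\<^esub> x"
      using p.absolutely_flat p(2) unfolding absolutely_flat_def by blast
    have "x \<otimes>\<^bsub>?U\<^esub> y \<otimes>\<^bsub>?U\<^esub> x = x"
      using p(2) y(1) by (simp add: chain_mult[OF p(1)] y(2)[symmetric])
    thus "\<exists>y\<in>carrier ?U. x = x \<otimes>\<^bsub>?U\<^esub> y \<otimes>\<^bsub>?U\<^esub> x"
      by (metis chain_carrierI[OF p(1) y(1)])
  qed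
  ultimately show ?thesis
    unfolding pseudofield_def pseudofield_axioms_def by (rule conjI)
qed

end

section \<open>Reduction to small families of equations\<close>

lemma finite_linear_order_greatest:
  assumes "finite A" "A \<noteq> {}" "linear_order r"
  shows "\<exists>m\<in>A. \<forall>k\<in>A. (k, m) \<in> r"
  using assms(1,2)
proof (induction rule: finite_ne_induct)
  case (singleton x)
  thus ?case using assms(3) by (auto simp: order_on_defs refl_on_def)
next
  case (insert x A)
  then obtain m where m: "m \<in> A" "\<forall>k\<in>A. (k, m) \<in> r" by blast
  have "(x, m) \<in> r \<or> (m, x) \<in> r" and r: "trans r" "(x, x) \<in> r"
    using assms(3) by (simp_all add: order_on_defs refl_on_def total_on_def) metis
  thus ?case using m by (metis insert_iff transD)
qed

context difference_ring
begin

text \<open>This set is the largest difference ideal inside \<open>p\<close>. In a simple ring it is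
  zero when \<open>p\<close> is proper, so an element whose translates all lie in \<open>p\<close>
  is zero.\<close>

lemma difference_ideal_core:
  assumes p: "ideal p R"
  shows "difference_ideal S R act {x \<in> carrier R. \<forall>\<sigma>\<in>carrier S. act \<sigma> x \<in> p}"
proof -
  interpret p: ideal p R by (rule p)
  interpret G: Group.group S by (rule group_S)
  let ?J = "{x \<in> carrier R. \<forall>\<sigma>\<in>carrier S. act \<sigma> x \<in> p}"
  have "ideal ?J R"
  proof (rule idealI[OF ring_axioms])
    show "subgroup ?J (add_monoid R)"
    proof
      fix x assume x: "x \<in> ?J"
      have "act \<sigma> (\<ominus>\<^bsub>R\<^esub> x) = \<ominus>\<^bsub>R\<^esub> act \<sigma> x" if "\<sigma> \<in> carrier S" for \<sigma>
        using x that act_add[OF that, of "\<ominus>\<^bsub>R\<^esub> x" x]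
        by (intro minus_equality[symmetric]) (auto simp: act_closed act_zero l_neg)
      thus "inv\<^bsub>add_monoid R\<^esub> x \<in> ?J" using x unfolding a_inv_def[symmetric] by simp
    qed (auto simp: act_add act_zero)
  qed (auto simp: act_mult act_closed p.I_l_closed p.I_r_closed)
  moreover have "act \<sigma> ` ?J \<subseteq> ?J" if "\<sigma> \<in> carrier S" for \<sigma>
    using that by (auto simp: act_closed composition_rule[symmetric])
  ultimately show ?thesis by (simp add: difference_ideal_def)
qed

text \<open>Modulo a maximal ideal \<open>p\<close>, the coefficients lie in a field, so one element of \<open>I\<close> for every
  possible leading monomial spans \<open>I\<close> modulo \<open>p\<close>.\<close>

lemma diff_eval_in_maximal_ideal:
  assumes p: "ideal p R" "\<one>\<^bsub>R\<^esub> \<notin> p"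
    and max: "\<And>J. ideal J R \<Longrightarrow> p \<subseteq> J \<Longrightarrow> \<one>\<^bsub>R\<^esub> \<notin> J \<Longrightarrow> J = p"
    and I: "ideal I (diff_poly_ring S R n)" and b: "b \<in> {..<n} \<rightarrow>\<^sub>E carrier R"
    and r: "well_order r"
    and F: "\<And>m f. f \<in> I \<Longrightarrow> f m \<notin> p \<Longrightarrow> (\<forall>k. f k \<notin> p \<longrightarrow> (k, m) \<in> r) \<Longrightarrow>
      \<exists>g\<in>I. g m \<notin> p \<and> (\<forall>k. g k \<notin> p \<longrightarrow> (k, m) \<in> r) \<and> diff_eval R R act (\<lambda>x. x) b g = \<zero>\<^bsub>R\<^esub>"
    and f: "f \<in> I"
  shows "diff_eval R R act (\<lambda>x. x) b f \<in> p"
proof -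
  let ?P = "diff_poly_ring S R n" and ?ev = "diff_eval R R act (\<lambda>x. x) b"
  note d = indexed_poly_ring_simps[of "diff_vars S n", folded diff_poly_ring_def]
  interpret p: ideal p R by (rule p)
  interpret I: ideal I ?P by (rule I)
  have id: "(\<lambda>x. x) \<in> difference_hom S R act R act" by (auto simp: difference_hom_def ring_hom_def)
  note ev = diff_eval_hom[OF difference_ring_axioms id b]
  have I_dp: "g \<in> dp_set n" if "g \<in> I" for g using I.Icarr[OF that] by (simp add: d)
  \<comment> \<open>\<open>m\<close> is the leading monomial of \<open>g\<close> modulo
    \<open>p\<close>. Only constant multiples are ever subtracted, so an arbitrary well order of the
    monomials does the work of a monomial order.\<close>
  define lead where "lead g m \<longleftrightarrow> g m \<notin> p \<and> (\<forall>k. g k \<notin> p \<longrightarrow> (k, m) \<in> r)" for g m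
  have ex_lead: "\<exists>m. lead g m" if g: "g \<in> I" and ng: "?ev g \<notin> p" for g
  proof -
    have "{m. g m \<notin> p} \<subseteq> {m. g m \<noteq> \<zero>\<^bsub>R\<^esub>}" by auto
    hence fin: "finite {m. g m \<notin> p}" using pset_support[OF I_dp[OF g]] finite_subset by blast
    have ne: "{m. g m \<notin> p} \<noteq> {}"
      using diff_eval_ideal[OF difference_ring_axioms id b p(1) I_dp[OF g]] ng by blast
    have "linear_order r" using r by (simp add: well_order_on_def)
    from finite_linear_order_greatest[OF fin ne this] show ?thesis
      by (auto simp: lead_def)
  qed
  have wf: "wf (r - Id)" using r by (simp add: well_order_on_def)
  have main: "\<forall>g\<in>I. lead g m \<longrightarrow> ?ev g \<in> p" for m
    using wf
  proof (induction m rule: wf_induct_rule)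
    case (less m)
    show ?case
    proof (intro ballI impI)
      fix g assume g: "g \<in> I" "lead g m"
      then obtain h where h: "h \<in> I" "lead h m" "?ev h = \<zero>\<^bsub>R\<^esub>"
        using F[of g m] unfolding lead_def by blast
      note gR = pset_coeff[OF I_dp[OF g(1)]] and hR = pset_coeff[OF I_dp[OF h(1)]]
      have "h m \<notin> p" using h(2) by (simp add: lead_def)
      from maximal_ideal_inverse[OF p(1) max hR this]
      obtain y where y: "y \<in> carrier R" "\<one>\<^bsub>R\<^esub> \<ominus>\<^bsub>R\<^esub> h m \<otimes>\<^bsub>R\<^esub> y \<in> p" by blast
      \<comment> \<open>Modulo \<open>p\<close>, \<open>c\<close> is the negated quotient of the
        leading coefficients. Adding \<open>c\<close> times \<open>h\<close> cancels the coefficient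
        at \<open>m\<close> and leaves the value at \<open>b\<close> unchanged, since
        \<open>h\<close> vanishes there.\<close>
      define c where "c = \<ominus>\<^bsub>R\<^esub> (g m \<otimes>\<^bsub>R\<^esub> y)"
      have c: "c \<in> carrier R" using gR y by (simp add: c_def)
      define g' where "g' = g \<oplus>\<^bsub>?P\<^esub> indexed_const c \<otimes>\<^bsub>?P\<^esub> h"
      have cP: "indexed_const c \<in> carrier ?P" using c by (simp add: d indexed_pset.indexed_const)
      have chI: "indexed_const c \<otimes>\<^bsub>?P\<^esub> h \<in> I" by (rule I.I_l_closed[OF h(1) cP])
      have g'I: "g' \<in> I" unfolding g'_def
        by (rule additive_subgroup.a_closed[OF ideal.axioms(1)[OF I] g(1) chI])
      have g': "g' k = g k \<oplus>\<^bsub>R\<^esub> c \<otimes>\<^bsub>R\<^esub> h k" for k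
        using conv_const[OF c, of h] hR by (simp add: g'_def d indexed_padd_def poly_smul_def)
      have ev_g': "?ev g' = ?ev g"
      proof -
        have "?ev g' = ?ev g \<oplus>\<^bsub>R\<^esub> ?ev (indexed_const c) \<otimes>\<^bsub>R\<^esub> ?ev h"
          unfolding g'_def using ring_hom_add[OF ev I.Icarr[OF g(1)] I.Icarr[OF chI]]
            ring_hom_mult[OF ev cP I.Icarr[OF h(1)]] by simp
        thus ?thesis
          using h(3) ring_hom_closed[OF ev I.Icarr[OF g(1)]] ring_hom_closed[OF ev cP] by simp
      qed
      have "g' m = g m \<otimes>\<^bsub>R\<^esub> (\<one>\<^bsub>R\<^esub> \<ominus>\<^bsub>R\<^esub> h m \<otimes>\<^bsub>R\<^esub> y)"
        unfolding g' c_def using gR[of m] hR[of m] y(1)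
        by (simp add: minus_eq r_distr r_minus l_minus m_ac)
      hence g'm: "g' m \<in> p" using p.I_l_closed[OF y(2) gR] by simp
      \<comment> \<open>Otherwise \<open>g'\<close> also has a value outside \<open>p\<close>, hence
        a leading monomial; it is strictly below \<open>m\<close>, against the induction
        hypothesis.\<close>
      show "?ev g \<in> p"
      proof (rule ccontr)
        assume "?ev g \<notin> p"
        then obtain k where k: "lead g' k" using ex_lead[OF g'I] ev_g' by auto
        hence "g' k \<notin> p" by (simp add: lead_def)
        hence "g k \<notin> p \<or> h k \<notin> p" unfolding g'
          using p.I_l_closed[of "h k" c] c additive_subgroup.a_closed[OF ideal.axioms(1)[OF p(1)]] by blast
        hence "(k, m) \<in> r" using g(2) h(2) by (auto simp: lead_def)
        moreover have "k \<noteq> m" using g'm \<open>g' k \<notin> p\<close> by blast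
        ultimately have "?ev g' \<in> p" using less k g'I by blast
        thus False using ev_g' \<open>?ev g \<notin> p\<close> by simp
      qed
    qed
  qed
  show ?thesis using ex_lead[OF f] main f by blast
qed

end

text \<open>It suffices to solve the families with one element of \<open>I\<close> for each leading
  monomial modulo a maximal ideal \<open>p\<close>: all values of \<open>I\<close> at a common zero
  then lie in \<open>p\<close>, and so do their translates.\<close>

lemma (in simple_difference_ring) ideal_zerosI:
  assumes fam: "\<And>n I F. difference_ideal S (diff_poly_ring S R n) (dp_act n) I \<Longrightarrow>
      I \<noteq> carrier (diff_poly_ring S R n) \<Longrightarrow> range (F :: ('a \<times> nat) multiset \<Rightarrow> _) \<subseteq> I \<Longrightarrow>
      \<exists>b. common_zero R R act (\<lambda>x. x) n (range F) b"
  shows "ideal_zeros S R act"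
  unfolding ideal_zeros_def
proof (intro allI impI, elim conjE)
  fix n I assume I: "difference_ideal S (diff_poly_ring S R n) (dp_act n) I"
    "I \<noteq> carrier (diff_poly_ring S R n)"
  let ?P = "diff_poly_ring S R n"
  interpret P: difference_ring S ?P "dp_act n" by (rule difference_ring_diff_poly)
  interpret I: ideal I ?P using I by (simp add: difference_ideal_def)
  interpret G: Group.group S by (rule group_S)
  have "difference_ideal S R (\<lambda>\<sigma> x. x) {\<zero>\<^bsub>R\<^esub>}" by (simp add: zeroideal)
  moreover have "\<one>\<^bsub>R\<^esub> \<notin> {\<zero>\<^bsub>R\<^esub>}" using one_not_zero by simp
  ultimately obtain p where p: "difference_ideal S R (\<lambda>\<sigma> x. x) p" "\<one>\<^bsub>R\<^esub> \<notin> p"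
    "\<And>J. difference_ideal S R (\<lambda>\<sigma> x. x) J \<Longrightarrow> p \<subseteq> J \<Longrightarrow> \<one>\<^bsub>R\<^esub> \<notin> J \<Longrightarrow> J = p"
    by (rule exists_maximal_difference_ideal) blast
  note p = p[unfolded difference_ideal_trivial_action]
  obtain r :: "('a \<times> nat) multiset rel" where r: "well_order r" using well_order_on by blast
  define lead where "lead g m \<longleftrightarrow> g m \<notin> p \<and> (\<forall>k. g k \<notin> p \<longrightarrow> (k, m) \<in> r)" for g m
  \<comment> \<open>The default, the zero polynomial, keeps the family inside \<open>I\<close> at
    monomials that lead no element of \<open>I\<close>.\<close>
  define F where "F m = (if \<exists>g\<in>I. lead g m then SOME g. g \<in> I \<and> lead g m else \<zero>\<^bsub>?P\<^esub>)" for m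
  have F: "F m \<in> I \<and> lead (F m) m" if "g \<in> I" "lead g m" for g m
  proof -
    have "(SOME g. g \<in> I \<and> lead g m) \<in> I \<and> lead (SOME g. g \<in> I \<and> lead g m) m"
      by (rule someI[of "\<lambda>g. g \<in> I \<and> lead g m"]) (use that in blast)
    thus ?thesis using that unfolding F_def by auto
  qed
  have "range F \<subseteq> I"
  proof
    fix f assume "f \<in> range F"
    then obtain m where "f = F m" by blast
    thus "f \<in> I" using F[of _ m] by (cases "\<exists>g\<in>I. lead g m") (auto simp: F_def)
  qed
  from fam[OF I this] obtain b where b: "b \<in> {..<n} \<rightarrow>\<^sub>E carrier R"
    "\<And>m. diff_eval R R act (\<lambda>x. x) b (F m) = \<zero>\<^bsub>R\<^esub>" by (auto simp: common_zero_def)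
  have id: "(\<lambda>x. x) \<in> difference_hom S R act R act" by (auto simp: difference_hom_def ring_hom_def)
  note ev_act = diff_eval_act[OF difference_ring_axioms id b(1)]
  let ?ev = "diff_eval R R act (\<lambda>x. x) b"
  have ev: "?ev f \<in> p" if "f \<in> I" for f
  proof (rule diff_eval_in_maximal_ideal[OF p I.ideal_axioms b(1) r _ that])
    fix m g assume "g \<in> I" "g m \<notin> p" "\<forall>k. g k \<notin> p \<longrightarrow> (k, m) \<in> r"
    hence "F m \<in> I \<and> lead (F m) m" using F[of g m] by (simp add: lead_def)
    thus "\<exists>g\<in>I. g m \<notin> p \<and> (\<forall>k. g k \<notin> p \<longrightarrow> (k, m) \<in> r) \<and> ?ev g = \<zero>\<^bsub>R\<^esub>"
      using b(2) unfolding lead_def by blast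
  qed
  let ?J = "{x \<in> carrier R. \<forall>\<sigma>\<in>carrier S. act \<sigma> x \<in> p}"
  have "\<one>\<^bsub>R\<^esub> \<notin> ?J"
  proof
    assume "\<one>\<^bsub>R\<^esub> \<in> ?J"
    hence "act \<one>\<^bsub>S\<^esub> \<one>\<^bsub>R\<^esub> \<in> p" using G.one_closed by simp
    thus False using p(2) by (simp add: act_unit)
  qed
  hence J: "?J = {\<zero>\<^bsub>R\<^esub>}" by (rule proper_difference_ideal_zero[OF difference_ideal_core[OF p(1)]])
  have "?ev f = \<zero>\<^bsub>R\<^esub>" if f: "f \<in> I" for f
  proof -
    \<comment> \<open>A translate of the value of \<open>f\<close> is the value of a translate of
      \<open>f\<close>, again an element of \<open>I\<close>; so the value lies in the core of
      \<open>p\<close>, which is zero.\<close>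
    have "dp_act n \<sigma> f \<in> I" if "\<sigma> \<in> carrier S" for \<sigma>
      using I(1) f that by (auto simp: difference_ideal_def)
    hence "?ev f \<in> ?J"
      using ev ev_act[OF _ I.Icarr[OF f]]
        ring_hom_closed[OF diff_eval_hom[OF difference_ring_axioms id b(1)] I.Icarr[OF f]] by fastforce
    thus ?thesis unfolding J by simp
  qed
  thus "\<exists>a. common_zero R R act (\<lambda>x. x) n I a" using b(1) by (auto simp: common_zero_def)
qed

text \<open>The polynomials vanishing at the zero in \<open>B\<close> form a difference ideal
  containing \<open>E\<close>. It is proper because \<open>1 \<noteq> 0\<close> carries over to
  \<open>B\<close> along the injection.\<close>

lemma (in simple_difference_ring) extension_zerosI:
  assumes zeros: "ideal_zeros S R act"
  shows "extension_zeros S R act"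
  unfolding extension_zeros_def
proof (intro allI impI, elim conjE exE)
  fix n E and B :: "(('a \<times> nat) multiset \<Rightarrow> 'c) set ring"
  assume E: "E \<subseteq> carrier (diff_poly_ring S R n)" and "zero_in_extension S R act n E B"
  then obtain actB \<iota> b where B: "difference_ring S B actB"
    and \<iota>: "\<iota> \<in> difference_hom S R act B actB" "inj_on \<iota> (carrier R)"
    and zero: "common_zero R B actB \<iota> n E b" by (auto simp: zero_in_extension_def)
  let ?P = "diff_poly_ring S R n" and ?ev = "diff_eval R B actB \<iota> b"
  interpret B: difference_ring S B actB by (rule B)
  interpret P: difference_ring S ?P "dp_act n" by (rule difference_ring_diff_poly)
  have b: "b \<in> {..<n} \<rightarrow>\<^sub>E carrier B" using zero by (simp add: common_zero_def)
  note \<iota>r = difference_hom_ring_hom[OF \<iota>(1)]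
  have ev: "?ev \<in> difference_hom S ?P (dp_act n) B actB"
    using diff_eval_hom[OF B \<iota>(1) b] diff_eval_act[OF B \<iota>(1) b] by (simp add: difference_hom_def)
  let ?I = "{f \<in> carrier ?P. ?ev f \<in> {\<zero>\<^bsub>B\<^esub>}}"
  have "difference_ideal S B actB {\<zero>\<^bsub>B\<^esub>}"
    using B.zeroideal B.act_zero by (auto simp: difference_ideal_def)
  hence I: "difference_ideal S ?P (dp_act n) ?I"
    by (rule difference_ideal_vimage[OF P.difference_ring_axioms B ev])
  have "\<iota> \<zero>\<^bsub>R\<^esub> = \<zero>\<^bsub>B\<^esub>" by (rule ring_hom_zero[OF \<iota>r ring_axioms B.ring_axioms])
  hence "\<one>\<^bsub>B\<^esub> \<noteq> \<zero>\<^bsub>B\<^esub>"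
    using inj_onD[OF \<iota>(2), of "\<one>\<^bsub>R\<^esub>" "\<zero>\<^bsub>R\<^esub>"] ring_hom_one[OF \<iota>r] one_not_zero by auto
  hence "\<one>\<^bsub>?P\<^esub> \<notin> ?I" using ring_hom_one[OF difference_hom_ring_hom[OF ev]] by simp
  hence "?I \<noteq> carrier ?P" using P.one_closed by blast
  then obtain a where a: "common_zero R R act (\<lambda>x. x) n ?I a"
    using zeros I unfolding ideal_zeros_def by blast
  have EI: "f \<in> ?I" if "f \<in> E" for f using E zero that by (auto simp: common_zero_def)
  have "common_zero R R act (\<lambda>x. x) n E a"
    unfolding common_zero_def
  proof (intro conjI ballI)
    show "a \<in> {..<n} \<rightarrow>\<^sub>E carrier R" using a by (simp add: common_zero_def)
    fix f assume "f \<in> E"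
    from EI[OF this] show "diff_eval R R act (\<lambda>x. x) a f = \<zero>\<^bsub>R\<^esub>" using a by (simp add: common_zero_def)
  qed
  thus "\<exists>a. common_zero R R act (\<lambda>x. x) n E a" by blast
qed

section \<open>Deciding all small systems\<close>

abbreviation extends ::
  "('s, 'x) monoid_scheme \<Rightarrow> ('a, 'm) ring_scheme \<Rightarrow> ('s \<Rightarrow> 'a \<Rightarrow> 'a) \<Rightarrow>
     ('a, 'n) ring_scheme \<Rightarrow> ('s \<Rightarrow> 'a \<Rightarrow> 'a) \<Rightarrow> bool" where
  "extends S A actA T actT \<equiv> (\<lambda>x. x) \<in> difference_hom S A actA T actT"

lemma extends_refl: "extends S A actA A actA"
  by (simp add: difference_hom_def ring_hom_def)

lemma extends_trans:
  "extends S A actA B actB \<Longrightarrow> extends S B actB T actT \<Longrightarrow> extends S A actA T actT"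
  by (rule difference_hom_comp)

lemma extends_carrier: "extends S A actA T actT \<Longrightarrow> carrier A \<subseteq> carrier T"
  by (auto simp: difference_hom_def ring_hom_def)

lemma extends_zero:
  assumes "difference_ring S A actA" "difference_ring S T actT" "extends S A actA T actT"
  shows "\<zero>\<^bsub>A\<^esub> = \<zero>\<^bsub>T\<^esub>"
proof -
  interpret A: difference_ring S A actA by fact
  interpret T: difference_ring S T actT by fact
  show ?thesis
    using ring_hom_zero[OF difference_hom_ring_hom[OF assms(3)] A.ring_axioms T.ring_axioms] .
qed

text \<open>Polynomials are coefficient functions, so with the common zero and the compatible
  addition the very same function is a polynomial over \<open>T\<close>.\<close>

lemma diff_poly_carrier_mono:
  assumes A: "difference_ring S A actA" and T: "difference_ring S T actT"
    and ext: "extends S A actA T actT" and f: "f \<in> carrier (diff_poly_ring S A n)"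
  shows "f \<in> carrier (diff_poly_ring S T n)"
proof -
  interpret A: difference_ring S A actA by (rule A)
  interpret T: difference_ring S T actT by (rule T)
  have zero: "\<zero>\<^bsub>A\<^esub> = \<zero>\<^bsub>T\<^esub>" by (rule extends_zero[OF A T ext])
  have "f \<in> A.dp_set n" using f by (simp add: A.diff_poly_carrier)
  hence "f \<in> T.dp_set n"
  proof (induction rule: A.indexed_pset.induct)
    case (indexed_const k)
    hence "T.indexed_const k \<in> T.dp_set n"
      using extends_carrier[OF ext] by (intro T.indexed_pset.indexed_const) blast
    thus ?case unfolding A.indexed_const_def T.indexed_const_def zero .
  next
    case (indexed_padd P Q)
    have "A.indexed_padd P Q = T.indexed_padd P Q"
      using A.pset_coeff[OF indexed_padd(1)] A.pset_coeff[OF indexed_padd(2)]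
        ring_hom_add[OF difference_hom_ring_hom[OF ext]]
      by (auto simp: A.indexed_padd_def T.indexed_padd_def)
    thus ?case using T.indexed_pset.indexed_padd[OF indexed_padd(3,4)] by simp
  next
    case (indexed_pmult P i)
    have "A.indexed_pmult P i = T.indexed_pmult P i"
      by (auto simp: A.indexed_pmult_def T.indexed_pmult_def zero)
    thus ?case using T.indexed_pset.indexed_pmult[OF indexed_pmult(3,2)] by simp
  qed
  thus ?thesis by (simp add: T.diff_poly_carrier)
qed

text \<open>\<open>\<iota>\<close> is fixed only on \<open>carrier A\<close> because it will be the
  composite of an embedding \<open>h\<close> into \<open>B\<close> and a renaming \<open>g\<close>
  of \<open>B\<close>.\<close>

lemma diff_eval_extends:
  assumes A: "difference_ring S A actA" and T: "difference_ring S T actT"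
    and ext: "extends S A actA T actT" and f: "f \<in> carrier (diff_poly_ring S A n)"
    and \<iota>: "\<And>x. x \<in> carrier A \<Longrightarrow> \<iota> x = x"
  shows "diff_eval A T actT \<iota> b f = diff_eval T T actT (\<lambda>x. x) b f"
proof -
  interpret A: difference_ring S A actA by (rule A)
  have "f m \<in> carrier A" for m using f A.pset_coeff by (simp add: A.diff_poly_carrier)
  thus ?thesis by (simp add: diff_eval_def extends_zero[OF A T ext] \<iota>)
qed

lemma common_zero_difference_hom:
  assumes A: "difference_ring S A actA" and B: "difference_ring S B actB"
    and T: "difference_ring S T actT" and ext: "extends S A actA T actT"
    and h: "h \<in> difference_hom S A actA B actB" and g: "g \<in> difference_hom S B actB T actT"
    and gh: "\<And>x. x \<in> carrier A \<Longrightarrow> g (h x) = x"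
    and E: "E \<subseteq> carrier (diff_poly_ring S A n)" and b: "common_zero A B actB h n E b"
  shows "common_zero T T actT (\<lambda>x. x) n E (\<lambda>i\<in>{..<n}. g (b i))"
proof -
  interpret A: difference_ring S A actA by (rule A)
  interpret B: difference_ring S B actB by (rule B)
  interpret T: difference_ring S T actT by (rule T)
  note gr = difference_hom_ring_hom[OF g]
  have bB: "b \<in> {..<n} \<rightarrow>\<^sub>E carrier B" using b by (simp add: common_zero_def)
  have "diff_eval T T actT (\<lambda>x. x) (\<lambda>i\<in>{..<n}. g (b i)) f = \<zero>\<^bsub>T\<^esub>" if f: "f \<in> E" for f
  proof -
    have fA: "f \<in> carrier (diff_poly_ring S A n)" using f E by blast
    have "diff_eval T T actT (\<lambda>x. x) (\<lambda>i\<in>{..<n}. g (b i)) f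
        = diff_eval A T actT (\<lambda>x. g (h x)) (\<lambda>i\<in>{..<n}. g (b i)) f"
      by (rule diff_eval_extends[OF A T ext fA gh, symmetric])
    also have "\<dots> = g (diff_eval A B actB h b f)"
      by (rule A.diff_eval_comp[OF B h bB T g, symmetric]) (use fA in \<open>simp add: A.diff_poly_carrier\<close>)
    also have "\<dots> = \<zero>\<^bsub>T\<^esub>"
      using b f ring_hom_zero[OF gr B.ring_axioms T.ring_axioms] by (simp add: common_zero_def)
    finally show ?thesis .
  qed
  moreover have "(\<lambda>i\<in>{..<n}. g (b i)) \<in> {..<n} \<rightarrow>\<^sub>E carrier T"
    using bB ring_hom_closed[OF gr] by auto
  ultimately show ?thesis by (simp add: common_zero_def)
qed

section \<open>Systems of equations indexed by monomials\<close>

text \<open>The number of variables together with a family of polynomials, one per monomial. Using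
  families of this shape, not arbitrary sets of equations, keeps the number of systems small enough
  to be named in \<open>'u\<close>.\<close>

type_synonym ('s, 'u) system = "nat \<times> (('s \<times> nat) multiset \<Rightarrow> ('s \<times> nat) multiset \<Rightarrow> 'u)"

definition system_over :: "('s, 'x) monoid_scheme \<Rightarrow> 'u ring \<Rightarrow> ('s, 'u) system \<Rightarrow> bool" where
  "system_over S A e \<longleftrightarrow> range (snd e) \<subseteq> carrier (diff_poly_ring S A (fst e))"

definition solves :: "'u ring \<Rightarrow> ('s \<Rightarrow> 'u \<Rightarrow> 'u) \<Rightarrow> ('s, 'u) system \<Rightarrow> bool" where
  "solves A act e \<longleftrightarrow> (\<exists>b. common_zero A A act (\<lambda>x. x) (fst e) (range (snd e)) b)"

text \<open>Either the system is already solved, or no pseudofield extension with elements in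
  \<open>'u\<close> solves it. The extensions range over the same type, so \<open>'u\<close> must
  have room for every extension that matters.\<close>

definition decides ::
  "('s, 'x) monoid_scheme \<Rightarrow> 'u ring \<Rightarrow> ('s \<Rightarrow> 'u \<Rightarrow> 'u) \<Rightarrow> ('s, 'u) system \<Rightarrow> bool" where
  "decides S A act e \<longleftrightarrow> system_over S A e \<and>
     (\<forall>T actT. pseudofield S T actT \<and> extends S A act T actT \<and> solves T actT e \<longrightarrow> solves A act e)"

lemma system_over_mono:
  assumes "difference_ring S A actA" "difference_ring S T actT" "extends S A actA T actT"
    and "system_over S A e"
  shows "system_over S T e"
  using diff_poly_carrier_mono[OF assms(1-3)] assms(4) by (auto simp: system_over_def)

lemma solves_mono:
  assumes "difference_ring S A actA" "difference_ring S T actT" "extends S A actA T actT"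
    and "system_over S A e" "solves A actA e"
  shows "solves T actT e"
  using common_zero_difference_hom[OF assms(1,1,2,3) extends_refl assms(3) _ ] assms(4,5)
  unfolding solves_def system_over_def by blast

text \<open>An extension of \<open>T\<close> is one of \<open>A\<close>; if it solves the system
  then so does \<open>A\<close>, and solutions persist from \<open>A\<close> to
  \<open>T\<close>.\<close>

lemma decides_mono:
  assumes A: "difference_ring S A actA" and T: "difference_ring S T actT"
    and ext: "extends S A actA T actT" and dec: "decides S A actA e"
  shows "decides S T actT e"
  unfolding decides_def
proof (intro conjI allI impI)
  have over: "system_over S A e" using dec by (simp add: decides_def)
  thus "system_over S T e" by (rule system_over_mono[OF A T ext])
  fix V actV assume "pseudofield S V actV \<and> extends S T actT V actV \<and> solves V actV e"
  hence "solves A actA e"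
    using dec extends_trans[OF ext] unfolding decides_def by blast
  thus "solves T actT e" by (rule solves_mono[OF A T ext over])
qed

text \<open>Hausdorff's principle: adjoining an upper bound would enlarge a maximal chain. This form
  suits \<open>below\<close>, under which distinct ring records can lie below each other by
  differing only outside their carriers.\<close>

lemma exists_maximal_chain:
  assumes "x0 \<in> G"
  obtains C where "C \<noteq> {}" "C \<subseteq> G" "\<forall>x\<in>C. \<forall>y\<in>C. x = y \<or> below x y \<or> below y x"
    "\<forall>x\<in>G. (\<forall>y\<in>C. below y x) \<longrightarrow> x \<in> C"
proof -
  obtain C where C: "pred_on.maxchain G below C" using pred_on.Hausdorff by blast
  hence chain: "C \<subseteq> G" "\<forall>x\<in>C. \<forall>y\<in>C. x = y \<or> below x y \<or> below y x"
    by (auto simp: pred_on.maxchain_def pred_on.chain_def)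
  have max: "x \<in> C" if x: "x \<in> G" "\<And>y. y \<in> C \<Longrightarrow> below y x" for x
  proof (rule ccontr)
    assume "x \<notin> C"
    hence "C \<subset> insert x C" by blast
    moreover have "pred_on.chain G below (insert x C)"
      using chain x by (auto simp: pred_on.chain_def)
    ultimately show False using C unfolding pred_on.maxchain_def by blast
  qed
  have "C \<noteq> {}" using max[OF assms] by blast
  thus thesis using that[OF _ chain] max by blast
qed

text \<open>The injection \<open>\<rho>\<close> provides disjoint sets of names: one for \<open>K\<close>, one for the solutions of
  each system, and a spare one. The elements of the union never exhaust the names, so every
  extension needed can be realised within the type.\<close>

lemma exists_difference_closed_extension:
  fixes K :: "'u ring" and S :: "('s, 'x) monoid_scheme"
    and \<rho> :: "('s, 'u) system \<times> 'u \<Rightarrow> 'u" and c :: "('s \<Rightarrow> ('s \<times> nat) multiset \<Rightarrow> 'u) \<Rightarrow> 'u"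
  assumes K: "pseudofield S K actK" and \<rho>: "inj \<rho>" and c: "inj c"
    and K_names: "carrier K \<subseteq> range (\<lambda>u. \<rho> ((0, F0), u))"
  obtains L :: "'u ring" and actL where "difference_closed S L actL" "extends S K actK L actL"
proof -
  define names where "names e = range (\<lambda>u. \<rho> (e, u))" for e
  have disj: "names e \<inter> names e' = {}" if "e \<noteq> e'" for e e'
    using that by (auto simp: names_def inj_eq[OF \<rho>])
  \<comment> \<open>The shift by 2 reserves block 0 for \<open>K\<close> and block 1 as the spare
    one.\<close>
  define sys_names where "sys_names e = names (fst e + 2, snd e)" for e
  \<comment> \<open>An element records a pseudofield over \<open>K\<close> and a set of systems it
    decides. Its elements use only the names of \<open>K\<close> and of those systems, so the names
    of every other system are still free.\<close>
  define good where "good x \<longleftrightarrow>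
      pseudofield S (fst (fst x)) (snd (fst x)) \<and>
      extends S K actK (fst (fst x)) (snd (fst x)) \<and>
      carrier (fst (fst x)) \<subseteq> names (0, F0) \<union> \<Union>(sys_names ` snd x) \<and>
      (\<forall>e\<in>snd x. decides S (fst (fst x)) (snd (fst x)) e)" for x
  define below where "below x y \<longleftrightarrow>
      extends S (fst (fst x)) (snd (fst x)) (fst (fst y)) (snd (fst y)) \<and> snd x \<subseteq> snd y"
    for x y :: "('u ring \<times> ('s \<Rightarrow> 'u \<Rightarrow> 'u)) \<times> ('s, 'u) system set"
  have "((K, actK), {}) \<in> Collect good"
    using K K_names extends_refl[of S K actK] by (simp add: good_def names_def)
  then obtain C where C: "C \<noteq> {}" "C \<subseteq> Collect good"
    and lin: "\<forall>x\<in>C. \<forall>y\<in>C. x = y \<or> below x y \<or> below y x"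
    and max: "\<forall>x\<in>Collect good. (\<forall>y\<in>C. below y x) \<longrightarrow> x \<in> C"
    by (rule exists_maximal_chain[where below = below])
  have good: "good x" if "x \<in> C" for x using C(2) that by blast
  interpret C: difference_ring_chain S "fst ` C"
  proof (rule difference_ring_chain.intro)
    show "fst ` C \<noteq> {}" using C(1) by simp
    show "difference_ring S (fst p) (snd p)" if "p \<in> fst ` C" for p
      using that good
      by (auto simp: good_def pseudofield_def simple_difference_ring_def)
    show "extends S (fst p) (snd p) (fst q) (snd q) \<or> extends S (fst q) (snd q) (fst p) (snd p)"
      if "p \<in> fst ` C" "q \<in> fst ` C" for p q
    proof -
      obtain x y where xy: "x \<in> C" "y \<in> C" "p = fst x" "q = fst y" using \<open>p \<in> _\<close> \<open>q \<in> _\<close> by blast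
      hence "x = y \<or> below x y \<or> below y x" using lin by blast
      thus ?thesis unfolding xy(3,4) below_def using extends_refl by blast
    qed
  qed
  define L where "L = chain_ring (fst ` C)"
  define actL where "actL = chain_act (fst ` C)"
  define D where "D = \<Union>(snd ` C)"
  have L: "pseudofield S L actL"
    unfolding L_def actL_def by (rule C.pseudofield_union) (use good in \<open>auto simp: good_def\<close>)
  interpret L: pseudofield S L actL by (rule L)
  have ext_L: "extends S (fst (fst x)) (snd (fst x)) L actL" if "x \<in> C" for x
    unfolding L_def actL_def by (rule C.chain_difference_hom) (use that in simp)
  have KL: "extends S K actK L actL"
  proof -
    obtain x where x: "x \<in> C" using C(1) by blast
    have "extends S K actK (fst (fst x)) (snd (fst x))" using good[OF x] by (simp add: good_def)
    thus ?thesis by (rule extends_trans[OF _ ext_L[OF x]])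
  qed
  have L_names: "carrier L \<subseteq> names (0, F0) \<union> \<Union>(sys_names ` D)"
  proof
    fix a assume "a \<in> carrier L"
    then obtain x where x: "x \<in> C" "a \<in> carrier (fst (fst x))" by (auto simp: L_def C.carrier_chain)
    hence "a \<in> names (0, F0) \<union> \<Union>(sys_names ` snd x)" using good[OF x(1)] by (auto simp: good_def)
    thus "a \<in> names (0, F0) \<union> \<Union>(sys_names ` D)" using x(1) by (auto simp: D_def)
  qed
  have decides: "decides S L actL e" if e: "e \<in> D" for e
  proof -
    obtain x where x: "x \<in> C" "e \<in> snd x" using e unfolding D_def by blast
    have A: "difference_ring S (fst (fst x)) (snd (fst x))"
      by (rule C.difference_ring) (use x(1) in simp)
    have "decides S (fst (fst x)) (snd (fst x)) e" using good[OF x(1)] x(2) by (simp add: good_def)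
    thus ?thesis
      by (rule decides_mono[OF A L.difference_ring_axioms ext_L[OF x(1)]])
  qed
  \<comment> \<open>Such an \<open>x\<close> lies above the whole chain, so it belongs to the chain
    and contributes nothing new to \<open>D\<close>.\<close>
  have maximal: "snd x \<subseteq> D"
    if x: "good x" "extends S L actL (fst (fst x)) (snd (fst x))" "D \<subseteq> snd x" for x
  proof -
    have "below y x" if y: "y \<in> C" for y
      unfolding below_def
    proof
      show "extends S (fst (fst y)) (snd (fst y)) (fst (fst x)) (snd (fst x))"
        by (rule extends_trans[OF ext_L[OF y] x(2)])
      show "snd y \<subseteq> snd x" using x(3) y unfolding D_def by blast
    qed
    hence "x \<in> C" using max x(1) by blast
    thus ?thesis by (auto simp: D_def)
  qed
  have "ideal_zeros S L actL"
  proof (rule L.ideal_zerosI)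
    fix n I and F :: "('s \<times> nat) multiset \<Rightarrow> ('s \<times> nat) multiset \<Rightarrow> 'u"
    assume I: "difference_ideal S (diff_poly_ring S L n) (L.dp_act n) I"
      "I \<noteq> carrier (diff_poly_ring S L n)" and F: "range F \<subseteq> I"
    have id: "ideal I (diff_poly_ring S L n)"
      using I(1) unfolding difference_ideal_def by (rule conjunct1)
    have over: "system_over S L (n, F)"
      using F ideal.Icarr[OF id] unfolding system_over_def by auto
    obtain B :: "('s \<Rightarrow> ('s \<times> nat) multiset \<Rightarrow> 'u) set ring" and actB h b
      and \<kappa> :: "_ \<Rightarrow> ('s \<Rightarrow> ('s \<times> nat) multiset \<Rightarrow> 'u)" where
      B: "pseudofield S B actB" and h: "h \<in> difference_hom S L actL B actB"
      and b: "common_zero L B actB h n I b" and \<kappa>: "inj_on \<kappa> (carrier B)"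
      using L.exists_pseudofield_zero[OF I] by blast
    interpret B: pseudofield S B actB by (rule B)
    have b: "common_zero L B actB h n (range F) b" using b F unfolding common_zero_def by blast
    \<comment> \<open>The system has a solution in some extension of \<open>L\<close>; any block
      \<open>e\<close> disjoint from \<open>L\<close> can supply the names of its new
      elements.\<close>
    have step: "\<exists>T actT. pseudofield S T actT \<and> extends S L actL T actT \<and> solves T actT (n, F) \<and>
        carrier T \<subseteq> carrier L \<union> names e" if "names e \<inter> carrier L = {}" for e
    proof -
      \<comment> \<open>\<open>\<kappa>\<close> turns elements of \<open>B\<close> into functions,
        \<open>c\<close> encodes these in \<open>'u\<close>, and \<open>\<rho>\<close> moves the
        codes into block \<open>e\<close>.\<close>
      let ?j = "\<lambda>y. \<rho> (e, c (\<kappa> y))"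
      have "inj_on ?j (carrier B)"
        by (rule inj_onI) (simp add: inj_eq[OF c] inj_eq[OF \<rho>] inj_on_eq_iff[OF \<kappa>])
      moreover have "?j ` carrier B \<inter> carrier L = {}" using that by (auto simp: names_def)
      ultimately have j: "inj_on ?j (carrier B)" "?j ` carrier B \<inter> carrier L = {}" .
      from exists_extension_on_superset[OF L B h j]
      obtain T :: "'u ring" and actT g where T: "pseudofield S T actT"
        "carrier T \<subseteq> carrier L \<union> ?j ` carrier B" and g: "g \<in> difference_hom S B actB T actT"
        and gh: "\<And>x. x \<in> carrier L \<Longrightarrow> g (h x) = x" by blast
      interpret T: pseudofield S T actT by (rule T)
      have "(\<lambda>x. g (h x)) \<in> difference_hom S L actL T actT" by (rule difference_hom_comp[OF h g])
      hence ext: "extends S L actL T actT"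
        using gh by (auto simp: difference_hom_def ring_hom_def L.act_closed Pi_iff)
      have "solves T actT (n, F)"
        using common_zero_difference_hom[OF L.difference_ring_axioms B.difference_ring_axioms
            T.difference_ring_axioms ext h g gh _ b] over
        by (auto simp: solves_def system_over_def)
      moreover have "carrier T \<subseteq> carrier L \<union> names e" using T(2) by (auto simp: names_def)
      ultimately show ?thesis using T(1) ext by blast
    qed
    have "solves L actL (n, F)"
    proof (cases "(n, F) \<in> D")
      case True
      \<comment> \<open>The extension built from the spare block merely witnesses solvability. As
        \<open>L\<close> decides the system, a solution in \<open>L\<close> follows.\<close>
      have "names (1, F0) \<inter> sys_names e = {}" for e unfolding sys_names_def by (rule disj) simp
      hence "names (1, F0) \<inter> carrier L = {}" using L_names disj[of "(1, F0)" "(0, F0)"] by fastforce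
      from step[OF this] show ?thesis using decides[OF True] unfolding decides_def by blast
    next
      case False
      \<comment> \<open>The block reserved for this system is untouched, because the system is not
        in \<open>D\<close>. The extension built there decides it by solving it, which contradicts
        maximality.\<close>
      let ?e = "(n + 2, F)"
      have "names ?e \<inter> sys_names e = {}" if "e \<in> D" for e
        unfolding sys_names_def by (rule disj) (use that False in \<open>auto simp: prod_eq_iff\<close>)
      hence "names ?e \<inter> carrier L = {}" using L_names disj[of ?e "(0, F0)"] by fastforce
      from step[OF this] obtain T actT where T: "pseudofield S T actT" "extends S L actL T actT"
        "solves T actT (n, F)" "carrier T \<subseteq> carrier L \<union> names ?e" by blast
      interpret T: pseudofield S T actT by (rule T)
      note mono = L.difference_ring_axioms T.difference_ring_axioms T(2)
      have "decides S T actT (n, F)"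
        using system_over_mono[OF mono over] T(3) by (simp add: decides_def)
      moreover have "decides S T actT e" if "e \<in> D" for e
        by (rule decides_mono[OF mono decides[OF that]])
      moreover have "carrier T \<subseteq> names (0, F0) \<union> \<Union>(sys_names ` insert (n, F) D)"
        using T(4) L_names by (auto simp: sys_names_def)
      ultimately have "good ((T, actT), insert (n, F) D)"
        using T(1) extends_trans[OF KL T(2)] by (simp add: good_def)
      from maximal[OF this] T(2) False show ?thesis by auto
    qed
    thus "\<exists>b. common_zero L L actL (\<lambda>x. x) n (range F) b" by (simp add: solves_def)
  qed
  hence "difference_closed S L actL"
    using L L.extension_zerosI by (simp add: difference_closed_def)
  thus thesis using that KL by blast
qed

section \<open>Cardinalities\<close>

text \<open>An infinite type is equinumerous with its square.\<close>

lemma exists_inj_pair: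
  fixes f :: "'a \<Rightarrow> 'c" and g :: "'b \<Rightarrow> 'c"
  assumes "infinite (UNIV :: 'c set)" "inj f" "inj g"
  shows "\<exists>h :: 'a \<times> 'b \<Rightarrow> 'c. inj h"
proof -
  obtain k :: "'c \<times> 'c \<Rightarrow> 'c" where k: "inj k"
    using card_of_Times_same_infinite[OF assms(1)] card_of_ordIso[of "UNIV \<times> UNIV :: ('c \<times> 'c) set" "UNIV :: 'c set"]
    by (auto simp: bij_betw_def)
  have "inj (\<lambda>(x, y). k (f x, g y))"
    by (rule injI) (auto simp: inj_eq[OF k] inj_eq[OF assms(2)] inj_eq[OF assms(3)])
  thus ?thesis by blast
qed

text \<open>A set-valued function is determined by its graph, a subset of the product, and the
  product embeds into \<open>'a\<close>.\<close>

lemma exists_inj_fun_set: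
  fixes f :: "'c \<Rightarrow> 'a"
  assumes "infinite (UNIV :: 'a set)" "inj f"
  shows "\<exists>h :: ('c \<Rightarrow> 'a set) \<Rightarrow> 'a set. inj h"
proof -
  obtain k :: "'c \<times> 'a \<Rightarrow> 'a" where k: "inj k"
    using exists_inj_pair[OF assms inj_on_id] by blast
  have "inj (\<lambda>g. k ` {(x, y). y \<in> g x})"
  proof (rule injI)
    fix g g' :: "'c \<Rightarrow> 'a set" assume "k ` {(x, y). y \<in> g x} = k ` {(x, y). y \<in> g' x}"
    hence "{(x, y). y \<in> g x} = {(x, y). y \<in> g' x}" using k by (simp add: inj_image_eq_iff)
    thus "g = g'" by (auto simp: set_eq_iff fun_eq_iff)
  qed
  thus ?thesis by blast
qed

text \<open>A multiset is encoded by the region below the graph of its multiplicity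
  function.\<close>

lemma exists_inj_multiset:
  assumes "infinite (UNIV :: 'c set)" "inj (f :: 'a \<Rightarrow> 'c)"
  shows "\<exists>h :: 'a multiset \<Rightarrow> 'c set. inj h"
proof -
  obtain i :: "nat \<Rightarrow> 'c" where "inj i" using infinite_countable_subset[OF assms(1)] by blast
  then obtain k :: "'a \<times> nat \<Rightarrow> 'c" where k: "inj k" using exists_inj_pair[OF assms] by blast
  have "inj (\<lambda>m. k ` {(x, j). j < count m x})"
  proof (rule injI)
    fix m m' assume "k ` {(x, j). j < count m x} = k ` {(x, j). j < count m' x}"
    hence "{(x, j). j < count m x} = {(x, j). j < count m' x}" using k by (simp add: inj_image_eq_iff)
    hence "j < count m x \<longleftrightarrow> j < count m' x" for j x by blast
    thus "m = m'" by (metis multiset_eqI linorder_neqE_nat less_irrefl)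
  qed
  thus ?thesis by blast
qed

section \<open>Choice of names and the embedding theorem\<close>

theorem theorem25:
  fixes S :: "('s, 'x) monoid_scheme"
    and K :: "('k, 'm) ring_scheme"
    and act :: "'s \<Rightarrow> 'k \<Rightarrow> 'k"
  assumes "group S" and "infinite (carrier S)"
    and "pseudofield S K act"
  shows "\<exists>(L :: ('k + 's) set set ring) actL h.
           difference_closed S L actL \<and>
           h \<in> difference_hom S K act L actL \<and> inj_on h (carrier K)"
proof -
  interpret K: pseudofield S K act by (rule assms(3))
  \<comment> \<open>Infinitude of the group makes \<open>'k + 's\<close> infinite, so that variables
    embed into it and monomials into its subsets.\<close>
  have "infinite (UNIV :: 's set)" using infinite_super[OF subset_UNIV assms(2)] .
  hence ks: "infinite (UNIV :: ('k + 's) set)" by simp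
  have a: "infinite (UNIV :: ('k + 's) set set)" using ks by (simp add: Finite_Set.finite_set)
  have u: "infinite (UNIV :: ('k + 's) set set set)" using a by (simp add: Finite_Set.finite_set)
  obtain i :: "nat \<Rightarrow> 'k + 's" where "inj i" using infinite_countable_subset[OF ks] by blast
  then obtain sn :: "'s \<times> nat \<Rightarrow> 'k + 's" where "inj sn"
    using exists_inj_pair[OF ks inj_Inr] by blast
  then obtain m :: "('s \<times> nat) multiset \<Rightarrow> ('k + 's) set" where m: "inj m"
    using exists_inj_multiset[OF ks] by blast
  have s': "inj (\<lambda>x :: 's. {Inr x :: 'k + 's})" by (simp add: inj_on_def)
  \<comment> \<open>Functions from a small type into sets of sets embed into sets of sets. This
    absorbs the extensions to be named (\<open>c\<close>) and the families of polynomials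
    (\<open>e\<close>).\<close>
  obtain sm :: "'s \<times> ('s \<times> nat) multiset \<Rightarrow> ('k + 's) set" where "inj sm"
    using exists_inj_pair[OF a s' m] by blast
  then obtain c :: "('s \<times> ('s \<times> nat) multiset \<Rightarrow> ('k + 's) set set) \<Rightarrow> ('k + 's) set set" where c: "inj c"
    using exists_inj_fun_set[OF a] by blast
  obtain mm :: "('s \<times> nat) multiset \<times> ('s \<times> nat) multiset \<Rightarrow> ('k + 's) set" where "inj mm"
    using exists_inj_pair[OF a m m] by blast
  then obtain e :: "(('s \<times> nat) multiset \<times> ('s \<times> nat) multiset \<Rightarrow> ('k + 's) set set) \<Rightarrow> ('k + 's) set set"
    where e: "inj e" using exists_inj_fun_set[OF a] by blast
  have curry: "inj (\<lambda>f :: 'v \<Rightarrow> 'w \<Rightarrow> 'z. \<lambda>(x, y). f x y)"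
    by (rule inj_on_inverseI[where g = curry]) (auto simp: fun_eq_iff)
  have c': "inj (\<lambda>f :: 's \<Rightarrow> ('s \<times> nat) multiset \<Rightarrow> ('k + 's) set set. c (\<lambda>(x, y). f x y))"
    using inj_compose[OF c curry] by (simp add: comp_def)
  have e': "inj (\<lambda>f :: ('s \<times> nat) multiset \<Rightarrow> ('s \<times> nat) multiset \<Rightarrow> ('k + 's) set set. e (\<lambda>(x, y). f x y))"
    using inj_compose[OF e curry] by (simp add: comp_def)
  obtain i' :: "nat \<Rightarrow> ('k + 's) set set" where "inj i'" using infinite_countable_subset[OF u] by blast
  then obtain sys :: "('s, ('k + 's) set set) system \<Rightarrow> ('k + 's) set set" where "inj sys"
    using exists_inj_pair[OF u _ e'] by blast
  then obtain \<rho> :: "('s, ('k + 's) set set) system \<times> ('k + 's) set set \<Rightarrow> ('k + 's) set set"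
    where \<rho>: "inj \<rho>" using exists_inj_pair[OF u _ inj_on_id] by blast
  \<comment> \<open>Places the copy of \<open>K\<close> in block 0, as the chain construction
    requires.\<close>
  define k where "k x = \<rho> ((0, undefined), {{Inl x}})" for x :: 'k
  have "inj_on k (carrier K)" by (auto simp: k_def inj_eq[OF \<rho>] intro!: inj_onI)
  then obtain K' :: "('k + 's) set set ring" and actK' where K': "pseudofield S K' actK'"
    "carrier K' = k ` carrier K" and kK: "k \<in> difference_hom S K act K' actK'"
    using K.exists_pseudofield_image by blast
  have "carrier K' \<subseteq> range (\<lambda>u. \<rho> ((0, undefined), u))" unfolding K'(2) by (auto simp: k_def)
  from exists_difference_closed_extension[OF K'(1) \<rho> c' this]
  obtain L :: "('k + 's) set set ring" and actL where L: "difference_closed S L actL"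
    and ext: "extends S K' actK' L actL" by blast
  have "k \<in> difference_hom S K act L actL" using difference_hom_comp[OF kK ext] .
  thus ?thesis using L \<open>inj_on k (carrier K)\<close> by blast
qed

end
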